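(* Let $\Omega\subset\mathbb{R}^n$ be a domain. If $\Omega$ is an $(\epsilon,\delta)$-domain, then there is a constant $\lambda_0>0$ such that for each $0<\lambda\le\lambda_0$ there is a bounded linear extension operator $T_\lambda:\mathrm{bmo}_\lambda(\Omega)\to\mathrm{bmo}(\mathbb{R}^n)$. Conversely, if for some $\lambda>0$ there is a bounded extension operator $T_\lambda:\mathrm{bmo}_\lambda(\Omega)\to\mathrm{bmo}(\mathbb{R}^n)$, then $\Omega$ is an $(\epsilon,\delta)$-domain for some $\epsilon,\delta>0$ depending on $\lambda$.
   Context: A domain is a nonempty open connected set. $Q$ always denotes a closed cube with sides parallel to the axes, $\ell(Q)$ its sidelength, $f_Q=\frac1{|Q|}\int_Q f\,dx$ the mean of $f$ over $Q$, and $|f|_Q=\frac1{|Q|}\int_Q|f|\,dx$. For $\lambda>0$, $\mathrm{bmo}_\lambda(\Omega)$ is the set of functions $f$ on $\Omega$ that are integrable on every cube $Q\subset\Omega$ and satisfy $$\|f\|_{\mathrm{bmo}_\lambda(\Omega)}:=\sup_{Q\subset\Omega,\ \ell(Q)<\lambda}\frac1{|Q|}\int_Q|f(x)-f_Q|\,dx+\sup_{Q\subset\Omega,\ \ell(Q)\ge\lambda}|f|_Q<\infty$$ (if $\Omega$ contains no cube of sidelength at least $\lambda$, the second supremum is $0$). $\mathrm{bmo}(\mathbb{R}^n)$ is the set of locally integrable $f$ on $\mathbb{R}^n$ with $$\|f\|_{\mathrm{bmo}(\mathbb{R}^n)}:=\sup_{\ell(Q)<1}\frac1{|Q|}\int_Q|f(x)-f_Q|\,dx+\sup_{\ell(Q)\ge1}|f|_Q<\infty,$$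 suprema over all cubes $Q\subset\mathbb{R}^n$. An extension operator $T$ is a map with $Tf=f$ on $\Omega$ for every $f$; it is bounded if there is a constant $C$ with $\|Tf\|_{\mathrm{bmo}(\mathbb{R}^n)}\le C\|f\|_{\mathrm{bmo}_\lambda(\Omega)}$ for all $f\in\mathrm{bmo}_\lambda(\Omega)$ (linearity is asserted only where stated). Let $d_\Omega(z)=\mathrm{dist}(z,\partial\Omega)$ (with $d_\Omega\equiv+\infty$ if $\Omega=\mathbb{R}^n$). For $\epsilon,\delta>0$, $\Omega$ is an $(\epsilon,\delta)$-domain if any distinct $x,y\in\Omega$ with $|x-y|<\delta$ can be joined by a rectifiable curve $\gamma\subset\Omega$ whose arclength $s(\gamma)$ satisfies $s(\gamma)\le\epsilon^{-1}|x-y|$ and such that $d_\Omega(z)\ge\epsilon\frac{|z-x||z-y|}{|x-y|}$ for all $z\in\gamma$. *)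

theory Defs
  imports "HOL-Analysis.Analysis"
begin

definition is_domain :: "(real^'n) set \<Rightarrow> bool" where
  "is_domain \<Omega> \<longleftrightarrow> \<Omega> \<noteq> {} \<and> open \<Omega> \<and> connected \<Omega>"

definition cube :: "real^'n \<Rightarrow> real \<Rightarrow> (real^'n) set" where
  "cube a l = cbox a (a + (\<chi> i. l))"

definition mean_on :: "(real^'n) set \<Rightarrow> (real^'n \<Rightarrow> real) \<Rightarrow> real" where
  "mean_on Q f = (1 / measure lebesgue Q) * (LINT x:Q|lebesgue. f x)"

(* Suprema are taken in ennreal, where the supremum of the empty set is 0.  The value is only
   meaningful for f integrable on every cube in the set, because non-integrable functions have
   Bochner integral 0. *)
definition bmo_norm :: "real \<Rightarrow> (real^'n) set \<Rightarrow> (real^'n \<Rightarrow> real) \<Rightarrow> ennreal" where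
  "bmo_norm lam \<Omega> f =
     (SUP (a, l) \<in> {(a, l). 0 < l \<and> l < lam \<and> cube a l \<subseteq> \<Omega>}.
        ennreal (mean_on (cube a l) (\<lambda>x. \<bar>f x - mean_on (cube a l) f\<bar>)))
   + (SUP (a, l) \<in> {(a, l). 0 < l \<and> lam \<le> l \<and> cube a l \<subseteq> \<Omega>}.
        ennreal (mean_on (cube a l) (\<lambda>x. \<bar>f x\<bar>)))"

(* A function on \<Omega> is represented by a total function whose values off \<Omega> are irrelevant. *)
definition bmo_on :: "real \<Rightarrow> (real^'n) set \<Rightarrow> (real^'n \<Rightarrow> real) set" where
  "bmo_on lam \<Omega> = {f. (\<forall>a l. 0 < l \<and> cube a l \<subseteq> \<Omega> \<longrightarrow> set_integrable lebesgue (cube a l) f)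
                   \<and> bmo_norm lam \<Omega> f < \<infinity>}"

definition bmo_Rn_norm :: "(real^'n \<Rightarrow> real) \<Rightarrow> ennreal" where
  "bmo_Rn_norm f = bmo_norm 1 UNIV f"

definition bmo_Rn :: "(real^'n \<Rightarrow> real) set" where
  "bmo_Rn = {f. (\<forall>K. compact K \<longrightarrow> set_integrable lebesgue K f) \<and> bmo_Rn_norm f < \<infinity>}"

(* The second conjunct makes T a map on functions on \<Omega>: T f depends only on the values of f
   on \<Omega>. *)
definition extension_operator ::
    "real \<Rightarrow> (real^'n) set \<Rightarrow> ((real^'n \<Rightarrow> real) \<Rightarrow> (real^'n \<Rightarrow> real)) \<Rightarrow> bool" where
  "extension_operator lam \<Omega> T \<longleftrightarrow>
     (\<forall>f \<in> bmo_on lam \<Omega>. T f \<in> bmo_Rn) \<and>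
     (\<forall>f \<in> bmo_on lam \<Omega>. \<forall>g \<in> bmo_on lam \<Omega>. (\<forall>x\<in>\<Omega>. f x = g x) \<longrightarrow> T f = T g) \<and>
     (\<forall>f \<in> bmo_on lam \<Omega>. \<forall>x\<in>\<Omega>. T f x = f x)"

definition bounded_operator ::
    "real \<Rightarrow> (real^'n) set \<Rightarrow> ((real^'n \<Rightarrow> real) \<Rightarrow> (real^'n \<Rightarrow> real)) \<Rightarrow> bool" where
  "bounded_operator lam \<Omega> T \<longleftrightarrow>
     (\<exists>C::real. \<forall>f \<in> bmo_on lam \<Omega>. bmo_Rn_norm (T f) \<le> ennreal C * bmo_norm lam \<Omega> f)"

definition linear_operator ::
    "real \<Rightarrow> (real^'n) set \<Rightarrow> ((real^'n \<Rightarrow> real) \<Rightarrow> (real^'n \<Rightarrow> real)) \<Rightarrow> bool" where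
  "linear_operator lam \<Omega> T \<longleftrightarrow>
     (\<forall>f \<in> bmo_on lam \<Omega>. \<forall>g \<in> bmo_on lam \<Omega>. \<forall>a b :: real.
        T (\<lambda>x. a * f x + b * g x) = (\<lambda>x. a * T f x + b * T g x))"

(* Least upper bound of the lengths of inscribed polygons; finite iff the curve is rectifiable. *)
definition arclength :: "(real \<Rightarrow> real^'n) \<Rightarrow> ennreal" where
  "arclength \<gamma> =
     (SUP (k, t) \<in> {(k :: nat, t :: nat \<Rightarrow> real). mono t \<and> range t \<subseteq> {0..1}}.
        \<Sum>i<k. ennreal (dist (\<gamma> (t i)) (\<gamma> (t (Suc i)))))"

definition dist_boundary :: "(real^'n) set \<Rightarrow> real^'n \<Rightarrow> ereal" where
  "dist_boundary \<Omega> z = (if \<Omega> = UNIV then \<infinity> else ereal (infdist z (frontier \<Omega>)))"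

definition eps_delta_domain :: "real \<Rightarrow> real \<Rightarrow> (real^'n) set \<Rightarrow> bool" where
  "eps_delta_domain \<epsilon> \<delta> \<Omega> \<longleftrightarrow>
     (\<forall>x\<in>\<Omega>. \<forall>y\<in>\<Omega>. x \<noteq> y \<and> dist x y < \<delta> \<longrightarrow>
        (\<exists>\<gamma>. path \<gamma> \<and> path_image \<gamma> \<subseteq> \<Omega> \<and> pathstart \<gamma> = x \<and> pathfinish \<gamma> = y \<and>
             arclength \<gamma> < \<infinity> \<and> arclength \<gamma> \<le> ennreal (dist x y / \<epsilon>) \<and>
             (\<forall>z \<in> path_image \<gamma>.
                dist_boundary \<Omega> z \<ge> ereal (\<epsilon> * (dist z x * dist z y / dist x y)))))"

end

theory Submission
  imports Defs
begin

text \<open>Both directions compare points of \<open>\<Omega>\<close> through chains whose steps are small multiples of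
the distance \<open>d\<close> to the boundary, a discrete quasi-hyperbolic metric.

Necessity: the truncated chain distance to the set formed by one point and all points of depth at
least \<open>r\<close> has bmo norm bounded by a dimensional constant. Telescoping the means of its extension over
dyadic cubes bounds chain lengths logarithmically by the ratio of Euclidean distance to depth. Along a minimal
chain from a point to depth \<open>r\<close> this forces the Gehring--Osgood carrot estimate, and two
carrots of depth comparable to \<open>\<bar>x - y\<bar>\<close> are joined by a chain of bounded length.

Sufficiency: outside \<open>\<Omega>\<close> the extension takes the mean of \<open>f\<close> over a small cube around a reflected
point of comparable depth, chosen from a countable dense set, and it is cut off at a fixed distance
from the boundary. In place of a Whitney decomposition and a layer-by-layer sum, the oscillation over
cubes near the boundary is bounded by recursion over subdivisions: since the boundary is porous, one
subcube always stays away from it, and the resulting factor below one closes the recursion.\<close>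

section \<open>Cubes and mean values\<close>

text \<open>The two-part norm shapes both directions. A test function for necessity must also have
  bounded means over cubes of side at least lambda, which a chain distance to one point does not
  have; adding all points of depth at least r, with r \<le> lambda/2, makes it vanish at the centers
  of those cubes. The price is that a short chain may end at depth r instead of at the given point.
  For a minimal chain to depth r this is harmless, and for two points of depth about r it is ruled
  out by asking for depth M r, which a chain of bounded length cannot reach. Truncation makes the
  test function bounded and integrable, and the bmo bound does not see the truncation level, which
  is then set just above the chain length to be proved. In the other direction lambda has to be
  small so that, at the depth where the extension is cut off, every average of f involved is already
  bounded by the second supremum. Curves are used at one scale at a time only: any two averages that
  are compared belong to points whose depths and distance are all comparable.\<close>

abbreviation deviation :: "(real^'n \<Rightarrow> real) \<Rightarrow> real \<Rightarrow> real^'n \<Rightarrow> real \<Rightarrow> ennreal" where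
  "deviation g k a l \<equiv> (\<integral>\<^sup>+x. ennreal \<bar>g x - k\<bar> * indicator (cube a l) x \<partial>lebesgue)"

lemma mem_cube: "x \<in> cube a l \<longleftrightarrow> (\<forall>i. a$i \<le> x$i \<and> x$i \<le> a$i + l)"
  by (auto simp: cube_def mem_box_cart)

text \<open>Balls of the maximum norm: center and half side suit chains and doubling, while the
  corner form \<open>cube\<close> suits subdivision.\<close>

definition ccube :: "real^'n \<Rightarrow> real \<Rightarrow> (real^'n) set" where
  "ccube p h = cube (p - (\<chi> i. h)) (2 * h)"

lemma mem_ccube: "x \<in> ccube p h \<longleftrightarrow> (\<forall>i. \<bar>x$i - p$i\<bar> \<le> h)"
  unfolding ccube_def mem_cube by (simp add: abs_le_iff algebra_simps) (smt (verit))

lemma cube_sets[measurable, simp]: "cube a l \<in> sets lebesgue" "cube a l \<in> sets borel"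
  by (auto simp: cube_def)

lemma cube_lmeasurable[simp]: "cube a l \<in> lmeasurable"
  by (simp add: cube_def)

lemma measure_cube:
  fixes a :: "real^'n"
  assumes "0 \<le> l"
  shows "measure lebesgue (cube a l) = l ^ CARD('n)"
proof -
  have "cube a l \<noteq> {}" using assms by (auto simp: mem_cube set_eq_iff intro!: exI[of _ a])
  then show ?thesis
    unfolding cube_def by (simp add: content_cbox_cart)
qed

lemma content_cube:
  fixes a :: "real^'n"
  assumes "0 \<le> l"
  shows "measure lborel (cube a l) = l ^ CARD('n)"
  using measure_cube[OF assms, of a] by simp

lemma emeasure_cube:
  fixes a :: "real^'n"
  assumes "0 \<le> l"
  shows "emeasure lebesgue (cube a l) = ennreal (l ^ CARD('n))"
  using measure_cube[OF assms, of a] cube_lmeasurable[of a l]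
  by (simp add: emeasure_eq_measure2)

lemma compact_cube: "compact (cube a l)"
  by (simp add: cube_def)

lemma dist_cube_le:
  fixes x y :: "real^'n"
  assumes "x \<in> cube a l" "y \<in> cube a l"
  shows "dist x y \<le> real CARD('n) * l"
proof -
  have "dist x y \<le> (\<Sum>i\<in>UNIV. \<bar>(x - y) $ i\<bar>)"
    unfolding dist_norm by (rule norm_le_l1_cart)
  also have "\<dots> \<le> (\<Sum>i\<in>(UNIV::'n set). l)"
    using assms by (intro sum_mono) (auto simp: mem_cube, smt (verit))
  finally show ?thesis by simp
qed

lemma dist_ccube_le:
  fixes x p :: "real^'n"
  assumes "x \<in> ccube p h"
  shows "dist x p \<le> real CARD('n) * h"
proof -
  have "dist x p \<le> (\<Sum>i\<in>UNIV. \<bar>(x - p) $ i\<bar>)"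
    unfolding dist_norm by (rule norm_le_l1_cart)
  also have "\<dots> \<le> (\<Sum>i\<in>(UNIV::'n set). h)"
    using assms by (intro sum_mono) (auto simp: mem_ccube)
  finally show ?thesis by simp
qed

lemma ccubeI:
  fixes x p :: "real^'n"
  assumes "dist x p \<le> h"
  shows "x \<in> ccube p h"
  unfolding mem_ccube
  by (metis assms component_le_norm_cart dist_norm order_trans vector_minus_component)

lemma ccube_subset:
  fixes p q :: "real^'n"
  assumes "dist p q + h \<le> k"
  shows "ccube p h \<subseteq> ccube q k"
proof
  fix x assume x: "x \<in> ccube p h"
  have "\<bar>p$i - q$i\<bar> \<le> dist p q" for i
    by (metis component_le_norm_cart dist_norm vector_minus_component)
  moreover have "\<bar>x$i - p$i\<bar> \<le> h" for i using x unfolding mem_ccube by blast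
  ultimately show "x \<in> ccube q k"
    unfolding mem_ccube using assms abs_triangle_ineq4 by (smt (verit, best))
qed

lemma set_integrable_const_cube: "set_integrable lebesgue (cube a l) (\<lambda>x. c::real)"
  using cube_lmeasurable[of a l] unfolding set_integrable_def lmeasurable_iff_integrable
  by (rule integrable_scaleR_left)

lemma set_integral_const_cube:
  fixes a :: "real^'n"
  assumes "0 \<le> l" shows "(LINT x:cube a l|lebesgue. (c::real)) = l ^ CARD('n) * c"
  using cube_lmeasurable[of a l] 
  by (subst set_integral_const) (auto simp: measure_cube[OF assms] fmeasurable_def)

lemma mean_on_const:
  assumes "0 < l" shows "mean_on (cube a l) (\<lambda>x. c) = c"
  using assms by (simp add: mean_on_def content_cube set_integral_const_cube)

lemma mean_on_mono:
  assumes "set_integrable lebesgue (cube a l) f" "set_integrable lebesgue (cube a l) g"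
    and "\<And>x. x \<in> cube a l \<Longrightarrow> f x \<le> g x"
  shows "mean_on (cube a l) f \<le> mean_on (cube a l) g"
  unfolding mean_on_def
  by (intro mult_left_mono set_integral_mono assms) auto

lemma mean_on_add:
  assumes "set_integrable lebesgue (cube a l) f" "set_integrable lebesgue (cube a l) g"
  shows "mean_on (cube a l) (\<lambda>x. f x + g x) = mean_on (cube a l) f + mean_on (cube a l) g"
  unfolding mean_on_def using set_integral_add(2)[OF assms] by (simp add: algebra_simps)

lemma mean_on_cmult: "mean_on Q (\<lambda>x. c * f x) = c * mean_on Q f"
  unfolding mean_on_def by simp

lemma mean_on_cong: "(\<And>x. x \<in> Q \<Longrightarrow> f x = g x) \<Longrightarrow> mean_on Q f = mean_on Q g"
  unfolding mean_on_def set_lebesgue_integral_def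
  by (intro arg_cong[where f="\<lambda>z. _ * z"] Bochner_Integration.integral_cong) (auto simp: indicator_def)

lemma set_integrable_dev:
  assumes "set_integrable lebesgue (cube a l) f"
  shows "set_integrable lebesgue (cube a l) (\<lambda>x. f x - (c::real))"
    "set_integrable lebesgue (cube a l) (\<lambda>x. \<bar>f x - (c::real)\<bar>)"
  using set_integral_diff(1)[OF assms set_integrable_const_cube[of a l c]]
  by (auto intro: set_integrable_abs)

lemma mean_on_dev:
  assumes "set_integrable lebesgue (cube a l) f" "0 < l"
  shows "mean_on (cube a l) (\<lambda>x. f x - c) = mean_on (cube a l) f - c"
  using mean_on_add[OF assms(1) set_integrable_const_cube[of a l "-c"]] mean_on_const[OF assms(2), of a "-c"]
  by simp

text \<open>Shrinking the domain of the mean costs at most the volume ratio of the two cubes. With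
  equal cubes and \<open>K = 1\<close> this is the bound of \<open>\<bar>f_Q - c\<bar>\<close> by
  the mean of \<open>\<bar>f - c\<bar>\<close>.\<close>

lemma mean_on_dev_le_subcube:
  fixes a b :: "real^'n"
  assumes f: "set_integrable lebesgue (cube b L) f" and sub: "cube a l \<subseteq> cube b L" 
    and l: "0 < l" and L: "L \<le> K * l"
  shows "\<bar>mean_on (cube a l) f - c\<bar> \<le> K ^ CARD('n) * mean_on (cube b L) (\<lambda>x. \<bar>f x - c\<bar>)"
proof -
  have fa: "set_integrable lebesgue (cube a l) f"
    by (rule set_integrable_subset[OF f _ sub]) auto
  have "a \<in> cube a l" "a + (\<chi> i. l) \<in> cube a l" using l by (auto simp: mem_cube)
  then have "a \<in> cube b L" "a + (\<chi> i. l) \<in> cube b L" using sub by auto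
  then have "b$i \<le> a$i \<and> a$i + l \<le> b$i + L" for i by (auto simp: mem_cube)
  \<comment> \<open>Any coordinate will do, since the index type is nonempty.\<close>
  from this[of undefined] have lL: "l \<le> L" by linarith
  have pos: "0 < K ^ CARD('n)" using l L lL
    by (smt (verit) mult_pos_pos zero_less_mult_iff zero_less_power)
  have "\<bar>mean_on (cube a l) f - c\<bar> = \<bar>mean_on (cube a l) (\<lambda>x. f x - c)\<bar>"
    by (simp add: mean_on_dev[OF fa l])
  also have "\<dots> \<le> mean_on (cube a l) (\<lambda>x. \<bar>f x - c\<bar>)"
  proof -
    have "\<bar>LINT x:cube a l|lebesgue. f x - c\<bar> \<le> (LINT x:cube a l|lebesgue. \<bar>f x - c\<bar>)"
      using set_integral_norm_bound[OF set_integrable_dev(1)[OF fa, of c]] by simp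
    then show ?thesis unfolding mean_on_def
      by (simp add: abs_mult divide_right_mono)
  qed
  also have "\<dots> \<le> (1 / l ^ CARD('n)) * (LINT x:cube b L|lebesgue. \<bar>f x - c\<bar>)"
  proof -
    have "(LINT x:cube a l|lebesgue. \<bar>f x - c\<bar>) \<le> (LINT x:cube b L|lebesgue. \<bar>f x - c\<bar>)"
      using sub set_integrable_dev(2)[OF fa, of c] set_integrable_dev(2)[OF f, of c]
      unfolding set_lebesgue_integral_def set_integrable_def
      by (intro integral_mono) (auto simp: indicator_def)
    then show ?thesis using l by (simp add: mean_on_def content_cube divide_right_mono)
  qed
  also have "\<dots> = (L / l) ^ CARD('n) * mean_on (cube b L) (\<lambda>x. \<bar>f x - c\<bar>)"
    using l lL by (simp add: mean_on_def content_cube power_divide)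
  also have "\<dots> \<le> K ^ CARD('n) * mean_on (cube b L) (\<lambda>x. \<bar>f x - c\<bar>)"
  proof (intro mult_right_mono power_mono)
    show "L / l \<le> K" using l L by (simp add: field_simps)
    show "0 \<le> mean_on (cube b L) (\<lambda>x. \<bar>f x - c\<bar>)"
      by (auto simp: mean_on_def set_lebesgue_integral_def)
  qed (use l lL in auto)
  finally show ?thesis .
qed

text \<open>At the cost of a factor 2, oscillation may be measured from whichever constant is at
  hand, such as a value at the center or an average over another cube.\<close>

lemma mean_osc_le:
  fixes a :: "real^'n"
  assumes f: "set_integrable lebesgue (cube a l) f" and l: "0 < l"
  shows "mean_on (cube a l) (\<lambda>x. \<bar>f x - mean_on (cube a l) f\<bar>) \<le> 2 * mean_on (cube a l) (\<lambda>x. \<bar>f x - c\<bar>)"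
proof -
  let ?m = "mean_on (cube a l) f"
  have 1: "\<bar>?m - c\<bar> \<le> mean_on (cube a l) (\<lambda>x. \<bar>f x - c\<bar>)"
    using mean_on_dev_le_subcube[OF f subset_refl l, of 1] by simp
  have "mean_on (cube a l) (\<lambda>x. \<bar>f x - ?m\<bar>) \<le> mean_on (cube a l) (\<lambda>x. \<bar>f x - c\<bar> + \<bar>?m - c\<bar>)"
    by (intro mean_on_mono set_integrable_dev f set_integral_add(1) set_integrable_const_cube) auto
  also have "\<dots> = mean_on (cube a l) (\<lambda>x. \<bar>f x - c\<bar>) + \<bar>?m - c\<bar>"
    by (simp add: mean_on_add set_integrable_dev f set_integrable_const_cube mean_on_const[OF l])
  finally show ?thesis using 1 by simp
qed

lemma bmo_norm_le:
  assumes "\<And>a l. 0 < l \<Longrightarrow> l < lam \<Longrightarrow> cube a l \<subseteq> \<Omega> \<Longrightarrow> 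
             mean_on (cube a l) (\<lambda>x. \<bar>f x - mean_on (cube a l) f\<bar>) \<le> A"
    and "\<And>a l. 0 < l \<Longrightarrow> lam \<le> l \<Longrightarrow> cube a l \<subseteq> \<Omega> \<Longrightarrow> mean_on (cube a l) (\<lambda>x. \<bar>f x\<bar>) \<le> B"
    and "0 \<le> A" "0 \<le> B"
  shows "bmo_norm lam \<Omega> f \<le> ennreal (A + B)"
  unfolding bmo_norm_def ennreal_plus[OF assms(3,4)]
  by (intro add_mono SUP_least) (auto intro!: ennreal_leI assms)

lemma bmo_norm_ge:
  assumes "bmo_norm lam \<Omega> f \<le> ennreal N" "0 \<le> N" "0 < l" "cube a l \<subseteq> \<Omega>"
  shows "l < lam \<Longrightarrow> mean_on (cube a l) (\<lambda>x. \<bar>f x - mean_on (cube a l) f\<bar>) \<le> N"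
    and "lam \<le> l \<Longrightarrow> mean_on (cube a l) (\<lambda>x. \<bar>f x\<bar>) \<le> N"
proof -
  assume "l < lam"
  then have "ennreal (mean_on (cube a l) (\<lambda>x. \<bar>f x - mean_on (cube a l) f\<bar>)) \<le> bmo_norm lam \<Omega> f"
    unfolding bmo_norm_def using assms by (intro add_increasing2[OF zero_le] SUP_upper2[of "(a,l)"]) auto
  then show "mean_on (cube a l) (\<lambda>x. \<bar>f x - mean_on (cube a l) f\<bar>) \<le> N"
    using assms(1,2) by (meson ennreal_le_iff order_trans)
next
  assume "lam \<le> l"
  then have "ennreal (mean_on (cube a l) (\<lambda>x. \<bar>f x\<bar>)) \<le> bmo_norm lam \<Omega> f"
    unfolding bmo_norm_def using assms by (intro add_increasing[OF zero_le] SUP_upper2[of "(a,l)"]) auto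
  then show "mean_on (cube a l) (\<lambda>x. \<bar>f x\<bar>) \<le> N"
    using assms(1,2) by (meson ennreal_le_iff order_trans)
qed

text \<open>From side \<open>lam\<close> on, the mean of \<open>\<bar>f\<bar>\<close> dominates the
  oscillation. The threshold thus disappears wherever only oscillation matters.\<close>

lemma bmo_norm_osc:
  assumes "bmo_norm lam \<Omega> f \<le> ennreal N" "0 \<le> N" "0 < l" "cube a l \<subseteq> \<Omega>"
    and f: "set_integrable lebesgue (cube a l) f"
  shows "mean_on (cube a l) (\<lambda>x. \<bar>f x - mean_on (cube a l) f\<bar>) \<le> 2 * N"
proof (cases "l < lam")
  case True
  then show ?thesis using bmo_norm_ge(1)[OF assms(1-4)] assms(2) by simp
next
  case False
  then show ?thesis 
    using bmo_norm_ge(2)[OF assms(1-4)] mean_osc_le[OF f assms(3), of 0] by simp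
qed

section \<open>Chains of points at the scale of the distance to the boundary\<close>

text \<open>The choice of \<open>\<kappa>\<close> gives a cube of half side
  \<open>\<kappa> * d z\<close> around \<open>z\<close> the Euclidean radius
  \<open>d z / 100\<close> at most, so fixed multiples of it still lie in
  \<open>\<Omega>\<close>.\<close>

locale proper_domain =
  fixes \<Omega> :: "(real^'n) set"
    and \<kappa> :: real
  assumes dom: "is_domain \<Omega>" and proper: "\<Omega> \<noteq> UNIV"
    and \<kappa>_def: "\<kappa> = 1 / (100 * real CARD('n))"
begin

abbreviation d :: "real^'n \<Rightarrow> real" where "d z \<equiv> infdist z (frontier \<Omega>)"

lemma openO: "open \<Omega>" and connO: "connected \<Omega>" and neO: "\<Omega> \<noteq> {}"
  using dom by (auto simp: is_domain_def)

lemma \<kappa>_bounds: "0 < \<kappa>" "\<kappa> \<le> 1/100" "real CARD('n) * \<kappa> = 1/100"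
  by (auto simp: \<kappa>_def field_simps)

lemma frontier_ne: "frontier \<Omega> \<noteq> {}"
  using neO proper by (simp add: frontier_eq_empty)

lemma not_frontier: "z \<in> \<Omega> \<Longrightarrow> z \<notin> frontier \<Omega>"
  using openO by (simp add: frontier_def interior_open)

lemma d_pos_iff: "0 < d z \<longleftrightarrow> z \<notin> frontier \<Omega>"
  using in_closed_iff_infdist_zero[OF frontier_closed frontier_ne, of z] infdist_nonneg[of z "frontier \<Omega>"]
  by linarith

lemma d_pos: "z \<in> \<Omega> \<Longrightarrow> 0 < d z"
  by (simp add: d_pos_iff not_frontier)

lemma d_lip: "\<bar>d x - d y\<bar> \<le> dist x y"
  by (rule infdist_triangle_abs)

lemma d_le: "d x \<le> d y + dist x y"
  using d_lip[of x y] by linarith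

text \<open>The function \<open>d\<close> is positive on both sides of the frontier, so membership
  in \<open>\<Omega>\<close> cannot be read off from depth; it is always obtained from connectedness
  through this lemma.\<close>

lemma connected_sub:
  assumes "connected S" "S \<inter> \<Omega> \<noteq> {}" "\<And>x. x \<in> S \<Longrightarrow> 0 < d x"
  shows "S \<subseteq> \<Omega>"
  using connected_Int_frontier[OF assms(1,2)] assms(3) d_pos_iff by blast

lemma ball_sub:
  assumes "z \<in> \<Omega>" "dist z y < d z" shows "y \<in> \<Omega>"
proof -
  have "ball z (d z) \<subseteq> \<Omega>"
  proof (rule connected_sub)
    show "ball z (d z) \<inter> \<Omega> \<noteq> {}" using assms(1) d_pos[of z] by (auto simp: set_eq_iff intro!: exI[of _ z])
    show "0 < d x" if "x \<in> ball z (d z)" for x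
      using that d_le[of z x] by simp
  qed simp
  then show ?thesis using assms by auto
qed

text \<open>The minimum of both depths makes the relation symmetric, and reflexivity on
  \<open>\<Omega>\<close> lets chains be padded to any greater length.\<close>

definition qstep :: "real^'n \<Rightarrow> real^'n \<Rightarrow> bool" where
  "qstep z w \<longleftrightarrow> z \<in> \<Omega> \<and> w \<in> \<Omega> \<and> dist z w < \<kappa> * min (d z) (d w)"

lemma qstep_refl: "z \<in> \<Omega> \<Longrightarrow> qstep z z"
  using d_pos[of z] \<kappa>_bounds by (simp add: qstep_def)

lemma qstep_sym: "qstep z w \<Longrightarrow> qstep w z"
  by (simp add: qstep_def dist_commute min.commute)

lemma qstep_dist: "qstep z w \<Longrightarrow> dist z w < \<kappa> * d z" "qstep z w \<Longrightarrow> dist z w < \<kappa> * d w"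
proof -
  have "\<kappa> * min (d z) (d w) \<le> \<kappa> * d z" "\<kappa> * min (d z) (d w) \<le> \<kappa> * d w"
    using \<kappa>_bounds by (auto intro!: mult_left_mono)
  then show "qstep z w \<Longrightarrow> dist z w < \<kappa> * d z" "qstep z w \<Longrightarrow> dist z w < \<kappa> * d w"
    unfolding qstep_def by linarith+
qed

lemma qstep_d: 
  assumes "qstep z w" shows "d w \<le> (101/100) * d z"
proof -
  have "\<kappa> * d z \<le> (1/100) * d z" using \<kappa>_bounds by (intro mult_right_mono) (auto simp: infdist_nonneg)
  then show ?thesis using qstep_dist(1)[OF assms] d_le[of w z] by (simp add: dist_commute)
qed

text \<open>Half of the step size leaves room for the depth of \<open>w\<close>, which is then at
  least \<open>d z / 2\<close>.\<close>

lemma qstepI: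
  assumes "z \<in> \<Omega>" "dist z w < \<kappa> / 2 * d z"
  shows "qstep z w"
proof -
  have dz: "0 < d z" using assms d_pos by blast
  have "\<kappa> * d z \<le> (1/100) * d z" using \<kappa>_bounds dz by (intro mult_right_mono) auto
  then have s: "dist z w < d z / 2" using assms(2) dz by linarith
  then have "d z / 2 \<le> d w" using d_le[of z w] by linarith
  then have "\<kappa> * (d z / 2) \<le> \<kappa> * d w" using \<kappa>_bounds by (intro mult_left_mono) auto
  moreover have "\<kappa> * (d z / 2) \<le> \<kappa> * d z" using \<kappa>_bounds dz by (intro mult_left_mono) auto
  ultimately have "dist z w < \<kappa> * min (d z) (d w)" using assms(2) by (auto simp: min_def)
  moreover have "w \<in> \<Omega>" using s dz by (intro ball_sub[OF assms(1)]) auto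
  ultimately show ?thesis using assms(1) by (simp add: qstep_def)
qed

abbreviation qpow :: "nat \<Rightarrow> real^'n \<Rightarrow> real^'n \<Rightarrow> bool" where
  "qpow m \<equiv> qstep ^^ m"

lemma qpow_in: "qpow m x y \<Longrightarrow> x \<in> \<Omega> \<Longrightarrow> y \<in> \<Omega>"
  by (induction m arbitrary: y) (auto simp: qstep_def)

lemma qpow_refl: "x \<in> \<Omega> \<Longrightarrow> qpow m x x"
  by (induction m) (auto intro: qstep_refl)

lemma qpow_trans: "qpow m x y \<Longrightarrow> qpow k y z \<Longrightarrow> qpow (m + k) x z"
  by (rule relpowp_trans)

lemma qpow_mono: "qpow m x y \<Longrightarrow> y \<in> \<Omega> \<Longrightarrow> m \<le> k \<Longrightarrow> qpow k x y"
  using qpow_trans[of m x y "k - m" y] qpow_refl by simp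

lemma qpow_sym: "qpow m x y \<Longrightarrow> qpow m y x"
proof (induction m arbitrary: y)
  case (Suc m)
  then obtain z where "qpow m x z" "qstep z y" by auto
  then show ?case using Suc.IH qstep_sym by (blast intro: relpowp_Suc_I2)
qed auto

lemma qpow_d: "qpow m x y \<Longrightarrow> d y \<le> 2 ^ m * d x"
proof (induction m arbitrary: y)
  case (Suc m)
  then obtain z where z: "qpow m x z" "qstep z y" by auto
  have "d y \<le> 2 * d z" using qstep_d[OF z(2)] infdist_nonneg[of z "frontier \<Omega>"] by linarith
  then show ?case using Suc.IH[OF z(1)] by simp
qed auto

text \<open>Being joined by a chain is an equivalence relation with open classes, because a small
  ball around each point is one step away from it.\<close>

lemma qpow_connected:
  assumes "x \<in> \<Omega>" "y \<in> \<Omega>" shows "\<exists>m. qpow m x y"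
proof (rule connected_equivalence_relation[OF connO assms])
  show "\<exists>m. qpow m y x" if "\<exists>m. qpow m x y" for x y using that qpow_sym by blast
  show "\<exists>m. qpow m x z" if "\<exists>m. qpow m x y" "\<exists>m. qpow m y z" for x y z using that qpow_trans by blast
  show "\<exists>T. openin (top_of_set \<Omega>) T \<and> a \<in> T \<and> (\<forall>x\<in>T. \<exists>m. qpow m a x)" if "a \<in> \<Omega>" for a
  proof (intro exI conjI ballI)
    show "openin (top_of_set \<Omega>) (\<Omega> \<inter> ball a (\<kappa> / 2 * d a))" by (simp add: openin_open_Int)
    show "a \<in> \<Omega> \<inter> ball a (\<kappa> / 2 * d a)" using that d_pos[OF that] \<kappa>_bounds by simp
    show "qpow 1 a x" if "x \<in> \<Omega> \<inter> ball a (\<kappa> / 2 * d a)" for x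
      using that \<open>a \<in> \<Omega>\<close> qstepI[of a x] by (auto simp: OO_def)
  qed
qed

text \<open>Greedy selection with \<open>\<eta> = \<kappa> * \<rho> / 4\<close>: a new chain point
  is taken as soon as the length walked since the last one exceeds \<open>\<eta>\<close>. Each
  selected step thus uses up more than \<open>\<eta>\<close> of the length, but at most
  \<open>2 * \<eta> < \<kappa> * \<rho>\<close>, so it is a legal step. The extra summand on the
  right pays for the last step.\<close>

lemma qpow_of_fine_sequence:
  assumes w: "\<And>i. i \<le> N \<Longrightarrow> w i \<in> \<Omega> \<and> \<rho> \<le> d (w i)" and \<rho>: "0 < \<rho>"
    and fine: "\<And>i. i < N \<Longrightarrow> dist (w i) (w (Suc i)) \<le> \<kappa> * \<rho> / 4"
  shows "\<exists>m. real m * (\<kappa> * \<rho> / 4) \<le> (\<Sum>i<N. dist (w i) (w (Suc i))) + \<kappa> * \<rho> / 4 \<and> qpow m (w 0) (w N)"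
proof -
  define \<eta> where "\<eta> = \<kappa> * \<rho> / 4"
  have \<eta>: "0 < \<eta>" using \<rho> \<kappa>_bounds by (simp add: \<eta>_def)
  define S where "S k = (\<Sum>i<k. dist (w i) (w (Suc i)))" for k
  have short: "qstep (w i) (w j)" if "i \<le> N" "j \<le> N" "dist (w i) (w j) \<le> 2 * \<eta>" for i j
  proof -
    have "2 * \<eta> < \<kappa> * \<rho>" using \<eta> by (simp add: \<eta>_def)
    also have "\<dots> \<le> \<kappa> * min (d (w i)) (d (w j))" using w that \<kappa>_bounds by (intro mult_left_mono) auto
    finally show ?thesis using that w by (auto simp: qstep_def)
  qed
  \<comment> \<open>Invariant at position \<open>k\<close>: \<open>i\<close> is the last selected
    index, reached in \<open>m\<close> steps, and at most \<open>\<eta>\<close> of length has been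
    walked since.\<close>
  have "\<exists>m i. i \<le> k \<and> real m * \<eta> \<le> S i \<and> qpow m (w 0) (w i) \<and> dist (w i) (w k) \<le> S k - S i \<and> S k - S i \<le> \<eta>"
    if "k \<le> N" for k
    using that
  proof (induction k)
    case 0
    then show ?case using \<eta> by (intro exI[of _ 0]) (auto simp: S_def)
  next
    case (Suc k)
    then obtain m i where mi: "i \<le> k" "real m * \<eta> \<le> S i" "qpow m (w 0) (w i)"
      "dist (w i) (w k) \<le> S k - S i" "S k - S i \<le> \<eta>" by auto
    have SS: "S (Suc k) = S k + dist (w k) (w (Suc k))" by (simp add: S_def)
    have tri: "dist (w i) (w (Suc k)) \<le> S (Suc k) - S i"
      using mi SS dist_triangle[of "w i" "w (Suc k)" "w k"] by linarith
    show ?case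
    proof (cases "S (Suc k) - S i \<le> \<eta>")
      case True
      then show ?thesis using mi tri by (intro exI[of _ m] exI[of _ i]) auto
    next
      case False
      have "dist (w i) (w (Suc k)) \<le> 2 * \<eta>"
        using tri SS mi fine[of k] Suc.prems by (simp add: \<eta>_def)
      then have "qpow (Suc m) (w 0) (w (Suc k))"
        using short[of i "Suc k"] mi Suc.prems by auto
      then show ?thesis using False mi \<eta> 
        by (intro exI[of _ "Suc m"] exI[of _ "Suc k"]) (auto simp: algebra_simps)
    qed
  qed
  then obtain m i where mi: "i \<le> N" "real m * \<eta> \<le> S i" "qpow m (w 0) (w i)"
      "dist (w i) (w N) \<le> S N - S i" "S N - S i \<le> \<eta>" by blast
  have "qstep (w i) (w N)" using mi \<eta> by (intro short) auto
  then have "qpow (Suc m) (w 0) (w N)" using mi(3) by auto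
  moreover have "real (Suc m) * \<eta> \<le> S N + \<eta>" using mi(2,4) zero_le_dist[of "w i" "w N"] by (simp add: algebra_simps del: zero_le_dist)
  ultimately show ?thesis unfolding S_def \<eta>_def by blast
qed

end

section \<open>Necessity of local uniformity\<close>

lemma mean_ccube_double:
  fixes p :: "real^'n"
  assumes F: "bmo_norm lam UNIV F \<le> ennreal N" "0 \<le> N" 
    and int: "\<And>a l. 0 < l \<Longrightarrow> set_integrable lebesgue (cube a l) F"
    and sub: "ccube p s \<subseteq> ccube q (2 * s)" and s: "0 < s"
  shows "\<bar>mean_on (ccube p s) F - mean_on (ccube q (2 * s)) F\<bar> \<le> 2 ^ CARD('n) * (2 * N)"
proof -
  have "\<bar>mean_on (ccube p s) F - mean_on (ccube q (2 * s)) F\<bar> \<le> 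
      2 ^ CARD('n) * mean_on (ccube q (2 * s)) (\<lambda>x. \<bar>F x - mean_on (ccube q (2 * s)) F\<bar>)"
    using s sub unfolding ccube_def by (intro mean_on_dev_le_subcube int) auto
  also have "\<dots> \<le> 2 ^ CARD('n) * (2 * N)"
    using s unfolding ccube_def by (intro mult_left_mono bmo_norm_osc[OF F] int) auto
  finally show ?thesis .
qed

text \<open>Each mean climbs through \<open>k\<close> doublings; at that size one more doubling
  around \<open>p\<close> contains both cubes. This makes \<open>2 * k + 2\<close> comparisons, and
  the intermediate cubes may lie anywhere in the space.\<close>

lemma mean_ccube_telescope:
  fixes p q :: "real^'n"
  assumes F: "bmo_norm lam UNIV F \<le> ennreal N" "0 \<le> N" 
    and int: "\<And>a l. 0 < l \<Longrightarrow> set_integrable lebesgue (cube a l) F"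
    and s: "0 < s" and pq: "dist p q \<le> 2 ^ k * s"
  shows "\<bar>mean_on (ccube p s) F - mean_on (ccube q s) F\<bar> \<le> real (2 * k + 2) * (2 ^ CARD('n) * (2 * N))"
proof -
  let ?D = "2 ^ CARD('n) * (2 * N)"
  have D: "\<bar>mean_on (ccube x s) F - mean_on (ccube x (2 ^ k * s)) F\<bar> \<le> real k * ?D" for x
  proof (induction k)
    case (Suc k)
    have "\<bar>mean_on (ccube x (2 ^ k * s)) F - mean_on (ccube x (2 * (2 ^ k * s))) F\<bar> \<le> ?D"
      using s by (intro mean_ccube_double[OF F int] ccube_subset) auto
    then show ?case using Suc by (simp add: algebra_simps)
  qed simp
  let ?S = "2 ^ k * s"
  have "\<bar>mean_on (ccube p ?S) F - mean_on (ccube p (2 * ?S)) F\<bar> \<le> ?D"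
    using s by (intro mean_ccube_double[OF F int] ccube_subset) auto
  moreover have "\<bar>mean_on (ccube q ?S) F - mean_on (ccube p (2 * ?S)) F\<bar> \<le> ?D"
    using s pq by (intro mean_ccube_double[OF F int] ccube_subset) (auto simp: dist_commute mult.commute)
  ultimately show ?thesis using D[of p] D[of q] by (simp add: algebra_simps)
qed

text \<open>Bernoulli's inequality makes the relative volume of the shell linear in
  \<open>t\<close>, so that shells of geometrically decreasing thickness have summable
  volumes.\<close>

lemma measure_ccube_shell:
  fixes c :: "real^'n"
  assumes "0 < h" "0 \<le> t" "t \<le> 1"
  shows "measure lebesgue (ccube c h - ccube c (h * (1 - t))) \<le> (2 * h) ^ CARD('n) * (real CARD('n) * t)"
proof -
  have sub: "ccube c (h * (1 - t)) \<subseteq> ccube c h"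
    using assms by (intro ccube_subset) auto
  have "measure lebesgue (ccube c h - ccube c (h * (1 - t))) = measure lebesgue (ccube c h) - measure lebesgue (ccube c (h * (1 - t)))"
    using sub cube_lmeasurable unfolding ccube_def by (intro measurable_measure_Diff) auto
  also have "\<dots> = (2 * h) ^ CARD('n) * (1 - (1 - t) ^ CARD('n))"
  proof -
    have "(2 * (h * (1 - t))) ^ CARD('n) = (2 * h) ^ CARD('n) * (1 - t) ^ CARD('n)"
      by (simp add: power_mult_distrib)
    then show ?thesis using assms by (simp add: ccube_def content_cube right_diff_distrib)
  qed
  also have "\<dots> \<le> (2 * h) ^ CARD('n) * (real CARD('n) * t)"
    using Bernoulli_inequality[of "- t" "CARD('n)"] assms by (intro mult_left_mono) auto
  finally show ?thesis .
qed

section \<open>The truncated chain distance and its mean oscillation\<close>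

context proper_domain
begin

definition lev :: "nat \<Rightarrow> (real^'n) set \<Rightarrow> (real^'n) set" where
  "lev m E = {x. \<exists>y\<in>E. qpow m x y}"

lemma lev_0: "lev 0 E = E" by (auto simp: lev_def)

lemma lev_Suc: "lev (Suc m) E = (\<Union>w\<in>lev m E. {z. qstep z w})"
proof -
  have "qpow (Suc m) x y \<longleftrightarrow> (\<exists>w. qstep x w \<and> qpow m w y)" for x y
    by (meson relpowp_Suc_I2 relpowp_Suc_D2)
  then show ?thesis unfolding lev_def by blast
qed

text \<open>A further step always adds an open neighbourhood; only level 0 inherits its
  measurability from \<open>E\<close>.\<close>

lemma open_lev: "open (lev (Suc m) E)"
  unfolding lev_Suc
proof (intro open_UN ballI)
  fix w
  have "open {z. dist z w < \<kappa> * min (d z) (d w)}"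
    by (intro open_Collect_less continuous_intros)
  moreover have "{z. qstep z w} = (if w \<in> \<Omega> then \<Omega> \<inter> {z. dist z w < \<kappa> * min (d z) (d w)} else {})"
    by (auto simp: qstep_def)
  ultimately show "open {z. qstep z w}" using openO by auto
qed

text \<open>Chain distance to \<open>E\<close> capped at \<open>M\<close>, with \<open>M\<close>
  also the value where no chain reaches \<open>E\<close>. The cap gives boundedness and keeps the
  property that one step changes the value by at most 1.\<close>

definition trunc :: "nat \<Rightarrow> (real^'n) set \<Rightarrow> real^'n \<Rightarrow> nat" where
  "trunc M E z = (LEAST k. k = M \<or> z \<in> lev k E)"

lemma trunc_le: "trunc M E z \<le> M"
  unfolding trunc_def by (rule Least_le) simp

lemma trunc_lev: "z \<in> lev k E \<Longrightarrow> trunc M E z \<le> k"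
  unfolding trunc_def by (rule Least_le) simp

lemma trunc_cases: "trunc M E z = M \<or> z \<in> lev (trunc M E z) E"
  unfolding trunc_def by (rule LeastI[of _ M]) simp

lemma trunc_step: "qstep z w \<Longrightarrow> trunc M E z \<le> trunc M E w + 1"
  using trunc_cases[of M E w] trunc_le[of M E z] trunc_lev[of z "Suc (trunc M E w)" E M]
  by (auto simp: lev_Suc)

lemma trunc_qpow: "qpow m z w \<Longrightarrow> \<bar>real (trunc M E z) - real (trunc M E w)\<bar> \<le> real m"
proof (induction m arbitrary: w)
  case (Suc m)
  then obtain v where v: "qpow m z v" "qstep v w" by auto
  then show ?case using Suc.IH[OF v(1)] trunc_step[OF v(2), of M E] trunc_step[OF qstep_sym[OF v(2)], of M E]
    by auto
qed simp

lemma trunc_measurable: 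
  assumes "E \<in> sets borel" shows "(\<lambda>z. real (trunc M E z)) \<in> borel_measurable borel"
proof -
  have [measurable]: "lev k E \<in> sets borel" for k
    using assms open_lev by (cases k) (auto simp: lev_0)
  have "trunc M E \<in> borel \<rightarrow>\<^sub>M count_space UNIV"
    unfolding trunc_def by measurable
  then show ?thesis by measurable
qed

lemma trunc_integrable:
  assumes "E \<in> sets borel" shows "set_integrable lebesgue (cube a l) (\<lambda>z. real (trunc M E z))"
proof (rule set_integrable_bound[OF set_integrable_const_cube[of a l "real M"]])
  have "(\<lambda>z. real (trunc M E z)) \<in> borel_measurable lborel"
    using trunc_measurable[OF assms] by simp
  then have "(\<lambda>z. real (trunc M E z)) \<in> borel_measurable lebesgue"
    by (rule measurable_completion)
  then show "set_borel_measurable lebesgue (cube a l) (\<lambda>z. real (trunc M E z))"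
    unfolding set_borel_measurable_def by (auto intro!: borel_measurable_scaleR borel_measurable_indicator)
qed (auto simp: trunc_le)

text \<open>The maximum norm is at most the Euclidean norm, so a frontier point closer than
  \<open>h * t\<close> would lie in the large cube, hence in the open set
  \<open>\<Omega>\<close>.\<close>

lemma ccube_depth:
  assumes sub: "ccube c h \<subseteq> \<Omega>" and z: "z \<in> ccube c (h * (1 - t))"
  shows "h * t \<le> d z"
proof (rule ccontr)
  assume "\<not> h * t \<le> d z"
  moreover obtain y where y: "y \<in> frontier \<Omega>" "d z = dist z y"
    using infdist_attains_inf[OF frontier_closed frontier_ne] by metis
  ultimately have yz: "y \<in> ccube z (h * t)" by (intro ccubeI) (simp add: dist_commute)
  have "y \<in> ccube c h" 
    unfolding mem_ccube
  proof
    fix i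
    have "\<bar>y $ i - z $ i\<bar> \<le> h * t" "\<bar>z $ i - c $ i\<bar> \<le> h * (1 - t)"
      using z yz by (auto simp: mem_ccube)
    then show "\<bar>y $ i - c $ i\<bar> \<le> h" by (simp add: algebra_simps)
  qed
  then show False using sub y not_frontier by blast
qed

definition \<rho> :: real where "\<rho> = 1 - 50 * \<kappa>\<^sup>2"

lemma \<rho>_eq: "\<rho> = 1 - \<kappa> / (2 * real CARD('n))"
  unfolding \<rho>_def by (simp add: \<kappa>_def power2_eq_square)

lemma \<rho>_bounds: "0 < \<rho>" "\<rho> < 1" "real CARD('n) * (1 - \<rho>) < \<kappa> * \<rho>"
proof -
  have n: "1 \<le> real CARD('n)" using zero_less_card_finite[where 'a='n] by linarith
  have "\<kappa> / (2 * real CARD('n)) \<le> \<kappa> / 2" using n \<kappa>_bounds by (intro divide_left_mono) auto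
  moreover have "0 < \<kappa> / (2 * real CARD('n))" using \<kappa>_bounds by simp
  ultimately show "0 < \<rho>" "\<rho> < 1" using \<kappa>_bounds unfolding \<rho>_eq by linarith+
  have "1/2 < \<rho>" using \<kappa>_bounds \<open>\<kappa> / (2 * real CARD('n)) \<le> \<kappa> / 2\<close> unfolding \<rho>_eq by linarith
  then have "\<kappa> * (1/2) < \<kappa> * \<rho>" using \<kappa>_bounds by (intro mult_strict_left_mono) auto
  then show "real CARD('n) * (1 - \<rho>) < \<kappa> * \<rho>" by (simp add: \<rho>_eq)
qed

text \<open>Each step toward the center divides the relative distance to the boundary of the cube by \<open>\<rho>\<close>;
this is where the value of \<open>\<rho>\<close> comes from.\<close>

lemma qpow_center:
  assumes sub: "ccube c h \<subseteq> \<Omega>" and h: "0 < h"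
  shows "z \<in> ccube c (h * (1 - \<rho> ^ k)) \<Longrightarrow> qpow k z c"
proof (induction k arbitrary: z)
  case 0
  then have "z = c" by (simp add: mem_ccube vec_eq_iff)
  then show ?case by simp
next
  case (Suc k)
  define s where "s = (1 - \<rho> ^ k) / (1 - \<rho> ^ Suc k)"
  have r1: "\<rho> ^ Suc k < 1" using \<rho>_bounds power_Suc_less_one by (metis less_eq_real_def)
  have r2: "\<rho> ^ Suc k \<le> \<rho> ^ k" "\<rho> ^ k \<le> 1" "0 < \<rho> ^ k"
    using \<rho>_bounds by (auto simp: power_le_one mult_left_le_one_le)
  have s: "0 \<le> s" "s \<le> 1" "s * (1 - \<rho> ^ Suc k) = 1 - \<rho> ^ k"
    using r1 r2 by (auto simp: s_def field_simps)
  define z' where "z' = c + s *\<^sub>R (z - c)"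
  have z': "z' \<in> ccube c (h * (1 - \<rho> ^ k))"
    unfolding mem_ccube
  proof
    fix i
    have "\<bar>z' $ i - c $ i\<bar> = s * \<bar>z $ i - c $ i\<bar>" using s by (simp add: z'_def abs_mult)
    also have "\<dots> \<le> s * (h * (1 - \<rho> ^ Suc k))" using Suc.prems s by (intro mult_left_mono) (auto simp: mem_ccube)
    also have "\<dots> = h * (1 - \<rho> ^ k)" using arg_cong[OF s(3), of "\<lambda>v. h * v"] by (simp only: mult_ac)
    finally show "\<bar>z' $ i - c $ i\<bar> \<le> h * (1 - \<rho> ^ k)" .
  qed
  have dz: "h * \<rho> ^ Suc k \<le> d z" "h * \<rho> ^ Suc k \<le> d z'"
  proof -
    show "h * \<rho> ^ Suc k \<le> d z" by (rule ccube_depth[OF sub Suc.prems])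
    have "h * \<rho> ^ Suc k \<le> h * \<rho> ^ k" using r2 h by (intro mult_left_mono) auto
    then show "h * \<rho> ^ Suc k \<le> d z'" using ccube_depth[OF sub z'] by linarith
  qed
  have "dist z z' = (1 - s) * dist z c"
  proof -
    have "z - z' = (1 - s) *\<^sub>R (z - c)" by (simp add: z'_def algebra_simps)
    then show ?thesis using s by (simp add: dist_norm)
  qed
  also have "\<dots> \<le> (1 - s) * (real CARD('n) * (h * (1 - \<rho> ^ Suc k)))"
    using s dist_ccube_le[OF Suc.prems] by (intro mult_left_mono) auto
  also have "\<dots> = real CARD('n) * (1 - \<rho>) * (h * \<rho> ^ k)"
  proof -
    have e: "(1 - s) * (1 - \<rho> ^ Suc k) = (1 - \<rho>) * \<rho> ^ k" using s(3) by (simp add: algebra_simps)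
    have "(1 - s) * (real CARD('n) * (h * (1 - \<rho> ^ Suc k))) = real CARD('n) * h * ((1 - s) * (1 - \<rho> ^ Suc k))"
      by (simp only: mult_ac)
    then show ?thesis unfolding e by (simp only: mult_ac)
  qed
  also have "\<dots> < \<kappa> * \<rho> * (h * \<rho> ^ k)"
    using \<rho>_bounds h by (intro mult_strict_right_mono) auto
  also have "\<dots> = \<kappa> * (h * \<rho> ^ Suc k)" by simp
  also have "\<dots> \<le> \<kappa> * min (d z) (d z')" using dz \<kappa>_bounds by (intro mult_left_mono) auto
  finally have "dist z z' < \<kappa> * min (d z) (d z')" .
  moreover have "z \<in> \<Omega>" "z' \<in> \<Omega>"
  proof -
    have "ccube c (h * (1 - \<rho> ^ j)) \<subseteq> ccube c h" for j
      using h \<rho>_bounds by (intro ccube_subset) auto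
    then show "z \<in> \<Omega>" "z' \<in> \<Omega>" using sub z' Suc.prems by blast+
  qed
  ultimately have "qstep z z'" by (simp add: qstep_def)
  then show ?case using Suc.IH[OF z'] by (blast intro: relpowp_Suc_I2)
qed

text \<open>The sum of a geometric series: with n the dimension, the shells have relative volumes at
  most n times \<open>\<rho> ^ k\<close>, which add up to at most n / (1 - \<rho>). Here n = 1 /
  (100 \<kappa>) and 1 - \<rho> is 50 times the square of \<kappa>.\<close>

definition A0 :: real where "A0 = 1 / (5000 * \<kappa> ^ 3)"

lemma A0_eq: "A0 = real CARD('n) / (1 - \<rho>)"
  unfolding A0_def \<rho>_eq by (simp add: \<kappa>_def power3_eq_cube)

lemma A0_pos: "0 < A0" using \<kappa>_bounds by (simp add: A0_def)

text \<open>Layer-cake argument: a point outside the shell \<open>?S k\<close> is at most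
  \<open>k\<close> steps from the center, so the difference of the values at \<open>z\<close> and
  \<open>c\<close> is at most the number of shells that contain \<open>z\<close>. Integration adds
  up the shell volumes, and neither \<open>M\<close> nor \<open>E\<close> enters the bound.\<close>

lemma trunc_mean_center:
  assumes E: "E \<in> sets borel" and sub: "ccube c h \<subseteq> \<Omega>" and h: "0 < h"
  shows "mean_on (ccube c h) (\<lambda>z. \<bar>real (trunc M E z) - real (trunc M E c)\<bar>) \<le> A0"
proof -
  let ?Q = "ccube c h" and ?S = "\<lambda>k. ccube c h - ccube c (h * (1 - \<rho> ^ k))"
  have [simp]: "\<rho> ^ k \<le> 1" "0 \<le> \<rho> ^ k" for k using \<rho>_bounds by (auto simp: power_le_one)
  have [simp]: "?S k \<in> sets lebesgue" for k by (simp add: ccube_def sets.Diff)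
  have lm: "?S k \<in> lmeasurable" for k
    using cube_lmeasurable unfolding ccube_def by (intro fmeasurable_Diff) auto
  have int: "integrable lebesgue (\<lambda>z. indicator (?S k) z :: real)" for k
    using lm by (simp add: lmeasurable_iff_integrable)
  have eq: "indicator ?Q z *\<^sub>R (\<Sum>k<M. indicator (?S k) z :: real) = (\<Sum>k<M. indicator (?S k) z)" for z
    by (auto simp: indicator_def intro!: sum.cong)
  have pt: "\<bar>real (trunc M E z) - real (trunc M E c)\<bar> \<le> (\<Sum>k<M. indicator (?S k) z)" if z: "z \<in> ?Q" for z
  proof (cases "\<exists>k<M. z \<notin> ?S k")
    case False
    then have "(\<Sum>k<M. indicator (?S k) z :: real) = M" by simp
    then show ?thesis using trunc_le[of M E z] trunc_le[of M E c] by (simp add: abs_le_iff)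
  next
    case True
    define k where "k = (LEAST k. z \<notin> ?S k)"
    have k: "z \<notin> ?S k" "k < M" using True unfolding k_def by (metis (lifting) LeastI, metis (lifting) Least_le le_less_trans)
    have lt: "z \<in> ?S j" if "j < k" for j using that not_less_Least unfolding k_def by blast
    have "real k = (\<Sum>j<k. indicator (?S j) z :: real)" using lt by simp
    also have "\<dots> \<le> (\<Sum>k<M. indicator (?S k) z :: real)" using k by (intro sum_mono2) auto
    finally have "real k \<le> (\<Sum>k<M. indicator (?S k) z :: real)" .
    moreover have "qpow k z c" using k z by (intro qpow_center[OF sub h]) auto
    ultimately show ?thesis using trunc_qpow[of k z c M E] by linarith
  qed
  have "mean_on ?Q (\<lambda>z. \<bar>real (trunc M E z) - real (trunc M E c)\<bar>) \<le> mean_on ?Q (\<lambda>z. \<Sum>k<M. indicator (?S k) z)"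
  proof (rule mean_on_mono[where a = "c - (\<chi> i. h)" and l = "2 * h", folded ccube_def])
    show "set_integrable lebesgue ?Q (\<lambda>x. \<bar>real (trunc M E x) - real (trunc M E c)\<bar>)"
      unfolding ccube_def by (intro set_integrable_dev trunc_integrable E)
    show "set_integrable lebesgue ?Q (\<lambda>z. \<Sum>k<M. indicator (?S k) z :: real)"
      unfolding set_integrable_def eq using int by (intro Bochner_Integration.integrable_sum)
  qed (use pt in auto)
  also have "\<dots> = (\<Sum>k<M. measure lebesgue (?S k)) / (2 * h) ^ CARD('n)"
  proof -
    have "(LINT z:?Q|lebesgue. \<Sum>k<M. indicator (?S k) z) = (\<Sum>k<M. measure lebesgue (?S k))"
      unfolding set_lebesgue_integral_def eq using int lm
      by (subst Bochner_Integration.integral_sum) (auto intro!: sum.cong simp: fmeasurable_def)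
    then show ?thesis using h unfolding mean_on_def ccube_def by (simp add: content_cube)
  qed
  also have "\<dots> \<le> (\<Sum>k<M. (2 * h) ^ CARD('n) * (real CARD('n) * \<rho> ^ k)) / (2 * h) ^ CARD('n)"
    using h by (intro divide_right_mono sum_mono measure_ccube_shell) auto
  also have "\<dots> = real CARD('n) * (\<Sum>k<M. \<rho> ^ k)"
    using h by (simp add: sum_distrib_left[symmetric] mult.assoc)
  also have "\<dots> \<le> real CARD('n) * (1 / (1 - \<rho>))"
  proof (intro mult_left_mono)
    have "(\<Sum>k<M. \<rho> ^ k) = (1 - \<rho> ^ M) / (1 - \<rho>)" using \<rho>_bounds by (simp add: sum_gp_strict)
    also have "\<dots> \<le> 1 / (1 - \<rho>)" using \<rho>_bounds by (intro divide_right_mono) auto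
    finally show "(\<Sum>k<M. \<rho> ^ k) \<le> 1 / (1 - \<rho>)" .
  qed simp
  finally show ?thesis by (simp add: A0_eq)
qed

end

lemma cube_as_ccube:
  fixes a :: "real^'n"
  shows "cube a l = ccube (a + (\<chi> i. l / 2)) (l / 2)"
proof -
  have "a + (\<chi> i. l / 2) - (\<chi> i. l / 2) = a" by (simp add: vec_eq_iff)
  then show ?thesis by (simp add: ccube_def)
qed

lemma bmo_Rn_cube: "F \<in> bmo_Rn \<Longrightarrow> set_integrable lebesgue (cube a l) F"
  using compact_cube by (auto simp: bmo_Rn_def)

section \<open>Short chains from a bounded extension\<close>

context proper_domain
begin

definition deep :: "real \<Rightarrow> (real^'n) set" where "deep r = {z \<in> \<Omega>. r \<le> d z}"

lemma deep_borel: "deep r \<in> sets borel"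
proof -
  have "deep r = \<Omega> \<inter> {z. r \<le> d z}" by (auto simp: deep_def)
  moreover have "closed {z. r \<le> d z}" by (intro closed_Collect_le continuous_intros)
  ultimately show ?thesis using openO by auto
qed

text \<open>The set \<open>deep r\<close> serves the second supremum: the center of a cube of side
  at least \<open>lam\<close> in \<open>\<Omega>\<close> has depth at least \<open>lam / 2\<close>,
  so \<open>f\<close> vanishes there. Oscillation contributes \<open>2 * A0\<close>, large cubes
  \<open>A0\<close>.\<close>

lemma trunc_bmo:
  fixes M :: nat
  assumes lam: "0 < lam" and r: "r \<le> lam / 2" and E: "E = insert p (deep r)"
  defines "f \<equiv> \<lambda>z. real (trunc M E z)"
  shows "bmo_norm lam \<Omega> f \<le> ennreal (3 * A0)" "f \<in> bmo_on lam \<Omega>"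
proof -
  have Eb: "E \<in> sets borel" using deep_borel E by auto
  have int: "set_integrable lebesgue (cube a l) f" for a l
    unfolding f_def by (rule trunc_integrable[OF Eb])
  have mean: "mean_on (cube a l) (\<lambda>x. \<bar>f x - f (a + (\<chi> i. l / 2))\<bar>) \<le> A0" if "0 < l" "cube a l \<subseteq> \<Omega>" for a l
    unfolding f_def using that by (subst cube_as_ccube, intro trunc_mean_center[OF Eb]) (auto simp: cube_as_ccube[symmetric])
  show "bmo_norm lam \<Omega> f \<le> ennreal (3 * A0)"
  proof -
    have "bmo_norm lam \<Omega> f \<le> ennreal (2 * A0 + A0)"
    proof (rule bmo_norm_le)
      fix a l assume l: "0 < l" "cube a l \<subseteq> \<Omega>"
      show "mean_on (cube a l) (\<lambda>x. \<bar>f x - mean_on (cube a l) f\<bar>) \<le> 2 * A0"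
        using mean_osc_le[OF int l(1), of a "f (a + (\<chi> i. l / 2))"] mean[OF l] by linarith
      assume "lam \<le> l"
      let ?c = "a + (\<chi> i. l / 2)"
      have "?c \<in> cube a l" using l by (simp add: mem_cube)
      moreover have "(l / 2) * 1 \<le> d ?c"
      proof (rule ccube_depth)
        show "ccube ?c (l / 2) \<subseteq> \<Omega>" using l by (simp add: cube_as_ccube[symmetric])
        show "?c \<in> ccube ?c (l / 2 * (1 - 1))" by (simp add: mem_ccube)
      qed
      ultimately have "?c \<in> E" using r \<open>lam \<le> l\<close> l by (auto simp: E deep_def)
      then have "f ?c = 0" using trunc_lev[of ?c 0 E M] by (simp add: f_def lev_0)
      then show "mean_on (cube a l) (\<lambda>x. \<bar>f x\<bar>) \<le> A0" using mean[OF l] by simp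
    qed (use A0_pos in auto)
    then show ?thesis by simp
  qed
  then show "f \<in> bmo_on lam \<Omega>"
    using int by (auto simp: bmo_on_def intro: le_less_trans)
qed

lemma two_power_ge: "\<exists>k. x \<le> (2::real) ^ k"
  by (meson less_imp_le real_arch_pow one_less_numeral_iff semiring_norm(76))

text \<open>The extension has bounded oscillation on cubes that leave \<open>\<Omega>\<close> too,
  so its means around \<open>p\<close> and \<open>q\<close> can be compared through large cubes, at
  a cost linear in \<open>k\<close>. On the small cubes the extension is within 1 of
  \<open>f p = 0\<close> and of \<open>f q\<close>, which bounds \<open>f q\<close>.\<close>

lemma extension_chain:
  assumes lam: "0 < lam" and T: "extension_operator lam \<Omega> T" and bT: "bounded_operator lam \<Omega> T"
  shows "\<exists>C>0. \<forall>p\<in>\<Omega>. \<forall>q\<in>\<Omega>. \<forall>r k. r \<le> lam / 2 \<longrightarrow> dist p q \<le> 2 ^ k * min (d p) (d q) \<longrightarrow>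
     (\<exists>m. real m \<le> C * (real k + 1) \<and> q \<in> lev m (insert p (deep r)))"
proof -
  obtain C0 where C0: "\<And>f. f \<in> bmo_on lam \<Omega> \<Longrightarrow> bmo_Rn_norm (T f) \<le> ennreal C0 * bmo_norm lam \<Omega> f"
    using bT unfolding bounded_operator_def by blast
  define N where "N = max C0 0 * (3 * A0)"
  have N: "0 \<le> N" using A0_pos by (simp add: N_def)
  define n where "n = real CARD('n)"
  have n: "0 < n" by (simp add: n_def)
  obtain k1 where k1: "4 * n / \<kappa> \<le> 2 ^ k1" using two_power_ge by blast
  define D where "D = 2 ^ CARD('n) * (2 * N)"
  have D: "0 \<le> D" using N by (simp add: D_def)
  \<comment> \<open>Chosen so that the telescoped bound
    \<open>real (2 * (k + k1) + 2) * D + 2\<close> is below \<open>C * (real k + 1)\<close> for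
    every \<open>k\<close>.\<close>
  define C where "C = 4 + D * (2 * real k1 + 4)"
  have C: "0 < C" using D by (simp add: C_def add_pos_nonneg)
  have "\<exists>m. real m \<le> C * (real k + 1) \<and> q \<in> lev m (insert p (deep r))"
    if p: "p \<in> \<Omega>" and q: "q \<in> \<Omega>" and r: "r \<le> lam / 2" and pq: "dist p q \<le> 2 ^ k * min (d p) (d q)" for p q r k
  proof -
    define E where "E = insert p (deep r)"
    define M where "M = nat \<lceil>C * (real k + 1)\<rceil>"
    define f where "f = (\<lambda>z. real (trunc M E z))"
    note tb = trunc_bmo[OF lam r E_def, of M, folded f_def]
    define F where "F = T f"
    have Ff: "F x = f x" if "x \<in> \<Omega>" for x
      using T tb(2) that unfolding extension_operator_def F_def by blast
    have "F \<in> bmo_Rn" using T tb(2) unfolding extension_operator_def F_def by blast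
    then have int: "set_integrable lebesgue (cube a l) F" for a l by (rule bmo_Rn_cube)
    have "bmo_Rn_norm F \<le> ennreal C0 * bmo_norm lam \<Omega> f" unfolding F_def by (rule C0[OF tb(2)])
    also have "\<dots> \<le> ennreal (max C0 0) * ennreal (3 * A0)"
      by (intro mult_mono tb(1) ennreal_leI) auto
    also have "\<dots> = ennreal N" using A0_pos by (simp add: N_def ennreal_mult)
    finally have FN: "bmo_norm 1 UNIV F \<le> ennreal N" by (simp add: bmo_Rn_norm_def)
    \<comment> \<open>Cubes of this half side have radius at most \<open>\<kappa> / 4\<close> times
      the smaller depth, so all their points are one step away from the center.\<close>
    define s where "s = \<kappa> / (4 * n) * min (d p) (d q)"
    have dd: "0 < min (d p) (d q)" using d_pos p q by simp
    then have s: "0 < s" using n \<kappa>_bounds by (simp add: s_def)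
    have near: "\<bar>mean_on (ccube x s) F - f x\<bar> \<le> 1" if x: "x \<in> \<Omega>" "min (d p) (d q) \<le> d x" for x
    proof -
      have q: "qstep x z" if "z \<in> ccube x s" for z
      proof (rule qstepI[OF x(1)])
        have "dist x z \<le> n * s" using dist_ccube_le[OF that] by (simp add: dist_commute n_def)
        also have "\<dots> = \<kappa> / 4 * min (d p) (d q)" using n by (simp add: s_def)
        also have "\<dots> \<le> \<kappa> / 4 * d x" using x \<kappa>_bounds by (intro mult_left_mono) auto
        also have "\<dots> < \<kappa> / 2 * d x" using d_pos[OF x(1)] \<kappa>_bounds by (intro mult_strict_right_mono) auto
        finally show "dist x z < \<kappa> / 2 * d x" .
      qed
      have "\<bar>F z - f x\<bar> \<le> 1" if "z \<in> ccube x s" for z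
        using trunc_qpow[of 1 x z M E] q[OF that] Ff[of z] by (auto simp: f_def qstep_def OO_def)
      then have "mean_on (ccube x s) (\<lambda>z. \<bar>F z - f x\<bar>) \<le> mean_on (ccube x s) (\<lambda>z. 1)"
        unfolding ccube_def by (intro mean_on_mono set_integrable_dev int set_integrable_const_cube) auto
      also have "\<dots> = 1" unfolding ccube_def using s by (intro mean_on_const) auto
      finally have "mean_on (ccube x s) (\<lambda>z. \<bar>F z - f x\<bar>) \<le> 1" .
      then show ?thesis
        using mean_on_dev_le_subcube[OF int subset_refl, of "2 * s" 1 "x - (\<chi> i. s)" "f x"] s unfolding ccube_def by simp
    qed
    have "dist p q \<le> 2 ^ (k + k1) * s"
    proof -
      have "2 ^ k * min (d p) (d q) = 2 ^ k * (4 * n / \<kappa>) * s" using n \<kappa>_bounds by (simp add: s_def)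
      also have "\<dots> \<le> 2 ^ k * 2 ^ k1 * s" using k1 s by (intro mult_right_mono mult_left_mono) auto
      finally show ?thesis using pq unfolding power_add by linarith
    qed
    then have "\<bar>mean_on (ccube p s) F - mean_on (ccube q s) F\<bar> \<le> real (2 * (k + k1) + 2) * D"
      unfolding D_def by (intro mean_ccube_telescope[OF FN N int s])
    moreover have "f p = 0" using trunc_lev[of p 0 E M] by (simp add: f_def lev_0 E_def)
    ultimately have "f q \<le> real (2 * (k + k1) + 2) * D + 2" 
      using near[OF p] near[OF q] by simp
    also have "\<dots> < C * (real k + 1)"
    proof -
      have "0 \<le> D * (real k * (2 * real k1 + 2)) + D * 2" using D by simp
      then show ?thesis unfolding C_def by (simp add: algebra_simps)
    qed
    finally have lt: "f q < C * (real k + 1)" .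
    \<comment> \<open>Since \<open>M\<close> is the ceiling of \<open>C * (real k + 1)\<close>, a
      strictly smaller value has not been truncated and is the length of an actual chain.\<close>
    then have "trunc M E q \<noteq> M" unfolding f_def M_def by linarith
    then have "q \<in> lev (trunc M E q) E" using trunc_cases[of M E q] by auto
    then show ?thesis using lt unfolding f_def E_def by (intro exI[of _ "trunc M (insert p (deep r)) q"]) auto
  qed
  then show ?thesis using C by blast
qed

end

text \<open>A length bound witnessed by any function \<open>g\<close> whose increments dominate the
  distances along the curve. Such witnesses can be reversed and concatenated by formulas, without
  suprema over partitions; \<open>arclength_le\<close> returns to the arclength at the end.\<close>

definition len_le :: "(real \<Rightarrow> real^'n) \<Rightarrow> real \<Rightarrow> bool" where
  "len_le \<gamma> L \<longleftrightarrow> (\<exists>g::real\<Rightarrow>real. (\<forall>s t. 0 \<le> s \<and> s \<le> t \<and> t \<le> 1 \<longrightarrow> dist (\<gamma> s) (\<gamma> t) \<le> g t - g s) \<and> g 1 - g 0 \<le> L)"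

lemma len_le_mono: "len_le \<gamma> L \<Longrightarrow> L \<le> L' \<Longrightarrow> len_le \<gamma> L'"
  unfolding len_le_def by force

lemma len_le_linepath: "len_le (linepath x y) (dist x y)"
  unfolding len_le_def
proof (intro exI[of _ "\<lambda>t. t * dist x y"] conjI allI impI)
  fix s t :: real assume "0 \<le> s \<and> s \<le> t \<and> t \<le> 1"
  moreover have "linepath x y s - linepath x y t = (t - s) *\<^sub>R (x - y)"
    by (simp add: linepath_def algebra_simps)
  then have "dist (linepath x y s) (linepath x y t) = \<bar>t - s\<bar> * dist x y"
    by (simp add: dist_norm)
  ultimately show "dist (linepath x y s) (linepath x y t) \<le> t * dist x y - s * dist x y"
    by (simp add: left_diff_distrib)
qed simp

lemma len_le_reverse:
  assumes "len_le \<gamma> L" shows "len_le (reversepath \<gamma>) L"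
proof -
  obtain g where g: "\<And>s t. 0 \<le> s \<and> s \<le> t \<and> t \<le> 1 \<Longrightarrow> dist (\<gamma> s) (\<gamma> t) \<le> g t - g s" "g 1 - g 0 \<le> L"
    using assms unfolding len_le_def by blast
  show ?thesis unfolding len_le_def reversepath_def
  proof (intro exI[of _ "\<lambda>t. - g (1 - t)"] conjI allI impI)
    fix s t :: real assume "0 \<le> s \<and> s \<le> t \<and> t \<le> 1"
    then show "dist (\<gamma> (1 - s)) (\<gamma> (1 - t)) \<le> - g (1 - t) - - g (1 - s)"
      using g(1)[of "1 - t" "1 - s"] by (simp add: dist_commute)
  qed (use g(2) in simp)
qed

lemma len_le_join:
  assumes "len_le \<gamma>1 L1" "len_le \<gamma>2 L2" and fs: "pathfinish \<gamma>1 = pathstart \<gamma>2"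
  shows "len_le (\<gamma>1 +++ \<gamma>2) (L1 + L2)"
proof -
  obtain g where g: "\<And>s t. 0 \<le> s \<and> s \<le> t \<and> t \<le> 1 \<Longrightarrow> dist (\<gamma>1 s) (\<gamma>1 t) \<le> g t - g s" "g 1 - g 0 \<le> L1"
    using assms unfolding len_le_def by blast
  obtain h where h: "\<And>s t. 0 \<le> s \<and> s \<le> t \<and> t \<le> 1 \<Longrightarrow> dist (\<gamma>2 s) (\<gamma>2 t) \<le> h t - h s" "h 1 - h 0 \<le> L2"
    using assms unfolding len_le_def by blast
  define k where "k = (\<lambda>t::real. if t \<le> 1/2 then g (2 * t) else g 1 + h (2 * t - 1) - h 0)"
  show ?thesis unfolding len_le_def
  proof (intro exI[of _ k] conjI allI impI)
    fix s t :: real assume st: "0 \<le> s \<and> s \<le> t \<and> t \<le> 1"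
    consider "t \<le> 1/2" | "s > 1/2" | "s \<le> 1/2" "t > 1/2" by linarith
    then show "dist ((\<gamma>1 +++ \<gamma>2) s) ((\<gamma>1 +++ \<gamma>2) t) \<le> k t - k s"
    proof cases
      case 1
      then show ?thesis using st g(1)[of "2 * s" "2 * t"] by (simp add: joinpaths_def k_def)
    next
      case 2
      then show ?thesis using st h(1)[of "2 * s - 1" "2 * t - 1"] by (simp add: joinpaths_def k_def)
    next
      case 3
      have e: "\<gamma>1 1 = \<gamma>2 0" using fs by (simp add: pathfinish_def pathstart_def)
      have "dist (\<gamma>1 (2 * s)) (\<gamma>2 (2 * t - 1)) \<le> dist (\<gamma>1 (2 * s)) (\<gamma>1 1) + dist (\<gamma>2 0) (\<gamma>2 (2 * t - 1))"
        unfolding e by (rule dist_triangle)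
      also have "\<dots> \<le> (g 1 - g (2 * s)) + (h (2 * t - 1) - h 0)"
        using 3 st by (intro add_mono g(1) h(1)) auto
      finally show ?thesis using 3 by (simp add: joinpaths_def k_def)
    qed
  next
    show "k 1 - k 0 \<le> L1 + L2" using g(2) h(2) by (simp add: k_def)
  qed
qed

lemma len_le_dist_start:
  assumes "len_le \<gamma> L" "w \<in> path_image \<gamma>"
  shows "dist (pathstart \<gamma>) w \<le> L" "dist w (pathfinish \<gamma>) \<le> L"
proof -
  obtain g where g: "\<And>s t. 0 \<le> s \<and> s \<le> t \<and> t \<le> 1 \<Longrightarrow> dist (\<gamma> s) (\<gamma> t) \<le> g t - g s" "g 1 - g 0 \<le> L"
    using assms unfolding len_le_def by blast
  obtain t where t: "0 \<le> t" "t \<le> 1" "w = \<gamma> t" using assms by (auto simp: path_image_def)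
  have "0 \<le> dist (\<gamma> 0) w" "0 \<le> dist w (\<gamma> 1)" by simp_all
  moreover have "dist (\<gamma> 0) w \<le> g t - g 0" "dist w (\<gamma> 1) \<le> g 1 - g t" using g(1)[of 0 t] g(1)[of t 1] t by auto
  ultimately show "dist (pathstart \<gamma>) w \<le> L" "dist w (pathfinish \<gamma>) \<le> L"
    using g(2) unfolding pathstart_def pathfinish_def by linarith+
qed

lemma arclength_le:
  assumes "len_le \<gamma> L" shows "arclength \<gamma> \<le> ennreal L"
proof -
  obtain g where g: "\<And>s t. 0 \<le> s \<and> s \<le> t \<and> t \<le> 1 \<Longrightarrow> dist (\<gamma> s) (\<gamma> t) \<le> g t - g s" "g 1 - g 0 \<le> L"
    using assms unfolding len_le_def by blast
  have "(\<Sum>i<k. ennreal (dist (\<gamma> (t i)) (\<gamma> (t (Suc i))))) \<le> ennreal L" if t: "mono t" "range t \<subseteq> {0..1}" for k and t :: "nat \<Rightarrow> real"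
  proof -
    have t01: "0 \<le> t i" "t i \<le> 1" for i using t(2) by (auto simp: image_subset_iff)
    have "(\<Sum>i<k. dist (\<gamma> (t i)) (\<gamma> (t (Suc i)))) \<le> (\<Sum>i<k. g (t (Suc i)) - g (t i))"
      using t01 t(1) by (intro sum_mono g(1)) (auto simp: mono_iff_le_Suc)
    also have "\<dots> = g (t k) - g (t 0)" by (rule sum_lessThan_telescope)
    also have "\<dots> \<le> L"
      using g(1)[of 0 "t 0"] g(1)[of "t k" 1] t01[of 0] t01[of k] g(2) 
        zero_le_dist[of "\<gamma> 0" "\<gamma> (t 0)"] zero_le_dist[of "\<gamma> (t k)" "\<gamma> 1"] by linarith
    finally show ?thesis by (simp add: ennreal_leI)
  qed
  then show ?thesis unfolding arclength_def by (intro SUP_least) auto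
qed

text \<open>The inserted vertex \<open>z 0\<close> accounts for the constant path when
  \<open>m = 0\<close>.\<close>

lemma polygon_path:
  fixes z :: "nat \<Rightarrow> real^'n"
  shows "\<exists>\<gamma>. path \<gamma> \<and> pathstart \<gamma> = z 0 \<and> pathfinish \<gamma> = z m \<and> len_le \<gamma> (\<Sum>i<m. dist (z i) (z (Suc i))) \<and>
    path_image \<gamma> \<subseteq> insert (z 0) (\<Union>i<m. closed_segment (z i) (z (Suc i)))"
proof (induction m)
  case 0
  have "len_le (linepath (z 0) (z 0)) 0" using len_le_linepath[of "z 0" "z 0"] by simp
  moreover have "path_image (linepath (z 0) (z 0)) = {z 0}" by (subst path_image_linepath) simp
  ultimately show ?case
    using path_linepath[of "z 0" "z 0"] pathstart_linepath[of "z 0" "z 0"] pathfinish_linepath[of "z 0" "z 0"]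
    by (intro exI[of _ "linepath (z 0) (z 0)"] conjI) (simp_all del: linepath_trivial)
next
  case (Suc m)
  then obtain \<gamma> where g: "path \<gamma>" "pathstart \<gamma> = z 0" "pathfinish \<gamma> = z m"
    "len_le \<gamma> (\<Sum>i<m. dist (z i) (z (Suc i)))"
    "path_image \<gamma> \<subseteq> insert (z 0) (\<Union>i<m. closed_segment (z i) (z (Suc i)))" by blast
  have "len_le (\<gamma> +++ linepath (z m) (z (Suc m))) ((\<Sum>i<m. dist (z i) (z (Suc i))) + dist (z m) (z (Suc m)))"
    using g by (intro len_le_join len_le_linepath) auto
  moreover have "path_image (\<gamma> +++ linepath (z m) (z (Suc m))) \<subseteq> insert (z 0) (\<Union>i<Suc m. closed_segment (z i) (z (Suc i)))"
    using g by (subst path_image_join) (auto simp: lessThan_Suc)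
  ultimately show ?case using g
    by (intro exI[of _ "\<gamma> +++ linepath (z m) (z (Suc m))"]) auto
qed

lemma power_two_dominates:
  fixes K :: real
  shows "\<exists>k0. \<forall>k\<ge>k0. K * (real k + 2) \<le> 2 ^ k"
proof -
  have "(\<lambda>n. of_nat n * (1/2::real) ^ n) \<longlonglongrightarrow> 0" by (rule powser_times_n_limit_0) simp
  then have "(\<lambda>n. K * (of_nat n * (1/2) ^ n) + K * 2 * (1/2) ^ n) \<longlonglongrightarrow> K * 0 + K * 2 * 0"
    by (intro tendsto_intros) auto
  then have "\<forall>\<^sub>F n in sequentially. K * (of_nat n * (1/2) ^ n) + K * 2 * (1/2::real) ^ n < 1"
    by (rule order_tendstoD) simp
  then obtain k0 where "\<And>k. k \<ge> k0 \<Longrightarrow> K * (of_nat k * (1/2) ^ k) + K * 2 * (1/2::real) ^ k < 1"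
    unfolding eventually_sequentially by blast
  then have "K * (real k + 2) \<le> 2 ^ k" if "k \<ge> k0" for k
    using that by (force simp: power_divide field_simps)
  then show ?thesis by blast
qed

text \<open>The least admissible \<open>k\<close> satisfies k < log2(N H) + 1 unless it is small, so
  N would be at most C (log2(N H) + 2), which fails for large N. Powers of two in the hypothesis
  keep logarithms out of the chain estimates.\<close>

lemma log_bound:
  fixes C H :: real
  assumes H: "0 < H"
  shows "\<exists>N0. \<forall>N. (\<forall>k. real N * H \<le> 2 ^ k \<longrightarrow> real N \<le> C * (real k + 1)) \<longrightarrow> N \<le> (N0::nat)"
proof -
  obtain k0 where k0: "\<And>k. k \<ge> k0 \<Longrightarrow> (H * C) * (real k + 2) \<le> 2 ^ k" using power_two_dominates by blast
  have "real N \<le> max (2 ^ k0 / H) 0" if N: "\<And>k. real N * H \<le> 2 ^ k \<Longrightarrow> real N \<le> C * (real k + 1)" for N :: nat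
  proof (rule ccontr)
    assume "\<not> ?thesis"
    then have N0: "2 ^ k0 < real N * H" using H by (simp add: field_simps)
    define k where "k = (LEAST k. real N * H \<le> 2 ^ k)"
    have ex: "\<exists>k. real N * H \<le> 2 ^ k" by (meson less_imp_le real_arch_pow one_less_numeral_iff semiring_norm(76))
    have k: "real N * H \<le> 2 ^ k" unfolding k_def using ex by (rule LeastI_ex)
    have kk: "k0 < k" 
    proof (rule ccontr)
      assume "\<not> k0 < k"
      then have "(2::real) ^ k \<le> 2 ^ k0" by simp
      then show False using k N0 by linarith
    qed
    have "\<not> real N * H \<le> 2 ^ (k - 1)" using kk not_less_Least[of "k - 1" "\<lambda>k. real N * H \<le> 2 ^ k"] by (simp add: k_def)
    then have "2 ^ (k - 1) < H * real N" by (simp add: mult.commute)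
    also have "\<dots> \<le> H * (C * (real k + 1))" using N[OF k] H by (intro mult_left_mono) auto
    also have "\<dots> = (H * C) * (real (k - 1) + 2)" using kk by (simp add: of_nat_diff)
    also have "\<dots> \<le> 2 ^ (k - 1)" using kk by (intro k0) auto
    finally show False by simp
  qed
  then have "N \<le> nat \<lceil>max (2 ^ k0 / H) 0\<rceil>" if "\<forall>k. real N * H \<le> 2 ^ k \<longrightarrow> real N \<le> C * (real k + 1)" for N :: nat
    using that by (simp add: le_nat_iff le_ceiling_iff nat_le_real_less)  (smt (verit) le_of_int_ceiling of_int_of_nat_eq of_nat_nat of_nat_le_iff)
  then show ?thesis by blast
qed

text \<open>Gehring--Osgood argument for the depths \<open>a i\<close> along a minimal chain. Between the position of the
maximum of \<open>a\<close> up to \<open>i\<close> and the first later position reaching that maximum, the chain has boundedly many steps,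
so \<open>a\<close> is almost increasing; applied once more, \<open>a\<close> doubles after boundedly many steps.\<close>

lemma growth_sum:
  fixes C :: real
  assumes C: "0 \<le> C"
  shows "\<exists>B>0. \<forall>a m. (\<forall>i\<le>m. 0 < a i \<and> a i \<le> a m) \<longrightarrow> (\<forall>i<m. a (Suc i) \<le> 2 * a i \<and> a i \<le> 2 * a (Suc i)) \<longrightarrow>
     (\<forall>i j k. i < j \<and> j \<le> m \<and> (\<Sum>l=i..<j. a l) \<le> 2 ^ k * min (a i) (a j) \<longrightarrow> real (j - i) \<le> C * (real k + 1)) \<longrightarrow>
     (\<forall>i\<le>m. (\<Sum>l\<le>i. a l) \<le> B * (a i :: real))"
proof -
  obtain N1 where N1: "\<And>N. (\<And>k. real N * 1 \<le> 2 ^ k \<Longrightarrow> real N \<le> C * (real k + 1)) \<Longrightarrow> N \<le> (N1::nat)"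
    using log_bound[of 1 C] by auto
  define B1 where "B1 = (2::real) ^ N1"
  have B1: "1 \<le> B1" by (simp add: B1_def)
  obtain N2 where N2: "\<And>N. (\<And>k. real N * (2 * B1) \<le> 2 ^ k \<Longrightarrow> real N \<le> C * (real k + 1)) \<Longrightarrow> N \<le> (N2::nat)"
    using log_bound[of "2 * B1" C] B1 by auto
  \<comment> \<open>Solves B = B/2 + (N2 + 1) B1: the last N2 + 1 terms of the sum are at most
    \<open>B1 * a i\<close> each, and the induction hypothesis covers the rest at an index where
    \<open>a\<close> is at most half of \<open>a i\<close>.\<close>
  define B where "B = 2 * (real N2 + 1) * B1"
  have B: "0 < B" using B1 by (simp add: B_def)
  have "(\<Sum>l\<le>i. a l) \<le> B * a i"
    if pos: "\<And>i. i \<le> m \<Longrightarrow> 0 < a i" and top: "\<And>i. i \<le> m \<Longrightarrow> a i \<le> a m"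
      and step: "\<And>i. i < m \<Longrightarrow> a i \<le> 2 * a (Suc i)"
      and P: "\<And>i j k. i < j \<Longrightarrow> j \<le> m \<Longrightarrow> (\<Sum>l=i..<j. a l) \<le> 2 ^ k * min (a i) (a j) \<Longrightarrow> real (j - i) \<le> C * (real k + 1)"
      and i: "i \<le> m" for a :: "nat \<Rightarrow> real" and m i
  proof -
    have decay: "a i \<le> 2 ^ k * a (i + k)" if "i + k \<le> m" for i k
      using that
    proof (induction k)
      case (Suc k)
      have "a i \<le> 2 ^ k * a (i + k)" using Suc by simp
      also have "\<dots> \<le> 2 ^ k * (2 * a (Suc (i + k)))" using Suc.prems by (intro mult_left_mono step) auto
      finally show ?case by (simp add: mult_ac)
    qed simp
    have Q1: "a l \<le> B1 * a i" if li: "l \<le> i" "i \<le> m" for l i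
    proof -
      have "\<exists>k\<in>{..i}. \<forall>l\<in>{..i}. a l \<le> a k"
      proof -
        have "Max (a ` {..i}) \<in> a ` {..i}" by (intro Max_in) auto
        then obtain k where k: "k \<in> {..i}" "a k = Max (a ` {..i})" by (metis imageE)
        then show ?thesis by (intro bexI[of _ k]) auto
      qed
      then obtain k0 where k0: "k0 \<le> i" "\<And>l. l \<le> i \<Longrightarrow> a l \<le> a k0" by auto
      define j where "j = (LEAST j. i \<le> j \<and> a k0 \<le> a j)"
      have ex: "i \<le> m \<and> a k0 \<le> a m" using li k0 top[of k0] by auto
      have j: "i \<le> j" "a k0 \<le> a j" "j \<le> m" 
        unfolding j_def using LeastI[of "\<lambda>j. i \<le> j \<and> a k0 \<le> a j", OF ex] Least_le[of "\<lambda>j. i \<le> j \<and> a k0 \<le> a j", OF ex] by auto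
      have small: "a l \<le> a k0" if "l < j" for l
      proof (cases "l \<le> i")
        case False
        then show ?thesis using that not_less_Least[of l "\<lambda>j. i \<le> j \<and> a k0 \<le> a j"] by (auto simp: j_def)
      qed (use k0 in auto)
      have "j - k0 \<le> N1"
      proof (rule N1)
        fix k assume k: "real (j - k0) * 1 \<le> 2 ^ k"
        show "real (j - k0) \<le> C * (real k + 1)"
        proof (cases "k0 < j")
          case True
          have "(\<Sum>l=k0..<j. a l) \<le> (\<Sum>l=k0..<j. a k0)" using small by (intro sum_mono) auto
          also have "\<dots> = real (j - k0) * a k0" by simp
          also have "\<dots> \<le> 2 ^ k * a k0" using k pos[of k0] k0 li by (intro mult_right_mono) auto
          finally show ?thesis using True j by (intro P) (auto simp: min_def)
        next
          case False
          then show ?thesis using C by simp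
        qed
      qed
      then have "i - k0 \<le> N1" using j by linarith
      have "a l \<le> a k0" using k0 li by auto
      also have "\<dots> \<le> 2 ^ (i - k0) * a i" using decay[of k0 "i - k0"] k0 li by simp
      also have "\<dots> \<le> B1 * a i" unfolding B1_def 
        using \<open>i - k0 \<le> N1\<close> pos[OF li(2)] by (intro mult_right_mono power_increasing) auto
      finally show ?thesis .
    qed
    have Q2: "a l \<le> a i / 2" if li: "l + N2 < i" "i \<le> m" for l i
    proof (rule ccontr)
      assume "\<not> a l \<le> a i / 2"
      then have big: "a i / 2 \<le> min (a l) (a i)" using pos[OF li(2)] by auto
      have "i - l \<le> N2"
      proof (rule N2)
        fix k assume k: "real (i - l) * (2 * B1) \<le> 2 ^ k"
        have "(\<Sum>j=l..<i. a j) \<le> (\<Sum>j=l..<i. B1 * a i)" using Q1 li by (intro sum_mono) auto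
        also have "\<dots> = (real (i - l) * (2 * B1)) * (a i / 2)" by simp
        also have "\<dots> \<le> 2 ^ k * (a i / 2)" using k pos[OF li(2)] by (intro mult_right_mono) auto
        also have "\<dots> \<le> 2 ^ k * min (a l) (a i)" using big by (intro mult_left_mono) auto
        finally show "real (i - l) \<le> C * (real k + 1)" using li by (intro P) auto
      qed
      then show False using li by linarith
    qed
    show ?thesis using i
    proof (induction i rule: less_induct)
      case (less i)
      have few: "sum a S \<le> (real N2 + 1) * B1 * a i" if "S \<subseteq> {..i}" "card S \<le> N2 + 1" for S
      proof -
        have "sum a S \<le> real (card S) * (B1 * a i)" 
          using that less.prems Q1 by (intro sum_bounded_above) auto
        also have "\<dots> \<le> (real N2 + 1) * (B1 * a i)"
          using that B1 pos[OF less.prems] by (intro mult_right_mono) auto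
        finally show ?thesis by (simp add: mult.assoc)
      qed
      have p: "0 \<le> (real N2 + 1) * B1 * a i" using B1 pos[OF less.prems] by simp
      show ?case
      proof (cases "i \<le> N2")
        case True
        have "B * a i = 2 * ((real N2 + 1) * B1 * a i)" by (simp add: B_def)
        moreover have "(\<Sum>l\<le>i. a l) \<le> (real N2 + 1) * B1 * a i" using True by (intro few) auto
        ultimately show ?thesis using p by linarith
      next
        case False
        define l where "l = i - (N2 + 1)"
        have l: "l < i" "l + N2 < i" "i = l + (N2 + 1)" using False by (auto simp: l_def)
        have "(\<Sum>j\<le>i. a j) = (\<Sum>j\<le>l. a j) + (\<Sum>j\<in>{l<..i}. a j)"
        proof -
          have "{..i} = {..l} \<union> {l<..i}" using l by auto
          then show ?thesis by (simp only:) (rule sum.union_disjoint, auto)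
        qed
        also have "\<dots> \<le> B * a l + (real N2 + 1) * B1 * a i"
          using l less by (intro add_mono few less.IH) auto
        also have "\<dots> \<le> B * (a i / 2) + (real N2 + 1) * B1 * a i"
          using Q2[OF l(2) less.prems] B by (intro add_right_mono mult_left_mono) auto
        also have "\<dots> = B * a i" unfolding B_def by (simp add: algebra_simps)
        finally show ?thesis .
      qed
    qed
  qed
  note main = this
  show ?thesis
  proof (intro exI[of _ B] conjI B allI impI)
    fix a :: "nat \<Rightarrow> real" and m i
    assume "\<forall>i\<le>m. 0 < a i \<and> a i \<le> a m" and "\<forall>i<m. a (Suc i) \<le> 2 * a i \<and> a i \<le> 2 * a (Suc i)"
      and P: "\<forall>i j k. i < j \<and> j \<le> m \<and> (\<Sum>l=i..<j. a l) \<le> 2 ^ k * min (a i) (a j) \<longrightarrow> real (j - i) \<le> C * (real k + 1)"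
      and "i \<le> m"
    moreover have "real (j - i) \<le> C * (real k + 1)"
      if "i < j" "j \<le> m" "(\<Sum>l=i..<j. a l) \<le> 2 ^ k * min (a i) (a j)" for i j k
      using P that by blast
    ultimately show "(\<Sum>l\<le>i. a l) \<le> B * a i" by (intro main) auto
  qed
qed

section \<open>Carrots, the middle piece, and the joining curve\<close>

context proper_domain
begin

lemma segment_near:
  assumes z: "z \<in> \<Omega>" and zw: "qstep z z'" and w: "w \<in> closed_segment z z'"
  shows "w \<in> \<Omega>" "dist w z \<le> d z / 100" "d z \<le> 2 * d w"
proof -
  have dz: "0 < d z" using d_pos z by blast
  have "dist w z \<le> dist z' z" using w dist_in_closed_segment(1)[of w z z'] by (simp add: dist_commute)
  also have "\<dots> \<le> \<kappa> * d z" using qstep_dist(1)[OF zw] by (simp add: dist_commute)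
  also have "\<dots> \<le> (1/100) * d z" using \<kappa>_bounds dz by (intro mult_right_mono) auto
  finally show *: "dist w z \<le> d z / 100" by simp
  then show "w \<in> \<Omega>" using dz by (intro ball_sub[OF z]) (simp add: dist_commute)
  show "d z \<le> 2 * d w" using * d_le[of z w] dz by (simp add: dist_commute)
qed

lemma qpow_seq: "qpow m x y \<longleftrightarrow> (\<exists>z. z 0 = x \<and> z m = y \<and> (\<forall>i<m. qstep (z i) (z (Suc i))))"
  by (rule relpowp_fun_conv)

lemma qpow_part:
  assumes "\<And>i. i < m \<Longrightarrow> qstep (z i) (z (Suc i))" "i \<le> j" "j \<le> m"
  shows "qpow (j - i) (z i) (z j)"
  unfolding qpow_seq using assms by (intro exI[of _ "\<lambda>l. z (i + l)"]) auto

lemma dist_seq: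
  fixes z :: "nat \<Rightarrow> real^'n"
  assumes "i \<le> j" shows "dist (z i) (z j) \<le> (\<Sum>l=i..<j. dist (z l) (z (Suc l)))"
  using assms
proof (induction j rule: dec_induct)
  case (step j)
  then show ?case using dist_triangle[of "z i" "z (Suc j)" "z j"] by simp
qed simp

text \<open>In a chain of minimal length from \<open>x\<close> to \<open>deep r\<close>, the number
  \<open>j - i\<close> is at most the length of any chain from \<open>z i\<close> to
  \<open>z j\<close>, and also of any chain from \<open>z i\<close> to \<open>deep r\<close>. Hence
  both possible ends of the short chain in \<open>extension_chain\<close> give the same bound. The
  last depth is the largest one because all earlier depths are below \<open>r\<close>; this is what
  \<open>growth_sum\<close> requires.\<close>

lemma carrot_chain:
  assumes lam: "0 < lam" and T: "extension_operator lam \<Omega> T" and bT: "bounded_operator lam \<Omega> T"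
  shows "\<exists>B>0. \<forall>x\<in>\<Omega>. \<forall>r. d x < r \<and> r \<le> lam / 2 \<and> deep r \<noteq> {} \<longrightarrow>
     (\<exists>m z. z 0 = x \<and> z m \<in> deep r \<and> (\<forall>i<m. qstep (z i) (z (Suc i)) \<and> d (z i) < r) \<and> 
        (\<forall>i\<le>m. (\<Sum>l\<le>i. d (z l)) \<le> B * d (z i)))"
proof -
  obtain C where C: "0 < C" and chain: "\<And>p q r k. p \<in> \<Omega> \<Longrightarrow> q \<in> \<Omega> \<Longrightarrow> r \<le> lam / 2 \<Longrightarrow> dist p q \<le> 2 ^ k * min (d p) (d q) \<Longrightarrow>
     \<exists>m. real m \<le> C * (real k + 1) \<and> q \<in> lev m (insert p (deep r))"
    using extension_chain[OF assms] by metis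
  from growth_sum[OF less_imp_le[OF C]] obtain B where B: "0 < B" and
    growth: "\<forall>a m. (\<forall>i\<le>m. 0 < a i \<and> a i \<le> a m) \<longrightarrow> (\<forall>i<m. a (Suc i) \<le> 2 * a i \<and> a i \<le> 2 * a (Suc i)) \<longrightarrow>
     (\<forall>i j k. i < j \<and> j \<le> m \<and> (\<Sum>l=i..<j. a l) \<le> 2 ^ k * min (a i) (a j) \<longrightarrow> real (j - i) \<le> C * (real k + 1)) \<longrightarrow>
     (\<forall>i\<le>m. (\<Sum>l\<le>i. a l) \<le> B * (a i :: real))"
    by (elim exE conjE) (rule that)
  have "\<exists>m z. z 0 = x \<and> z m \<in> deep r \<and> (\<forall>i<m. qstep (z i) (z (Suc i)) \<and> d (z i) < r) \<and> 
        (\<forall>i\<le>m. (\<Sum>l\<le>i. d (z l)) \<le> B * d (z i))"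
    if x: "x \<in> \<Omega>" and r: "d x < r" "r \<le> lam / 2" and ne: "deep r \<noteq> {}" for x r
  proof -
    define m where "m = (LEAST m. \<exists>y\<in>deep r. qpow m x y)"
    have ex: "\<exists>m. \<exists>y\<in>deep r. qpow m x y" using ne qpow_connected[OF x] by (fastforce simp: deep_def)
    have min: "m \<le> k" if "y \<in> deep r" "qpow k x y" for k y
      unfolding m_def using that by (intro Least_le) blast
    from LeastI_ex[OF ex] obtain y where y: "y \<in> deep r" "qpow m x y" unfolding m_def by blast
    then obtain z where z: "z 0 = x" "z m = y" and zs: "\<And>i. i < m \<Longrightarrow> qstep (z i) (z (Suc i))"
      unfolding qpow_seq by blast
    have x0: "qpow i x (z i)" if "i \<le> m" for i using qpow_part[of m z 0 i] zs that z by simp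
    have zO: "z i \<in> \<Omega>" if "i \<le> m" for i using x0[OF that] qpow_in x by blast
    have low: "d (z i) < r" if "i < m" for i
      using min[of "z i" i] x0[of i] zO[of i] that by (force simp: deep_def)
    have top: "r \<le> d (z m)" using y z by (simp add: deep_def)
    have "(\<Sum>l\<le>i. d (z l)) \<le> B * d (z i)" if "i \<le> m" for i
    proof (rule growth[rule_format, OF _ _ _ that])
      show "0 < d (z i) \<and> d (z i) \<le> d (z m)" if "i \<le> m" for i
        using that low[of i] top d_pos[OF zO[OF that]] by (cases "i = m") auto
      show "d (z (Suc i)) \<le> 2 * d (z i) \<and> d (z i) \<le> 2 * d (z (Suc i))" if "i < m" for i
        using qstep_d[OF zs[OF that]] qstep_d[OF qstep_sym[OF zs[OF that]]] d_pos[OF zO[of i]] d_pos[OF zO[of "Suc i"]] that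
        by auto
      fix i j k assume "i < j \<and> j \<le> m \<and> (\<Sum>l=i..<j. d (z l)) \<le> 2 ^ k * min (d (z i)) (d (z j))"
      then have ij: "i < j" "j \<le> m" and s: "(\<Sum>l=i..<j. d (z l)) \<le> 2 ^ k * min (d (z i)) (d (z j))" by auto
      have "dist (z i) (z j) \<le> (\<Sum>l=i..<j. dist (z l) (z (Suc l)))" using ij by (intro dist_seq) auto
      also have "\<dots> \<le> (\<Sum>l=i..<j. d (z l))"
      proof (rule sum_mono)
        fix l assume "l \<in> {i..<j}"
        then have l: "l < m" using ij by auto
        have "\<kappa> * d (z l) \<le> 1 * d (z l)" using \<kappa>_bounds by (intro mult_right_mono) (auto simp: infdist_nonneg)
        then show "dist (z l) (z (Suc l)) \<le> d (z l)" using qstep_dist(1)[OF zs[OF l]] by simp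
      qed
      finally have "dist (z j) (z i) \<le> 2 ^ k * min (d (z j)) (d (z i))" using s by (simp add: dist_commute min.commute)
      moreover have im: "i \<le> m" using ij by simp
      ultimately obtain k' where k': "real k' \<le> C * (real k + 1)" "z i \<in> lev k' (insert (z j) (deep r))"
        using chain[OF zO[OF ij(2)] zO[OF im] r(2)] by blast
      have "j - i \<le> k'"
      proof -
        from k'(2) consider "qpow k' (z i) (z j)" | y' where "y' \<in> deep r" "qpow k' (z i) y'"
          by (auto simp: lev_def)
        then show ?thesis
        proof cases
          case 1
          have "qpow (i + k' + (m - j)) x (z m)"
            using qpow_trans[OF qpow_trans[OF x0 1] qpow_part[of m z j m]] zs ij by auto
          then have "m \<le> i + k' + (m - j)" using min y z by blast
          then show ?thesis using ij by linarith
        next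
          case 2
          have "qpow (i + k') x y'" using qpow_trans[OF x0 2(2)] ij by auto
          then have "m \<le> i + k'" using min 2 by blast
          then show ?thesis using ij by linarith
        qed
      qed
      then show "real (j - i) \<le> C * (real k + 1)" using k'(1) by linarith
    qed
    then show ?thesis using z zs low y by (intro exI[of _ m] exI[of _ z]) auto
  qed
  then show ?thesis using B by blast
qed

text \<open>The polygon through the carrot chain. The sum of depths bounds the way back to
  \<open>x\<close> as well as, at the top, the whole length; passing from vertices to points of
  edges costs a factor 2.\<close>

lemma carrot_path:
  assumes lam: "0 < lam" and T: "extension_operator lam \<Omega> T" and bT: "bounded_operator lam \<Omega> T"
  shows "\<exists>B>0. \<forall>x\<in>\<Omega>. \<forall>r. d x < r \<and> r \<le> lam / 2 \<and> deep r \<noteq> {} \<longrightarrow>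
     (\<exists>\<gamma>. path \<gamma> \<and> pathstart \<gamma> = x \<and> pathfinish \<gamma> \<in> deep r \<and> d (pathfinish \<gamma>) \<le> 2 * r \<and> len_le \<gamma> (B * r) \<and>
        (\<forall>w\<in>path_image \<gamma>. w \<in> \<Omega> \<and> dist w x \<le> B * d w))"
proof -
  obtain B where B: "0 < B" and chain: "\<And>x r. x \<in> \<Omega> \<Longrightarrow> d x < r \<and> r \<le> lam / 2 \<and> deep r \<noteq> {} \<Longrightarrow>
     (\<exists>m z. z 0 = x \<and> z m \<in> deep r \<and> (\<forall>i<m. qstep (z i) (z (Suc i)) \<and> d (z i) < r) \<and> 
        (\<forall>i\<le>m. (\<Sum>l\<le>i. d (z l)) \<le> B * d (z i)))"
    using carrot_chain[OF assms] by metis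
  have "\<exists>\<gamma>. path \<gamma> \<and> pathstart \<gamma> = x \<and> pathfinish \<gamma> \<in> deep r \<and> d (pathfinish \<gamma>) \<le> 2 * r \<and> len_le \<gamma> (2 * B * r) \<and>
        (\<forall>w\<in>path_image \<gamma>. w \<in> \<Omega> \<and> dist w x \<le> 2 * B * d w)"
    if x: "x \<in> \<Omega>" and r: "d x < r" "r \<le> lam / 2" "deep r \<noteq> {}" for x r
  proof -
    obtain m z where z: "z 0 = x" "z m \<in> deep r" and zs: "\<And>i. i < m \<Longrightarrow> qstep (z i) (z (Suc i))"
      and low: "\<And>i. i < m \<Longrightarrow> d (z i) < r" and S: "\<And>i. i \<le> m \<Longrightarrow> (\<Sum>l\<le>i. d (z l)) \<le> B * d (z i)"
      using chain[OF x] r by blast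
    have zO: "z i \<in> \<Omega>" if "i \<le> m" for i
      using qpow_part[of m z 0 i] zs that z x qpow_in by auto
    have m: "0 < m" using z r by (cases m) (auto simp: deep_def)
    have top: "d (z m) \<le> 2 * r"
      using qstep_d[OF zs[of "m - 1"]] low[of "m - 1"] m d_pos[OF zO[of "m - 1"]] by auto
    have stp: "dist (z i) (z (Suc i)) \<le> d (z i) / 100" if "i < m" for i
      using segment_near(2)[OF zO zs[OF that], of "z (Suc i)"] that by (simp add: dist_commute)
    obtain \<gamma> where g: "path \<gamma>" "pathstart \<gamma> = z 0" "pathfinish \<gamma> = z m" "len_le \<gamma> (\<Sum>i<m. dist (z i) (z (Suc i)))"
      "path_image \<gamma> \<subseteq> insert (z 0) (\<Union>i<m. closed_segment (z i) (z (Suc i)))" using polygon_path[of z m] by blast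
    have len: "(\<Sum>i<m. dist (z i) (z (Suc i))) \<le> 2 * B * r"
    proof -
      have "(\<Sum>i<m. dist (z i) (z (Suc i))) \<le> (\<Sum>i<m. d (z i))"
      proof (rule sum_mono)
        fix i assume "i \<in> {..<m}"
        then show "dist (z i) (z (Suc i)) \<le> d (z i)" using stp[of i] d_pos[OF zO[of i]] by auto
      qed
      also have "\<dots> \<le> (\<Sum>i\<le>m. d (z i))" by (intro sum_mono2) (auto simp: infdist_nonneg)
      also have "\<dots> \<le> B * (2 * r)" using order_trans[OF S[OF order_refl] mult_left_mono[OF top]] B by simp
      finally show ?thesis by simp
    qed
    have "w \<in> \<Omega> \<and> dist w x \<le> 2 * B * d w" if w: "w \<in> path_image \<gamma>" for w
    proof (cases "w = x")
      case True
      then show ?thesis using x B by (simp add: infdist_nonneg)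
    next
      case False
      then obtain i where i: "i < m" "w \<in> closed_segment (z i) (z (Suc i))" using g(5) w z by auto
      note near = segment_near[OF zO zs[OF i(1)] i(2)]
      have zi: "0 < d (z i)" using d_pos[OF zO] i by simp
      have "dist w x \<le> dist (z i) x + dist w (z i)" using dist_triangle[of w x "z i"] by simp
      also have "\<dots> \<le> (\<Sum>l<i. dist (z l) (z (Suc l))) + d (z i)"
        using dist_seq[of 0 i z] z near(2) i zi by (simp add: dist_commute atLeast0LessThan)
      also have "\<dots> \<le> (\<Sum>l<i. d (z l)) + d (z i)"
      proof (intro add_right_mono sum_mono)
        fix l assume "l \<in> {..<i}"
        then show "dist (z l) (z (Suc l)) \<le> d (z l)" using stp[of l] d_pos[OF zO[of l]] i by auto
      qed
      also have "\<dots> = (\<Sum>l\<le>i. d (z l))" by (simp add: lessThan_Suc_atMost[symmetric])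
      also have "\<dots> \<le> B * d (z i)" using S i by auto
      also have "\<dots> \<le> B * (2 * d w)" using near(3) i B by (intro mult_left_mono) auto
      finally show ?thesis using near(1) i by (simp add: mult_ac)
    qed
    then show ?thesis using g z top len_le_mono[OF g(4) len] by (intro exI[of _ \<gamma>]) auto
  qed
  then show ?thesis using B by (intro exI[of _ "2 * B"]) auto
qed

text \<open>In \<open>m0\<close> steps the depth grows from at most \<open>2 * r\<close> by a factor
  of at most \<open>2 ^ m0\<close>. Since \<open>M\<close> exceeds \<open>2 * 2 ^ m0\<close>, the
  chain from \<open>q\<close> cannot end in \<open>deep (M * r)\<close>, so it ends at
  \<open>p\<close>. The same growth bound, applied from \<open>p\<close> and back to
  \<open>p\<close>, keeps all depths comparable to \<open>r\<close>.\<close>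

lemma middle_path:
  assumes lam: "0 < lam" and T: "extension_operator lam \<Omega> T" and bT: "bounded_operator lam \<Omega> T"
  shows "\<exists>B>0. \<exists>M>0. \<forall>p q r. p \<in> deep r \<and> q \<in> deep r \<and> 0 < r \<and> M * r \<le> lam / 2 \<and> d p \<le> 2 * r \<and> d q \<le> 2 * r \<and> dist p q \<le> H * r \<longrightarrow>
     (\<exists>\<gamma>. path \<gamma> \<and> pathstart \<gamma> = p \<and> pathfinish \<gamma> = q \<and> len_le \<gamma> (B * r) \<and> (\<forall>w\<in>path_image \<gamma>. w \<in> \<Omega> \<and> r \<le> B * d w))"
proof -
  obtain C where C: "0 < C" and chain: "\<And>p q r k. p \<in> \<Omega> \<Longrightarrow> q \<in> \<Omega> \<Longrightarrow> r \<le> lam / 2 \<Longrightarrow> dist p q \<le> 2 ^ k * min (d p) (d q) \<Longrightarrow>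
     \<exists>m. real m \<le> C * (real k + 1) \<and> q \<in> lev m (insert p (deep r))"
    using extension_chain[OF assms] by metis
  obtain k where k: "H \<le> 2 ^ k" using two_power_ge by blast
  define m0 where "m0 = nat \<lfloor>C * (real k + 1)\<rfloor>"
  define M where "M = 2 * 2 ^ m0 + (1::real)"
  define B where "B = real m0 * (2 * 2 ^ m0) + 2 * 2 ^ m0"
  have "\<exists>\<gamma>. path \<gamma> \<and> pathstart \<gamma> = p \<and> pathfinish \<gamma> = q \<and> len_le \<gamma> (B * r) \<and> (\<forall>w\<in>path_image \<gamma>. w \<in> \<Omega> \<and> r \<le> B * d w)"
    if pq: "p \<in> deep r" "q \<in> deep r" and r: "0 < r" "M * r \<le> lam / 2" and up: "d p \<le> 2 * r" "d q \<le> 2 * r" and H: "dist p q \<le> H * r" for p q r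
  proof -
    have pO: "p \<in> \<Omega>" "q \<in> \<Omega>" and lo: "r \<le> d p" "r \<le> d q" using pq by (auto simp: deep_def)
    have "H * r \<le> 2 ^ k * min (d p) (d q)" using k r lo by (intro mult_mono) auto
    then obtain m where m: "real m \<le> C * (real k + 1)" "q \<in> lev m (insert p (deep (M * r)))"
      using chain[OF pO r(2), of k] H by auto
    have mm0: "m \<le> m0" using m(1) by (simp add: m0_def le_nat_floor)
    then have m2: "(2::real) ^ m \<le> 2 ^ m0" by simp
    have "qpow m q p"
    proof -
      obtain y where y: "y = p \<or> y \<in> deep (M * r)" "qpow m q y" using m(2) by (auto simp: lev_def)
      have "y \<notin> deep (M * r)"
      proof
        assume "y \<in> deep (M * r)"
        then have "M * r \<le> 2 ^ m * d q" using qpow_d[OF y(2)] by (simp add: deep_def)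
        also have "\<dots> \<le> 2 ^ m0 * (2 * r)" using m2 up r by (intro mult_mono) (auto simp: infdist_nonneg)
        also have "\<dots> < M * r" using r by (simp add: M_def algebra_simps)
        finally show False by simp
      qed
      then show ?thesis using y by auto
    qed
    then obtain z where z: "z 0 = p" "z m = q" and zs: "\<And>i. i < m \<Longrightarrow> qstep (z i) (z (Suc i))"
      using qpow_sym unfolding qpow_seq by metis
    have p0: "qpow i p (z i)" if "i \<le> m" for i using qpow_part[of m z 0 i] zs that z by simp
    have zO: "z i \<in> \<Omega>" if "i \<le> m" for i using p0[OF that] qpow_in pO by blast
    have zd: "d (z i) \<le> 2 ^ m0 * (2 * r)" "r \<le> 2 ^ m0 * d (z i)" if "i \<le> m" for i
    proof -
      have i: "(2::real) ^ i \<le> 2 ^ m0" using that mm0 by simp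
      have "d (z i) \<le> 2 ^ i * d p" by (rule qpow_d[OF p0[OF that]])
      also have "\<dots> \<le> 2 ^ m0 * (2 * r)" using i up by (intro mult_mono) (auto simp: infdist_nonneg)
      finally show "d (z i) \<le> 2 ^ m0 * (2 * r)" .
      have "r \<le> 2 ^ i * d (z i)" using qpow_d[OF qpow_sym[OF p0[OF that]]] lo by simp
      also have "\<dots> \<le> 2 ^ m0 * d (z i)" using i by (intro mult_right_mono) (auto simp: infdist_nonneg)
      finally show "r \<le> 2 ^ m0 * d (z i)" .
    qed
    obtain \<gamma> where g: "path \<gamma>" "pathstart \<gamma> = z 0" "pathfinish \<gamma> = z m" "len_le \<gamma> (\<Sum>i<m. dist (z i) (z (Suc i)))"
      "path_image \<gamma> \<subseteq> insert (z 0) (\<Union>i<m. closed_segment (z i) (z (Suc i)))" using polygon_path[of z m] by blast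
    have len: "(\<Sum>i<m. dist (z i) (z (Suc i))) \<le> B * r"
    proof -
      have "(\<Sum>i<m. dist (z i) (z (Suc i))) \<le> (\<Sum>i<m. 2 ^ m0 * (2 * r))"
      proof (rule sum_mono)
        fix i assume i: "i \<in> {..<m}"
        then have "dist (z i) (z (Suc i)) \<le> d (z i) / 100"
          using segment_near(2)[OF zO zs, of i "z (Suc i)"] by (simp add: dist_commute)
        then show "dist (z i) (z (Suc i)) \<le> 2 ^ m0 * (2 * r)" using zd(1)[of i] d_pos[OF zO[of i]] i by auto
      qed
      also have "\<dots> = real m * (2 ^ m0 * (2 * r))" by simp
      also have "\<dots> \<le> real m0 * (2 ^ m0 * (2 * r))" using mm0 r by (intro mult_right_mono) auto
      also have "\<dots> \<le> B * r" using r by (simp add: B_def algebra_simps)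
      finally show ?thesis .
    qed
    have "w \<in> \<Omega> \<and> r \<le> B * d w" if w: "w \<in> path_image \<gamma>" for w
    proof -
      have key: "r \<le> B * d w" if "d (z i) \<le> 2 * d w" "i \<le> m" for i
      proof -
        have "r \<le> 2 ^ m0 * d (z i)" using zd(2) that by auto
        also have "\<dots> \<le> 2 ^ m0 * (2 * d w)" using that by (intro mult_left_mono) auto
        also have "\<dots> = (2 * 2 ^ m0) * d w" by simp
        also have "\<dots> \<le> B * d w" by (intro mult_right_mono) (auto simp: B_def infdist_nonneg)
        finally show ?thesis .
      qed
      show ?thesis
      proof (cases "w = z 0")
        case True
        then show ?thesis using zO[of 0] key[of 0] infdist_nonneg[of "z 0" "frontier \<Omega>"] by auto
      next
        case False
        then obtain i where i: "i < m" "w \<in> closed_segment (z i) (z (Suc i))" using g(5) w z by auto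
        then show ?thesis using segment_near(1,3)[OF zO zs[OF i(1)] i(2)] key[of i] by auto
      qed
    qed
    then show ?thesis using g z len_le_mono[OF g(4) len] by (intro exI[of _ \<gamma>]) auto
  qed
  moreover have "0 < B" "0 < M" by (auto simp: B_def M_def add_nonneg_pos)
  ultimately show ?thesis by blast
qed

lemma dist_boundary_eq: "dist_boundary \<Omega> z = ereal (d z)"
  using proper by (simp add: dist_boundary_def)

lemma extension_imp_eps_delta:
  assumes lam: "0 < lam" and T: "extension_operator lam \<Omega> T" and bT: "bounded_operator lam \<Omega> T"
  shows "\<exists>\<epsilon>>0. \<exists>\<delta>>0. eps_delta_domain \<epsilon> \<delta> \<Omega>"
proof -
  obtain B where B: "0 < B" and carrot: "\<And>x r. x \<in> \<Omega> \<Longrightarrow> d x < r \<and> r \<le> lam / 2 \<and> deep r \<noteq> {} \<Longrightarrow>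
     (\<exists>\<gamma>. path \<gamma> \<and> pathstart \<gamma> = x \<and> pathfinish \<gamma> \<in> deep r \<and> d (pathfinish \<gamma>) \<le> 2 * r \<and> len_le \<gamma> (B * r) \<and>
        (\<forall>w\<in>path_image \<gamma>. w \<in> \<Omega> \<and> dist w x \<le> B * d w))"
    using carrot_path[OF assms] by metis
  obtain B2 M where B2: "0 < B2" "0 < M" and mid: "\<And>p q r. p \<in> deep r \<and> q \<in> deep r \<and> 0 < r \<and> M * r \<le> lam / 2 \<and> d p \<le> 2 * r \<and> d q \<le> 2 * r \<and> dist p q \<le> (2 * B + 1) * r \<Longrightarrow>
     (\<exists>\<gamma>. path \<gamma> \<and> pathstart \<gamma> = p \<and> pathfinish \<gamma> = q \<and> len_le \<gamma> (B2 * r) \<and> (\<forall>w\<in>path_image \<gamma>. w \<in> \<Omega> \<and> r \<le> B2 * d w))"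
    using middle_path[OF assms, of "2 * B + 1"] by metis
  obtain x0 where x0: "x0 \<in> \<Omega>" using neO by blast
  \<comment> \<open>For points closer than \<open>\<delta>\<close>, the depth
    \<open>r = 10 * dist x y\<close> satisfies \<open>r \<le> lam / 2\<close> and
    \<open>M * r \<le> lam / 2\<close>, and \<open>x0\<close> witnesses that \<open>deep r\<close>
    is nonempty.\<close>
  define \<delta> where "\<delta> = min (d x0) (min (lam / 2) (lam / (2 * M))) / 10"
  have \<delta>: "0 < \<delta>" using lam B2 d_pos[OF x0] by (simp add: \<delta>_def)
  have \<delta>': "10 * \<delta> \<le> d x0" "10 * \<delta> \<le> lam / 2" "M * (10 * \<delta>) \<le> lam / 2"
  proof -
    have "10 * \<delta> \<le> lam / (2 * M)" by (simp add: \<delta>_def)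
    then have "M * (10 * \<delta>) \<le> M * (lam / (2 * M))" using B2 by (intro mult_left_mono) auto
    then show "M * (10 * \<delta>) \<le> lam / 2" using B2 by simp
  qed (auto simp: \<delta>_def)
  \<comment> \<open>The summands serve, in this order, the segment case, the total length of three
    pieces, the depth condition on the carrots, and the depth condition on the middle piece.\<close>
  define K where "K = 1 + 10 * (2 * B + B2) + B * (10 * B + 1) + 10 * (B + B2) * (B + B2) * B2"
  have K: "1 \<le> K" using B B2 by (simp add: K_def)
  have "\<exists>\<gamma>. path \<gamma> \<and> path_image \<gamma> \<subseteq> \<Omega> \<and> pathstart \<gamma> = x \<and> pathfinish \<gamma> = y \<and> len_le \<gamma> (K * dist x y) \<and>
      (\<forall>z\<in>path_image \<gamma>. dist z x * dist z y \<le> K * d z * dist x y)"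
    if x: "x \<in> \<Omega>" and y: "y \<in> \<Omega>" and xy: "x \<noteq> y" "dist x y < \<delta>" for x y
  proof -
    define D where "D = dist x y"
    have D: "0 < D" using xy by (simp add: D_def)
    \<comment> \<open>If one end is deeper than ten times the distance, the segment itself works;
      otherwise both depths are below \<open>r\<close>, as the carrots need.\<close>
    have seg: "\<exists>\<gamma>. path \<gamma> \<and> path_image \<gamma> \<subseteq> \<Omega> \<and> pathstart \<gamma> = x \<and> pathfinish \<gamma> = y \<and> len_le \<gamma> (K * dist x y) \<and>
      (\<forall>z\<in>path_image \<gamma>. dist z x * dist z y \<le> K * d z * dist x y)" if c: "10 * D \<le> d x \<or> 10 * D \<le> d y"
    proof (intro exI[of _ "linepath x y"] conjI ballI)
      have near: "dist z x \<le> D" "dist z y \<le> D" if "z \<in> closed_segment x y" for z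
        using dist_in_closed_segment[OF that] by (auto simp: D_def dist_commute)
      have dz: "D \<le> d z" if "z \<in> closed_segment x y" for z
        using near[OF that] c d_le[of x z] d_le[of y z] D by (auto simp: dist_commute)
      have "z \<in> \<Omega>" if z: "z \<in> closed_segment x y" for z
        using near[OF z] c D ball_sub[OF x, of z] ball_sub[OF y, of z] by (auto simp: dist_commute)
      then show "path_image (linepath x y) \<subseteq> \<Omega>" by auto
      show "len_le (linepath x y) (K * dist x y)"
        using len_le_mono[OF len_le_linepath] K mult_right_mono[of 1 K "dist x y"] by simp
      fix z assume "z \<in> path_image (linepath x y)"
      then have z: "z \<in> closed_segment x y" by simp
      have "dist z x * dist z y \<le> D * D" using near[OF z] D by (intro mult_mono) auto
      also have "\<dots> \<le> d z * D" using dz[OF z] D by (intro mult_right_mono) auto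
      also have "\<dots> \<le> K * d z * D" using K dz[OF z] D by (intro mult_right_mono) auto
      finally show "dist z x * dist z y \<le> K * d z * dist x y" by (simp add: D_def)
    qed auto
    show ?thesis
    proof (cases "10 * D \<le> d x \<or> 10 * D \<le> d y")
      case False
      define r where "r = 10 * D"
      have r: "0 < r" "r \<le> lam / 2" "M * r \<le> lam / 2" "r \<le> d x0"
      proof -
        have "r \<le> 10 * \<delta>" using xy by (simp add: r_def D_def)
        moreover have "M * r \<le> M * (10 * \<delta>)" using \<open>r \<le> 10 * \<delta>\<close> B2 by (intro mult_left_mono) auto
        ultimately show "r \<le> lam / 2" "M * r \<le> lam / 2" "r \<le> d x0" using \<delta>' by auto
      qed (use D in \<open>simp add: r_def\<close>)
      have ne: "deep r \<noteq> {}" using x0 r by (auto simp: deep_def)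
      obtain g1 where g1: "path g1" "pathstart g1 = x" "pathfinish g1 \<in> deep r" "d (pathfinish g1) \<le> 2 * r" "len_le g1 (B * r)"
        "\<And>w. w \<in> path_image g1 \<Longrightarrow> w \<in> \<Omega> \<and> dist w x \<le> B * d w"
        using carrot[OF x, of r] False r ne by (auto simp: r_def)
      obtain g2 where g2: "path g2" "pathstart g2 = y" "pathfinish g2 \<in> deep r" "d (pathfinish g2) \<le> 2 * r" "len_le g2 (B * r)"
        "\<And>w. w \<in> path_image g2 \<Longrightarrow> w \<in> \<Omega> \<and> dist w y \<le> B * d w"
        using carrot[OF y, of r] False r ne by (auto simp: r_def)
      let ?p = "pathfinish g1" and ?q = "pathfinish g2"
      have g1x: "dist w x \<le> B * r" if "w \<in> path_image g1" for w
        using len_le_dist_start(1)[OF g1(5) that] g1 by (simp add: dist_commute)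
      have g2y: "dist w y \<le> B * r" if "w \<in> path_image g2" for w
        using len_le_dist_start(1)[OF g2(5) that] g2 by (simp add: dist_commute)
      have px: "dist ?p x \<le> B * r" and qy: "dist ?q y \<le> B * r"
        using g1x g2y pathfinish_in_path_image by auto
      have "dist ?p ?q \<le> dist ?p x + D + dist ?q y"
        using dist_triangle[of ?p ?q x] dist_triangle[of x ?q y] by (simp add: D_def dist_commute)
      then have "dist ?p ?q \<le> (2 * B + 1) * r" using px qy r(1) D by (simp add: r_def algebra_simps)
      then obtain g where g: "path g" "pathstart g = ?p" "pathfinish g = ?q" "len_le g (B2 * r)"
        "\<And>w. w \<in> path_image g \<Longrightarrow> w \<in> \<Omega> \<and> r \<le> B2 * d w"
        using mid[of ?p r ?q] g1 g2 r by auto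
      let ?\<gamma> = "g1 +++ (g +++ reversepath g2)"
      have pth: "path ?\<gamma>" "pathstart ?\<gamma> = x" "pathfinish ?\<gamma> = y" using g1 g2 g by auto
      have im: "path_image ?\<gamma> \<subseteq> path_image g1 \<union> path_image g \<union> path_image g2"
        using path_image_join_subset[of g1 "g +++ reversepath g2"] path_image_join_subset[of g "reversepath g2"] by auto
      have "len_le ?\<gamma> (B * r + (B2 * r + B * r))"
        using g g1 g2 by (intro len_le_join len_le_reverse) auto
      moreover have "B * r + (B2 * r + B * r) \<le> K * D"
      proof -
        have "B * r + (B2 * r + B * r) = 10 * (2 * B + B2) * D" by (simp add: r_def algebra_simps)
        also have "\<dots> \<le> K * D" using D B B2 by (intro mult_right_mono) (auto simp: K_def)
        finally show ?thesis .
      qed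
      ultimately have len: "len_le ?\<gamma> (K * dist x y)" unfolding D_def by (rule len_le_mono)
      have carrot_bound: "dist w a * dist w b \<le> K * d w * D" 
        if w: "dist w a \<le> B * d w" "dist w a \<le> B * r" "dist a b = D" for w a b
      proof -
        have "dist w b \<le> (10 * B + 1) * D"
          using w(2,3) dist_triangle[of w b a] by (simp add: r_def algebra_simps)
        then have "dist w a * dist w b \<le> (B * d w) * ((10 * B + 1) * D)"
          using w B by (intro mult_mono) (auto simp: infdist_nonneg)
        also have "\<dots> = (B * (10 * B + 1)) * (d w * D)" by simp
        also have "\<dots> \<le> K * (d w * D)"
          using B B2 D by (intro mult_right_mono) (auto simp: K_def infdist_nonneg)
        finally show ?thesis by (simp add: mult.assoc)
      qed
      have "w \<in> \<Omega> \<and> dist w x * dist w y \<le> K * d w * D" if w: "w \<in> path_image ?\<gamma>" for w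
      proof -
        consider "w \<in> path_image g1" | "w \<in> path_image g2" | "w \<in> path_image g" using subsetD[OF im w] by blast
        then show ?thesis
        proof cases
          case 1
          then show ?thesis using g1(6) g1x carrot_bound[of w x y] by (simp add: D_def)
        next
          case 2
          then show ?thesis using g2(6) g2y carrot_bound[of w y x] by (simp add: D_def dist_commute mult.commute[of "dist w x"])
        next
          case 3
          have "dist w x \<le> (B + B2) * r"
            using len_le_dist_start(1)[OF g(4) 3] g(2) px dist_triangle[of w x ?p] by (simp add: dist_commute algebra_simps)
          moreover have "dist w y \<le> (B + B2) * r"
            using len_le_dist_start(2)[OF g(4) 3] g(3) qy dist_triangle[of w y ?q] by (simp add: dist_commute algebra_simps)
          ultimately have "dist w x * dist w y \<le> ((B + B2) * r) * ((B + B2) * r)"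
            using B B2 r by (intro mult_mono) auto
          also have "\<dots> = ((B + B2) * (B + B2) * 10 * D) * r" by (simp add: r_def)
          also have "\<dots> \<le> ((B + B2) * (B + B2) * 10 * D) * (B2 * d w)"
            using g(5)[OF 3] B B2 D by (intro mult_left_mono) auto
          also have "\<dots> = (10 * (B + B2) * (B + B2) * B2) * (d w * D)" by simp
          also have "\<dots> \<le> K * (d w * D)"
            using B B2 D by (intro mult_right_mono) (auto simp: K_def infdist_nonneg)
          finally show ?thesis using g(5)[OF 3] by (simp add: mult.assoc)
        qed
      qed
      then show ?thesis using pth len by (intro exI[of _ ?\<gamma>]) (auto simp: D_def)
    qed (rule seg)
  qed
  note main = this
  have "eps_delta_domain (1 / K) \<delta> \<Omega>"
    unfolding eps_delta_domain_def
  proof (intro ballI impI)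
    fix x y assume x: "x \<in> \<Omega>" "y \<in> \<Omega>" and xy: "x \<noteq> y \<and> dist x y < \<delta>"
    obtain \<gamma> where g: "path \<gamma>" "path_image \<gamma> \<subseteq> \<Omega>" "pathstart \<gamma> = x" "pathfinish \<gamma> = y" "len_le \<gamma> (K * dist x y)"
      "\<And>z. z\<in>path_image \<gamma> \<Longrightarrow> dist z x * dist z y \<le> K * d z * dist x y" using main[OF x] xy by blast
    have "arclength \<gamma> \<le> ennreal (dist x y / (1 / K))" using arclength_le[OF g(5)] by (simp add: mult.commute)
    moreover from this have "arclength \<gamma> < \<infinity>" by (simp add: le_less_trans)
    moreover have "ereal (1 / K * (dist z x * dist z y / dist x y)) \<le> dist_boundary \<Omega> z" if "z \<in> path_image \<gamma>" for z
      using g(6)[OF that] K xy by (simp add: dist_boundary_eq field_simps)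
    ultimately show "\<exists>\<gamma>. path \<gamma> \<and> path_image \<gamma> \<subseteq> \<Omega> \<and> pathstart \<gamma> = x \<and> pathfinish \<gamma> = y \<and> arclength \<gamma> < \<infinity> \<and>
       arclength \<gamma> \<le> ennreal (dist x y / (1 / K)) \<and> (\<forall>z\<in>path_image \<gamma>. ereal (1 / K * (dist z x * dist z y / dist x y)) \<le> dist_boundary \<Omega> z)"
      using g by blast
  qed
  then show ?thesis using \<delta> K by (intro exI[of _ "1 / K"] conjI exI[of _ \<delta>]) auto
qed

end

section \<open>Porous sets and subdivision of cubes\<close>

definition grid_ix :: "nat \<Rightarrow> ('n::finite \<Rightarrow> nat) set" where
  "grid_ix M = (\<Pi>\<^sub>E i\<in>UNIV. {..<M})"

definition grid_pt :: "real^'n \<Rightarrow> real \<Rightarrow> nat \<Rightarrow> ('n \<Rightarrow> nat) \<Rightarrow> real^'n" where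
  "grid_pt a l M m = a + (\<chi> i. real (m i) * (l / real M))"

lemma finite_grid_ix: "finite (grid_ix M)"
  by (simp add: grid_ix_def finite_PiE)

lemma card_grid_ix: "card (grid_ix M :: ('n::finite \<Rightarrow> nat) set) = M ^ CARD('n)"
  by (simp add: grid_ix_def card_PiE)

lemma grid_subcube:
  assumes "m \<in> grid_ix M" "0 \<le> l"
  shows "cube (grid_pt a l M m) (l / real M) \<subseteq> cube a l"
proof
  fix x assume x: "x \<in> cube (grid_pt a l M m) (l / real M)"
  have m: "m i + 1 \<le> M" for i using assms(1) by (auto simp: grid_ix_def PiE_iff Suc_le_eq)
  show "x \<in> cube a l" unfolding mem_cube
  proof
    fix i
    have M: "0 < real M" using m[of i] by simp
    have "real (m i) * (l / real M) + l / real M = (real (m i) + 1) * (l / real M)" by (simp add: algebra_simps)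
    also have "\<dots> \<le> real M * (l / real M)" using m[of i] assms(2) by (intro mult_right_mono) auto
    also have "\<dots> = l" using M by simp
    finally have "real (m i) * (l / real M) + l / real M \<le> l" .
    moreover have "0 \<le> real (m i) * (l / real M)" using assms(2) by simp
    moreover have "a $ i + real (m i) * (l / real M) \<le> x $ i \<and> x $ i \<le> a $ i + real (m i) * (l / real M) + l / real M"
      using x unfolding mem_cube grid_pt_def by simp
    ultimately show "a $ i \<le> x $ i \<and> x $ i \<le> a $ i + l" by linarith
  qed
qed

lemma grid_cover:
  assumes M: "0 < M" and l: "0 < l" and x: "x \<in> cube a l"
  shows "\<exists>m\<in>grid_ix M. x \<in> cube (grid_pt a l M m) (l / real M)"
proof -
  define h where "h = l / real M"
  have h: "0 < h" "real M * h = l" using M l by (auto simp: h_def)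
  define m where "m = (\<lambda>i. min (M - 1) (nat \<lfloor>(x $ i - a $ i) / h\<rfloor>))"
  have "m \<in> grid_ix M" using M by (auto simp: grid_ix_def m_def PiE_iff)
  moreover have "x \<in> cube (grid_pt a l M m) (l / real M)"
    unfolding mem_cube grid_pt_def h_def[symmetric]
  proof
    fix i
    define y where "y = (x $ i - a $ i) / h"
    have xi: "0 \<le> x $ i - a $ i" "x $ i - a $ i \<le> l" using x by (auto simp: mem_cube diff_le_eq add.commute)
    have y: "0 \<le> y" "y \<le> real M" "x $ i = a $ i + y * h"
      using xi h by (auto simp: y_def field_simps)
    have "real (m i) \<le> y" "y \<le> real (m i) + 1"
    proof -
      have fl: "real (nat \<lfloor>y\<rfloor>) = of_int \<lfloor>y\<rfloor>" using y by simp
      have "real (m i) \<le> real (nat \<lfloor>y\<rfloor>)" by (simp add: m_def y_def)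
      then show "real (m i) \<le> y" using fl by linarith
      show "y \<le> real (m i) + 1"
      proof (cases "nat \<lfloor>y\<rfloor> \<le> M - 1")
        case True
        then have "m i = nat \<lfloor>y\<rfloor>" by (simp add: m_def y_def)
        then show ?thesis using fl by linarith
      next
        case False
        then have "m i = M - 1" by (simp add: m_def y_def)
        then show ?thesis using y M by (simp add: of_nat_diff)
      qed
    qed
    then have "real (m i) * h \<le> y * h" "y * h \<le> (real (m i) + 1) * h" using h by (auto intro!: mult_right_mono)
    then show "(a + (\<chi> i. real (m i) * h)) $ i \<le> x $ i \<and> x $ i \<le> (a + (\<chi> i. real (m i) * h)) $ i + h"
      using y by (simp add: algebra_simps)
  qed
  ultimately show ?thesis by blast
qed

text \<open>Only an inequality, because closed subcubes share their faces; covering is all that the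
  estimates use.\<close>

lemma nn_integral_grid_le:
  fixes h :: "real^'n \<Rightarrow> ennreal"
  assumes [measurable]: "h \<in> borel_measurable lebesgue" and M: "0 < M" and l: "0 < l"
  shows "(\<integral>\<^sup>+x. h x * indicator (cube a l) x \<partial>lebesgue) 
     \<le> (\<Sum>m\<in>grid_ix M. \<integral>\<^sup>+x. h x * indicator (cube (grid_pt a l M m) (l / real M)) x \<partial>lebesgue)"
proof -
  have "(\<integral>\<^sup>+x. h x * indicator (cube a l) x \<partial>lebesgue) 
     \<le> (\<integral>\<^sup>+x. (\<Sum>m\<in>grid_ix M. h x * indicator (cube (grid_pt a l M m) (l / real M)) x) \<partial>lebesgue)"
  proof (rule nn_integral_mono)
    fix x
    show "h x * indicator (cube a l) x \<le> (\<Sum>m\<in>grid_ix M. h x * indicator (cube (grid_pt a l M m) (l / real M)) x)"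
    proof (cases "x \<in> cube a l")
      case True
      then obtain m where m: "m \<in> grid_ix M" "x \<in> cube (grid_pt a l M m) (l / real M)"
        using grid_cover[OF M l] by blast
      have "h x * indicator (cube a l) x = h x * indicator (cube (grid_pt a l M m) (l / real M)) x"
        using m True by simp
      also have "\<dots> \<le> (\<Sum>m\<in>grid_ix M. h x * indicator (cube (grid_pt a l M m) (l / real M)) x)"
        using m finite_grid_ix by (intro member_le_sum) auto
      finally show ?thesis .
    qed simp
  qed
  also have "\<dots> = (\<Sum>m\<in>grid_ix M. \<integral>\<^sup>+x. h x * indicator (cube (grid_pt a l M m) (l / real M)) x \<partial>lebesgue)"
    by (intro nn_integral_sum) measurable
  finally show ?thesis .
qed

text \<open>Distance in units of the side, so the notion is invariant under scaling. Together with
  an upper bound on \<open>infdist a S\<close> it describes a cube of Whitney type.\<close>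

definition far :: "(real^'n) set \<Rightarrow> real^'n \<Rightarrow> real \<Rightarrow> bool" where
  "far S a l \<longleftrightarrow> (\<forall>x\<in>cube a l. l \<le> infdist x S)"

lemma not_far_dist:
  fixes a :: "real^'n"
  assumes "\<not> far S a l" "x \<in> cube a l"
  shows "infdist x S < (real CARD('n) + 1) * l"
proof -
  obtain y where y: "y \<in> cube a l" "infdist y S < l" using assms by (auto simp: far_def)
  have "infdist x S \<le> infdist y S + dist x y" by (rule infdist_triangle)
  also have "\<dots> < (real CARD('n) + 1) * l"
    using y dist_cube_le[OF assms(2) y(1)] by (simp add: algebra_simps)
  finally show ?thesis .
qed

lemma corner_in_cube: "0 \<le> l \<Longrightarrow> a \<in> cube a l"
  by (simp add: mem_cube)

text \<open>If a cube is not far, one of its \<open>M ^ CARD('n)\<close> subcubes misses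
  \<open>S\<close>; if it is far, it misses \<open>S\<close> altogether. Each generation of
  subdivision thus keeps at most the fraction \<open>\<theta>\<close> of the volume.\<close>

lemma porous_null:
  fixes S :: "(real^'n) set"
  assumes S: "closed S" and M: "0 < M"
    and por: "\<And>a l. 0 < l \<Longrightarrow> l \<le> s0 \<Longrightarrow> \<not> far S a l \<Longrightarrow> \<exists>m\<in>grid_ix M. far S (grid_pt a l M m) (l / real M)"
    and l: "0 < l" "l \<le> s0"
  shows "emeasure lebesgue (S \<inter> cube a l) = 0"
proof -
  define Mn where "Mn = real (M ^ CARD('n))"
  have Mn: "1 \<le> Mn" using M by (simp add: Mn_def)
  define \<theta> where "\<theta> = 1 - 1 / Mn"
  have \<theta>: "0 \<le> \<theta>" "\<theta> < 1" using Mn by (auto simp: \<theta>_def)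
  have [measurable]: "S \<in> sets lebesgue" using S by auto
  have farS: "S \<inter> cube a l = {}" if "far S a l" "0 < l" for a l
    using that by (force simp: far_def)
  have bound: "emeasure lebesgue (S \<inter> cube a l) \<le> ennreal (\<theta> ^ k * l ^ CARD('n))" if "0 < l" "l \<le> s0" for k a l
    using that
  proof (induction k arbitrary: a l)
    case 0
    have "emeasure lebesgue (S \<inter> cube a l) \<le> emeasure lebesgue (cube a l)" by (intro emeasure_mono) auto
    then show ?case using 0 emeasure_cube[of l a] by simp
  next
    case (Suc k)
    show ?case
    proof (cases "far S a l")
      case True
      then show ?thesis using farS Suc.prems by simp
    next
      case False
      let ?h = "l / real M"
      let ?c = "\<lambda>m. cube (grid_pt a l M m) ?h"
      have h: "0 < ?h" "?h \<le> s0"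
      proof -
        have "l / real M \<le> l / 1" using M Suc.prems by (intro divide_left_mono) auto
        then show "?h \<le> s0" using Suc.prems by simp
      qed (use M Suc.prems in auto)
      obtain m0 where m0: "m0 \<in> grid_ix M" "far S (grid_pt a l M m0) ?h" using por[OF Suc.prems False] by blast
      have "emeasure lebesgue (S \<inter> cube a l) = (\<integral>\<^sup>+x. indicator S x * indicator (cube a l) x \<partial>lebesgue)"
        by (simp add: indicator_inter_arith[symmetric])
      also have "\<dots> \<le> (\<Sum>m\<in>grid_ix M. \<integral>\<^sup>+x. indicator S x * indicator (?c m) x \<partial>lebesgue)"
        using M Suc.prems by (intro nn_integral_grid_le) auto
      also have "\<dots> = (\<Sum>m\<in>grid_ix M. emeasure lebesgue (S \<inter> ?c m))"
        by (simp add: indicator_inter_arith[symmetric])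
      also have "\<dots> = (\<Sum>m\<in>grid_ix M - {m0}. emeasure lebesgue (S \<inter> ?c m))"
        using m0 farS[OF m0(2) h(1)] finite_grid_ix by (subst sum.remove[of _ m0]) auto
      also have "\<dots> \<le> (\<Sum>m\<in>grid_ix M - {m0}. ennreal (\<theta> ^ k * ?h ^ CARD('n)))"
        using h by (intro sum_mono Suc.IH)
      also have "\<dots> = ennreal ((Mn - 1) * (\<theta> ^ k * ?h ^ CARD('n)))"
      proof -
        have "real (card (grid_ix M - {m0})) = Mn - 1"
          using m0(1) M by (simp add: card_grid_ix Mn_def of_nat_diff Suc_le_eq)
        then have "(\<Sum>m\<in>grid_ix M - {m0}. \<theta> ^ k * ?h ^ CARD('n)) = (Mn - 1) * (\<theta> ^ k * ?h ^ CARD('n))"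
          by simp
        moreover have "(\<Sum>m\<in>grid_ix M - {m0}. ennreal (\<theta> ^ k * ?h ^ CARD('n))) = ennreal (\<Sum>m\<in>grid_ix M - {m0}. \<theta> ^ k * ?h ^ CARD('n))"
          using \<theta> h by (intro sum_ennreal) auto
        ultimately show ?thesis by (simp only:)
      qed
      also have "(Mn - 1) * (\<theta> ^ k * ?h ^ CARD('n)) = \<theta> ^ Suc k * l ^ CARD('n)"
        using M by (simp add: \<theta>_def Mn_def power_divide field_simps)
      finally show ?thesis .
    qed
  qed
  have "(\<lambda>k. ennreal (\<theta> ^ k * l ^ CARD('n))) \<longlonglongrightarrow> ennreal (0 * l ^ CARD('n))"
    using \<theta> by (intro tendsto_intros LIMSEQ_realpow_zero) auto
  then have "emeasure lebesgue (S \<inter> cube a l) \<le> ennreal (0 * l ^ CARD('n))"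
    using bound[OF l] by (intro LIMSEQ_le_const) auto
  then show ?thesis by simp
qed

text \<open>The sets \<open>U k l\<close> in the proof cut off a neighbourhood of \<open>S\<close>, so that the induction on \<open>k\<close> starts from
a trivial bound although nothing is known beforehand about the deviation of \<open>g\<close> near \<open>S\<close>.\<close>

lemma porous_recursion:
  fixes S :: "(real^'n) set" and g :: "real^'n \<Rightarrow> real" and cf :: "real^'n \<Rightarrow> real \<Rightarrow> real"
  assumes S: "closed S" "S \<noteq> {}" and M2: "1 < M"
    and g[measurable]: "g \<in> borel_measurable lebesgue" and K: "0 \<le> K"
    and por: "\<And>a l. 0 < l \<Longrightarrow> l \<le> s0 \<Longrightarrow> \<not> far S a l \<Longrightarrow> \<exists>m\<in>grid_ix M. far S (grid_pt a l M m) (l / real M)"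
    and cmp: "\<And>a l m. 0 < l \<Longrightarrow> l \<le> s0 \<Longrightarrow> \<not> far S a l \<Longrightarrow> m \<in> grid_ix M \<Longrightarrow> \<bar>cf (grid_pt a l M m) (l / real M) - cf a l\<bar> \<le> K"
    and farb: "\<And>a l. 0 < l \<Longrightarrow> l \<le> s0 \<Longrightarrow> far S a l \<Longrightarrow> infdist a S \<le> (real CARD('n) + 1) * real M * l \<Longrightarrow>
        deviation g (cf a l) a l \<le> ennreal (K * l ^ CARD('n))"
    and l: "0 < l" "l \<le> s0" and near: "infdist a S \<le> (real CARD('n) + 1) * real M * l"
  shows "deviation g (cf a l) a l \<le> ennreal (2 * real (M ^ CARD('n)) * K * l ^ CARD('n))"
proof -
  have M: "0 < M" using M2 by simp
  define Mn where "Mn = real (M ^ CARD('n))"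
  have Mn: "1 \<le> Mn" using M by (simp add: Mn_def)
  \<comment> \<open>One subdivision requires
    \<open>(K + K) + (Mn - 1) * (K' + K) \<le> Mn * K'\<close>, that is
    \<open>K + Mn * K \<le> K'\<close>. There is room for this because the far subcube contributes
    \<open>K\<close> instead of \<open>K'\<close>.\<close>
  define K' where "K' = 2 * Mn * K"
  have K': "K \<le> K'" "K + Mn * K \<le> K'" "0 \<le> K'" 
    using mult_right_mono[OF Mn K] K unfolding K'_def by linarith+
  define n where "n = real CARD('n) + 1"
  have n: "0 < n" by (simp add: n_def)
  define U where "U k l = {x::real^'n. n * l / real M ^ k \<le> infdist x S}" for k l
  have Ucl: "closed (U k l)" for k l unfolding U_def by (intro closed_Collect_le continuous_intros)
  then have U[measurable]: "U k l \<in> sets lebesgue" for k l by auto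
  let ?I = "\<lambda>k a l b r c. (\<integral>\<^sup>+x. ennreal \<bar>g x - c\<bar> * indicator (U k l) x * indicator (cube b r) x \<partial>lebesgue)"
  have bound: "?I k a l a l (cf a l) \<le> ennreal (K' * l ^ CARD('n))" 
    if "0 < l" "l \<le> s0" "infdist a S \<le> n * real M * l" for k a l
    using that
  proof (induction k arbitrary: a l)
    have far_case: "?I k a l a l (cf a l) \<le> ennreal (K * l ^ CARD('n))" if "far S a l" "0 < l" "l \<le> s0" "infdist a S \<le> n * real M * l" for k a l
    proof -
      have "?I k a l a l (cf a l) \<le> deviation g (cf a l) a l"
        by (intro nn_integral_mono) (auto simp: indicator_def)
      also have "\<dots> \<le> ennreal (K * l ^ CARD('n))" using farb that by (auto simp: n_def)
      finally show ?thesis .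
    qed
    have far': "?I k a l a l (cf a l) \<le> ennreal (K' * l ^ CARD('n))" if "far S a l" "0 < l" "l \<le> s0" "infdist a S \<le> n * real M * l" for k a l
    proof -
      have "K * l ^ CARD('n) \<le> K' * l ^ CARD('n)" using that K' by (intro mult_right_mono) auto
      then show ?thesis using far_case[OF that] ennreal_leI order_trans by blast
    qed
    {
      case 0
      show ?case
      proof (cases "far S a l")
        case False
        then have "indicator (U 0 l) x * indicator (cube a l) x = (0::ennreal)" for x
          using not_far_dist[OF False, of x] by (auto simp: U_def n_def indicator_def)
        then have "?I 0 a l a l (cf a l) = 0" by (simp only: mult.assoc mult_zero_right) simp
        then show ?thesis by simp
      qed (use far' 0 in blast)
    next
      case (Suc k)
      show ?case
      proof (cases "far S a l")
        case False
        let ?h = "l / real M"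
        let ?p = "grid_pt a l M"
        have h: "0 < ?h" "?h \<le> s0"
        proof -
          have "l / real M \<le> l / 1" using M Suc.prems by (intro divide_left_mono) auto
          then show "?h \<le> s0" using Suc.prems by simp
        qed (use M Suc.prems in auto)
        \<comment> \<open>A cube that is not far lies within
          \<open>n * l = n * real M * (l / real M)\<close> of \<open>S\<close>. Hence the factor
          \<open>real M\<close> in the nearness hypothesis, which the subcubes inherit.\<close>
        have nearm: "infdist (?p m) S \<le> n * real M * ?h" if "m \<in> grid_ix M" for m
        proof -
          have "?p m \<in> cube a l" using grid_subcube[OF that, of l a] corner_in_cube[of ?h "?p m"] h Suc.prems by auto
          from not_far_dist[OF False this] show ?thesis using M by (simp add: n_def)
        qed
        \<comment> \<open>Self-similarity: the cut-off set of the cube is that of its subcubes one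
          generation earlier, so the induction hypothesis fits.\<close>
        have UU: "U (Suc k) l = U k ?h" by (simp add: U_def)
        obtain m0 where m0: "m0 \<in> grid_ix M" "far S (?p m0) ?h" using por[OF Suc.prems(1,2) False] by blast
        have sub: "?I k (?p m) ?h (?p m) ?h (cf a l) \<le> ennreal ((C + K) * ?h ^ CARD('n))"
          if m: "m \<in> grid_ix M" and le: "?I k (?p m) ?h (?p m) ?h (cf (?p m) ?h) \<le> ennreal (C * ?h ^ CARD('n))" and C: "0 \<le> C" for m C
        proof -
          have "?I k (?p m) ?h (?p m) ?h (cf a l) \<le> (\<integral>\<^sup>+x. ennreal \<bar>g x - cf (?p m) ?h\<bar> * indicator (U k ?h) x * indicator (cube (?p m) ?h) x 
              + ennreal K * indicator (cube (?p m) ?h) x \<partial>lebesgue)"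
          proof (rule nn_integral_mono)
            fix x
            have "ennreal \<bar>g x - cf a l\<bar> \<le> ennreal (\<bar>g x - cf (?p m) ?h\<bar> + K)"
              using cmp[OF Suc.prems(1,2) False m] by (intro ennreal_leI) linarith
            then show "ennreal \<bar>g x - cf a l\<bar> * indicator (U k ?h) x * indicator (cube (?p m) ?h) x \<le> ennreal \<bar>g x - cf (?p m) ?h\<bar> * indicator (U k ?h) x * indicator (cube (?p m) ?h) x 
              + ennreal K * indicator (cube (?p m) ?h) x"
              using K by (auto simp: indicator_def ennreal_plus)
          qed
          also have "\<dots> = ?I k (?p m) ?h (?p m) ?h (cf (?p m) ?h) + ennreal K * emeasure lebesgue (cube (?p m) ?h)"
            by (subst nn_integral_add) (auto simp: nn_integral_cmult)
          also have "\<dots> \<le> ennreal (C * ?h ^ CARD('n)) + ennreal K * ennreal (?h ^ CARD('n))"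
            using le h emeasure_cube[of ?h "?p m"] by (intro add_mono) auto
          also have "\<dots> = ennreal ((C + K) * ?h ^ CARD('n))"
            using C K h by (simp add: ennreal_mult[symmetric] ennreal_plus[symmetric] algebra_simps del: ennreal_plus)
          finally show ?thesis .
        qed
        have "?I (Suc k) a l a l (cf a l) \<le> (\<Sum>m\<in>grid_ix M. ?I k (?p m) ?h (?p m) ?h (cf a l))"
          unfolding UU using M Suc.prems by (intro nn_integral_grid_le) auto
        also have "\<dots> = ?I k (?p m0) ?h (?p m0) ?h (cf a l) + (\<Sum>m\<in>grid_ix M - {m0}. ?I k (?p m) ?h (?p m) ?h (cf a l))"
          using m0 finite_grid_ix by (intro sum.remove) auto
        also have "\<dots> \<le> ennreal ((K + K) * ?h ^ CARD('n)) + (\<Sum>m\<in>grid_ix M - {m0}. ennreal ((K' + K) * ?h ^ CARD('n)))"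
          using m0 h nearm K K' Suc.IH[OF h] by (intro add_mono sum_mono sub far_case) auto
        also have "\<dots> = ennreal ((K + K) * ?h ^ CARD('n) + (Mn - 1) * ((K' + K) * ?h ^ CARD('n)))"
        proof -
          have "real (card (grid_ix M - {m0})) = Mn - 1"
            using m0(1) M by (simp add: card_grid_ix Mn_def of_nat_diff Suc_le_eq)
          then have "(\<Sum>m\<in>grid_ix M - {m0}. (K' + K) * ?h ^ CARD('n)) = (Mn - 1) * ((K' + K) * ?h ^ CARD('n))"
            by simp
          then show ?thesis using K K' h Mn by (subst sum_ennreal) (auto simp: ennreal_plus)
        qed
        also have "\<dots> \<le> ennreal (K' * l ^ CARD('n))"
        proof (rule ennreal_leI)
          have "(K + K) * ?h ^ CARD('n) + (Mn - 1) * ((K' + K) * ?h ^ CARD('n)) = ((K + Mn * K) + (Mn - 1) * K') * ?h ^ CARD('n)"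
            by (simp add: algebra_simps)
          also have "\<dots> \<le> (Mn * K') * ?h ^ CARD('n)"
            using K' h by (intro mult_right_mono) (auto simp: algebra_simps)
          also have "\<dots> = K' * l ^ CARD('n)" using M by (simp add: Mn_def power_divide)
          finally show "(K + K) * ?h ^ CARD('n) + (Mn - 1) * ((K' + K) * ?h ^ CARD('n)) \<le> K' * l ^ CARD('n)" .
        qed
        finally show ?thesis .
      qed (use far' Suc.prems in blast)
    }
  qed
  let ?h = "\<lambda>k x. ennreal \<bar>g x - cf a l\<bar> * indicator (U k l) x * indicator (cube a l) x"
  \<comment> \<open>Almost every point of the cube is off \<open>S\<close>, hence in some
    \<open>U k l\<close>, and monotone convergence removes the cut-off.\<close>
  have null: "AE x in lebesgue. x \<notin> S \<inter> cube a l"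
    using porous_null[OF S(1) M por l, of a] S(1)
    by (intro AE_not_in) (auto simp: null_sets_def)
  have "deviation g (cf a l) a l = (\<integral>\<^sup>+x. (SUP k. ?h k x) \<partial>lebesgue)"
  proof (rule nn_integral_cong_AE)
    show "AE x in lebesgue. ennreal \<bar>g x - cf a l\<bar> * indicator (cube a l) x = (SUP k. ?h k x)"
      using null
    proof eventually_elim
      case (elim x)
      show ?case
      proof (cases "x \<in> cube a l")
        case True
        then have "0 < infdist x S"
          using elim S infdist_nonneg[of x S] in_closed_iff_infdist_zero[OF S, of x] by fastforce
        have "\<exists>k. x \<in> U k l"
        proof -
          have "1 < real M" using M2 by simp
          then obtain k where "n * l / infdist x S < real M ^ k" using real_arch_pow by blast
          then have "n * l / real M ^ k \<le> infdist x S"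
            using \<open>0 < infdist x S\<close> M by (simp add: field_simps)
          then show ?thesis by (auto simp: U_def)
        qed
        then obtain k where "x \<in> U k l" by blast
        then have "ennreal \<bar>g x - cf a l\<bar> * indicator (cube a l) x = ?h k x" by simp
        also have "\<dots> \<le> (SUP k. ?h k x)" by (intro SUP_upper) auto
        finally show ?thesis by (intro antisym SUP_least) (auto simp: indicator_def)
      qed simp
    qed
  qed
  also have "\<dots> = (SUP k. \<integral>\<^sup>+x. ?h k x \<partial>lebesgue)"
  proof (rule nn_integral_monotone_convergence_SUP)
    have "U k l \<subseteq> U (Suc k) l" for k
    proof -
      have "n * l / real M ^ Suc k \<le> n * l / real M ^ k"
        using M n l by (intro divide_left_mono) auto
      then show ?thesis by (auto simp: U_def)
    qed
    then show "incseq ?h" 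
      by (intro incseq_SucI le_funI mult_right_mono mult_left_mono) (auto simp: indicator_def)
  qed measurable
  also have "\<dots> \<le> ennreal (K' * l ^ CARD('n))"
    using near by (intro SUP_least bound[OF l]) (simp add: n_def)
  finally show ?thesis by (simp add: K'_def Mn_def)
qed

section \<open>Consequences of local uniformity\<close>

locale local_uniform = proper_domain \<Omega> \<kappa> for \<Omega> :: "(real^'n) set" and \<kappa> +
  fixes \<epsilon> \<delta> :: real
  assumes \<epsilon>: "0 < \<epsilon>" and \<delta>: "0 < \<delta>" and ed: "eps_delta_domain \<epsilon> \<delta> \<Omega>"
begin

lemma curve:
  assumes "x \<in> \<Omega>" "y \<in> \<Omega>" "x \<noteq> y" "dist x y < \<delta>"
  obtains \<gamma> where "path \<gamma>" "path_image \<gamma> \<subseteq> \<Omega>" "pathstart \<gamma> = x" "pathfinish \<gamma> = y"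
    "arclength \<gamma> \<le> ennreal (dist x y / \<epsilon>)"
    "\<And>z. z \<in> path_image \<gamma> \<Longrightarrow> \<epsilon> * (dist z x * dist z y / dist x y) \<le> d z"
proof -
  obtain \<gamma> where "path \<gamma>" "path_image \<gamma> \<subseteq> \<Omega>" "pathstart \<gamma> = x" "pathfinish \<gamma> = y"
    "arclength \<gamma> \<le> ennreal (dist x y / \<epsilon>)"
    and z: "\<forall>z \<in> path_image \<gamma>. dist_boundary \<Omega> z \<ge> ereal (\<epsilon> * (dist z x * dist z y / dist x y))"
    using ed assms unfolding eps_delta_domain_def by blast
  moreover have "\<epsilon> * (dist z x * dist z y / dist x y) \<le> d z" if "z \<in> path_image \<gamma>" for z
    using z that by (simp add: dist_boundary_def proper)
  ultimately show thesis using that by blast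
qed

text \<open>One of two fixed points of \<open>\<Omega>\<close> is at least half their distance away
  from any \<open>y\<close>. The uniform \<open>\<rho>0\<close> ensures that \<open>\<Omega>\<close>
  leaves small balls even when it is bounded.\<close>

lemma far_point: "\<exists>\<rho>0>0. \<forall>y. \<exists>u\<in>\<Omega>. \<rho>0 \<le> dist u y"
proof -
  obtain u where u: "u \<in> \<Omega>" using neO by blast
  obtain v where v: "v \<in> \<Omega>" "v \<noteq> u"
  proof -
    have "infinite \<Omega>" using openO neO finite_imp_not_open by blast
    then have "infinite (\<Omega> - {u})" by simp
    then show thesis using that by (metis Diff_iff finite.emptyI insertI1 ex_in_conv)
  qed
  have "\<exists>w\<in>\<Omega>. dist u v / 2 \<le> dist w y" for y
    using u v dist_triangle2[of u v y] by (metis add_le_cancel_left field_sum_of_halves linorder_not_le add_strict_mono)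
  then show ?thesis using v by (intro exI[of _ "dist u v / 2"]) auto
qed

text \<open>The point \<open>x\<close> may lie on either side of the frontier. Take \<open>y\<close>
  in \<open>\<Omega>\<close> close to the frontier point nearest to \<open>x\<close>, and
  \<open>w\<close> in \<open>\<Omega>\<close> at distance \<open>t / 2\<close> from
  \<open>y\<close>. The curve between them has a point at distance \<open>t / 4\<close> from
  \<open>y\<close> and at least \<open>t / 4\<close> from \<open>w\<close>, and there the depth
  condition gives \<open>\<epsilon> / 8 * t\<close>.\<close>

lemma corkscrew: "\<exists>c>0. \<exists>r1>0. \<forall>x t. 0 < t \<and> t \<le> r1 \<and> d x \<le> t \<longrightarrow> (\<exists>z\<in>\<Omega>. dist z x \<le> 2 * t \<and> c * t \<le> d z)"
proof -
  obtain \<rho>0 where \<rho>0: "0 < \<rho>0" "\<And>y. \<exists>u\<in>\<Omega>. \<rho>0 \<le> dist u y" using far_point by blast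
  have "\<exists>z\<in>\<Omega>. dist z x \<le> 2 * t \<and> \<epsilon> / 8 * t \<le> d z"
    if t: "0 < t" "t \<le> min \<rho>0 \<delta>" and x: "d x \<le> t" for x t
  proof -
    obtain s where s: "s \<in> frontier \<Omega>" "d x = dist x s"
      using infdist_attains_inf[OF frontier_closed frontier_ne] by metis
    then have "s \<in> closure \<Omega>" by (simp add: frontier_def)
    then obtain y where y: "y \<in> \<Omega>" "dist y s < t / 4" using t by (meson closure_approachable divide_pos_pos zero_less_numeral)
    obtain u where u: "u \<in> \<Omega>" "\<rho>0 \<le> dist u y" using \<rho>0 by blast
    have "\<Omega> \<inter> frontier (ball y (t / 2)) \<noteq> {}"
      using connO t y u by (intro connected_Int_frontier) (auto simp: dist_commute intro!: exI[of _ y] exI[of _ u])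
    moreover have "frontier (ball y (t / 2)) = sphere y (t / 2)" using t by (intro frontier_ball) simp
    ultimately obtain w where w: "w \<in> \<Omega>" "dist y w = t / 2" by (metis Int_iff ex_in_conv mem_sphere)
    have yw: "y \<noteq> w" "dist y w < \<delta>" using w t by auto
    obtain \<gamma> where g: "path \<gamma>" "path_image \<gamma> \<subseteq> \<Omega>" "pathstart \<gamma> = y" "pathfinish \<gamma> = w"
      "\<And>z. z \<in> path_image \<gamma> \<Longrightarrow> \<epsilon> * (dist z y * dist z w / dist y w) \<le> d z"
      using curve[OF y(1) w(1) yw] by metis
    have "path_image \<gamma> \<inter> frontier (ball y (t / 4)) \<noteq> {}"
    proof (rule connected_Int_frontier)
      show "connected (path_image \<gamma>)" using g by (simp add: connected_path_image)
      show "path_image \<gamma> \<inter> ball y (t / 4) \<noteq> {}" using g(3) pathstart_in_path_image[of \<gamma>] t by force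
      show "path_image \<gamma> - ball y (t / 4) \<noteq> {}" using g(4) pathfinish_in_path_image[of \<gamma>] t w(2) by force
    qed
    moreover have "frontier (ball y (t / 4)) = sphere y (t / 4)" using t by (intro frontier_ball) simp
    ultimately obtain z where z: "z \<in> path_image \<gamma>" "dist y z = t / 4" by (metis Int_iff ex_in_conv mem_sphere)
    have "t / 4 \<le> dist z w" using w(2) z(2) dist_triangle[of y w z] by linarith
    then have "(t / 4) * (t / 4) \<le> dist z y * dist z w"
      using z(2) t by (intro mult_mono) (auto simp: dist_commute)
    then have "(t / 4) * (t / 4) / (t / 2) \<le> dist z y * dist z w / dist y w"
      unfolding w(2) using t by (intro divide_right_mono) auto
    then have "\<epsilon> * ((t / 4) * (t / 4) / (t / 2)) \<le> \<epsilon> * (dist z y * dist z w / dist y w)"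
      using \<epsilon> by (intro mult_left_mono) auto
    also have "\<dots> \<le> d z" by (rule g(5)[OF z(1)])
    finally have "\<epsilon> / 8 * t \<le> d z" using t by simp
    moreover have "dist z x \<le> 2 * t"
      using z(2) y(2) s(2) x dist_triangle[of z x y] dist_triangle[of y x s] t by (simp add: dist_commute)
    ultimately show ?thesis using z g by blast
  qed
  then show ?thesis using \<epsilon> \<delta> \<rho>0(1) by (intro exI[of _ "\<epsilon> / 8"] conjI exI[of _ "min \<rho>0 \<delta>"]) auto
qed

text \<open>Within \<open>c * t / 2\<close> of an end the curve keeps half of the depth
  \<open>c * t\<close>; elsewhere the depth condition gives
  \<open>\<epsilon> * c\<^sup>2 / (4 * H) * t\<close>. These are the two entries of
  \<open>\<sigma>\<close>. A length of at most \<open>H * t / \<epsilon>\<close> cut into pieces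
  proportional to \<open>\<kappa> * \<sigma> * t\<close> gives a number of steps in which
  \<open>t\<close> cancels.\<close>

lemma single_scale_chain:
  assumes c: "0 < c" and H: "0 < H"
  shows "\<exists>m. \<forall>p\<in>\<Omega>. \<forall>q\<in>\<Omega>. \<forall>t>0. c * t \<le> d p \<longrightarrow> c * t \<le> d q \<longrightarrow> dist p q \<le> H * t \<longrightarrow> H * t < \<delta> \<longrightarrow> qpow m p q"
proof -
  define \<sigma> where "\<sigma> = min (c / 2) (\<epsilon> * c\<^sup>2 / (4 * H))"
  have \<sigma>: "0 < \<sigma>" using c H \<epsilon> by (simp add: \<sigma>_def)
  define m0 where "m0 = nat \<lfloor>4 * H / (\<epsilon> * \<kappa> * \<sigma>) + 1\<rfloor>"
  have "qpow m0 p q"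
    if pq: "p \<in> \<Omega>" "q \<in> \<Omega>" and t: "0 < t" and dp: "c * t \<le> d p" and dq: "c * t \<le> d q" and close: "dist p q \<le> H * t" "H * t < \<delta>" for p q t
  proof (cases "p = q")
    case True
    then show ?thesis using qpow_refl pq by simp
  next
    case False
    have "dist p q < \<delta>" using close by linarith
    then obtain \<gamma> where g: "path \<gamma>" "path_image \<gamma> \<subseteq> \<Omega>" "pathstart \<gamma> = p" "pathfinish \<gamma> = q"
      "arclength \<gamma> \<le> ennreal (dist p q / \<epsilon>)"
      "\<And>z. z \<in> path_image \<gamma> \<Longrightarrow> \<epsilon> * (dist z p * dist z q / dist p q) \<le> d z"
      using curve[OF pq False] by metis
    define \<rho> where "\<rho> = \<sigma> * t"
    have \<rho>: "0 < \<rho>" using \<sigma> t by (simp add: \<rho>_def)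
    have \<rho>c: "\<rho> \<le> c * t / 2" 
    proof -
      have "\<sigma> * t \<le> c / 2 * t" using t by (intro mult_right_mono) (auto simp: \<sigma>_def)
      then show ?thesis by (simp add: \<rho>_def)
    qed
    have deep: "\<rho> \<le> d z" if z: "z \<in> path_image \<gamma>" for z
    proof -
      consider "dist z p \<le> c * t / 2" | "dist z q \<le> c * t / 2" | "c * t / 2 \<le> dist z p" "c * t / 2 \<le> dist z q" by linarith
      then show ?thesis
      proof cases
        case 1
        then show ?thesis using d_le[of p z] dp \<rho>c by (simp add: dist_commute)
      next
        case 2
        then show ?thesis using d_le[of q z] dq \<rho>c by (simp add: dist_commute)
      next
        case 3
        have "\<rho> \<le> \<epsilon> * c\<^sup>2 / (4 * H) * t" unfolding \<rho>_def using t by (intro mult_right_mono) (auto simp: \<sigma>_def)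
        also have "\<dots> = \<epsilon> * ((c * t / 2) * (c * t / 2) / (H * t))" using t H by (simp add: power2_eq_square)
        also have "\<dots> \<le> \<epsilon> * (dist z p * dist z q / dist p q)"
          using 3 \<epsilon> t H c close False by (intro mult_left_mono frac_le mult_mono) auto
        finally show ?thesis using g(6)[OF z] by linarith
      qed
    qed
    have "uniformly_continuous_on {0..1} \<gamma>"
      using g(1) by (intro compact_uniformly_continuous) (auto simp: path_def)
    moreover have "0 < \<kappa> * \<rho> / 4" using \<rho> \<kappa>_bounds by simp
    ultimately obtain e where e: "0 < e" "\<And>s t. s \<in> {0..1} \<Longrightarrow> t \<in> {0..1} \<Longrightarrow> dist t s < e \<Longrightarrow> dist (\<gamma> t) (\<gamma> s) < \<kappa> * \<rho> / 4"
      unfolding uniformly_continuous_on_def by metis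
    obtain N :: nat where N: "1 / e < real N" using reals_Archimedean2 by blast
    have N0: "0 < real N" using N e by (smt (verit) divide_pos_pos)
    have Ne: "1 / real N < e" using N N0 e by (simp add: field_simps)
    define s where "s i = min 1 (real i / real N)" for i :: nat
    have s01: "s i \<in> {0..1}" for i by (simp add: s_def)
    have smono: "mono s" unfolding s_def by (intro monoI min.mono) (auto simp: divide_right_mono)
    have sstep: "dist (s i) (s (Suc i)) < e" if "i < N" for i
    proof -
      have "real (Suc i) / real N \<le> 1" "real i / real N \<le> 1" using that N0 by auto
      then have "dist (s i) (s (Suc i)) = 1 / real N"
        unfolding s_def dist_real_def using N0 by (simp add: min_def field_simps)
      then show ?thesis using Ne by simp
    qed
    let ?w = "\<lambda>i. \<gamma> (s i)"
    have im: "?w i \<in> path_image \<gamma>" for i using s01 by (auto simp: path_image_def)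
    have "\<exists>m. real m * (\<kappa> * \<rho> / 4) \<le> (\<Sum>i<N. dist (?w i) (?w (Suc i))) + \<kappa> * \<rho> / 4 \<and> qpow m (?w 0) (?w N)"
    proof (rule qpow_of_fine_sequence)
      show "?w i \<in> \<Omega> \<and> \<rho> \<le> d (?w i)" if "i \<le> N" for i using im deep g(2) by blast
      show "dist (?w i) (?w (Suc i)) \<le> \<kappa> * \<rho> / 4" if "i < N" for i
        using e(2)[OF s01 s01 sstep[OF that]] by simp
    qed (rule \<rho>)
    then obtain m where m: "real m * (\<kappa> * \<rho> / 4) \<le> (\<Sum>i<N. dist (?w i) (?w (Suc i))) + \<kappa> * \<rho> / 4" "qpow m (?w 0) (?w N)" by blast
    have ends: "?w 0 = p" "?w N = q" using g N0 by (auto simp: s_def pathstart_def pathfinish_def)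
    have "ennreal (\<Sum>i<N. dist (?w i) (?w (Suc i))) = (\<Sum>i<N. ennreal (dist (?w i) (?w (Suc i))))" by simp
    also have "\<dots> \<le> arclength \<gamma>"
      unfolding arclength_def using smono s01 by (intro SUP_upper2[of "(N, s)"]) auto
    also have "\<dots> \<le> ennreal (dist p q / \<epsilon>)" by (rule g)
    finally have "(\<Sum>i<N. dist (?w i) (?w (Suc i))) \<le> dist p q / \<epsilon>" using \<epsilon> by (subst (asm) ennreal_le_iff) auto
    also have "\<dots> \<le> H * t / \<epsilon>" using close \<epsilon> by (intro divide_right_mono) auto
    finally have "real m * (\<kappa> * \<rho> / 4) \<le> H * t / \<epsilon> + \<kappa> * \<rho> / 4" using m(1) by linarith
    then have "real m \<le> (H * t / \<epsilon> + \<kappa> * \<rho> / 4) / (\<kappa> * \<rho> / 4)"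
      using \<rho> \<kappa>_bounds by (subst pos_le_divide_eq) auto
    also have "\<dots> = 4 * H / (\<epsilon> * \<kappa> * \<sigma>) + 1" using \<rho> \<kappa>_bounds \<sigma> t \<epsilon> by (simp add: \<rho>_def field_simps)
    finally have "m \<le> m0" unfolding m0_def by (rule le_nat_floor)
    then show ?thesis using m(2) ends pq by (auto intro: qpow_mono)
  qed
  then show ?thesis by blast
qed

end

section \<open>Averages at the scale of the depth\<close>

context proper_domain
begin

definition avg :: "(real^'n \<Rightarrow> real) \<Rightarrow> real^'n \<Rightarrow> real" where
  "avg f z = mean_on (ccube z (\<kappa> * d z)) f"

abbreviation bmo_le :: "real \<Rightarrow> real \<Rightarrow> (real^'n \<Rightarrow> real) \<Rightarrow> bool" where
  "bmo_le lam N f \<equiv> f \<in> bmo_on lam \<Omega> \<and> bmo_norm lam \<Omega> f \<le> ennreal N \<and> 0 \<le> N"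

lemma ccube_in:
  assumes z: "z \<in> \<Omega>" and h: "h \<le> 4 * \<kappa> * d z"
  shows "ccube z h \<subseteq> \<Omega>"
proof
  fix x assume "x \<in> ccube z h"
  from dist_ccube_le[OF this] have "dist x z \<le> real CARD('n) * h" .
  also have "\<dots> \<le> real CARD('n) * (4 * \<kappa> * d z)" using h by (intro mult_left_mono) auto
  also have "\<dots> = 4 * (real CARD('n) * \<kappa>) * d z" by simp
  also have "\<dots> < d z" using d_pos[OF z] unfolding \<kappa>_bounds(3) by simp
  finally show "x \<in> \<Omega>" using ball_sub[OF z] by (simp add: dist_commute)
qed

lemma avg_cong:
  assumes "z \<in> \<Omega>" "\<And>x. x \<in> \<Omega> \<Longrightarrow> f x = g x" shows "avg f z = avg g z"
proof -
  have "\<kappa> * d z \<le> 4 * \<kappa> * d z" using \<kappa>_bounds d_pos[OF assms(1)] by simp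
  then show ?thesis unfolding avg_def using ccube_in[OF assms(1)] assms(2) by (intro mean_on_cong) blast
qed

lemma bmo_on_cube: "f \<in> bmo_on lam \<Omega> \<Longrightarrow> 0 < l \<Longrightarrow> cube a l \<subseteq> \<Omega> \<Longrightarrow> set_integrable lebesgue (cube a l) f"
  by (simp add: bmo_on_def)

lemma bmo_on_ccube: "f \<in> bmo_on lam \<Omega> \<Longrightarrow> 0 < h \<Longrightarrow> ccube p h \<subseteq> \<Omega> \<Longrightarrow> set_integrable lebesgue (ccube p h) f"
  unfolding ccube_def by (intro bmo_on_cube) auto

lemma mean_ccube_compare:
  assumes f: "f \<in> bmo_on lam \<Omega>" and N: "bmo_norm lam \<Omega> f \<le> ennreal N" "0 \<le> N"
    and sub: "ccube p h \<subseteq> ccube q k" "ccube q k \<subseteq> \<Omega>" and h: "0 < h" "0 < k" "k \<le> K * h"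
  shows "\<bar>mean_on (ccube p h) f - mean_on (ccube q k) f\<bar> \<le> K ^ CARD('n) * (2 * N)"
proof -
  have "\<bar>mean_on (ccube p h) f - mean_on (ccube q k) f\<bar> \<le> K ^ CARD('n) * mean_on (ccube q k) (\<lambda>x. \<bar>f x - mean_on (ccube q k) f\<bar>)"
    using sub h bmo_on_ccube[OF f h(2) sub(2)] unfolding ccube_def by (intro mean_on_dev_le_subcube) auto
  also have "\<dots> \<le> K ^ CARD('n) * (2 * N)"
  proof (intro mult_left_mono)
    show "mean_on (ccube q k) (\<lambda>x. \<bar>f x - mean_on (ccube q k) f\<bar>) \<le> 2 * N"
      using sub h bmo_on_ccube[OF f h(2) sub(2)] unfolding ccube_def by (intro bmo_norm_osc[OF N]) auto
    have "0 \<le> K" using h by (smt (verit) mult_nonneg_nonpos2 mult_nonneg_nonneg mult_le_0_iff)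
    then show "0 \<le> K ^ CARD('n)" by simp
  qed
  finally show ?thesis .
qed

text \<open>Both averaging cubes lie in the cube of half side \<open>4 * \<kappa> * d z\<close>
  around \<open>z\<close>. As the two depths differ by a factor of at most 2, the ratio of sides is
  at most 8.\<close>

lemma avg_step:
  assumes f: "f \<in> bmo_on lam \<Omega>" and N: "bmo_norm lam \<Omega> f \<le> ennreal N" "0 \<le> N" and zw: "qstep z w"
  shows "\<bar>avg f z - avg f w\<bar> \<le> 8 ^ CARD('n) * (4 * N)"
proof -
  have O: "z \<in> \<Omega>" "w \<in> \<Omega>" using zw by (auto simp: qstep_def)
  let ?h = "4 * \<kappa> * d z"
  have dd: "0 < d z" "0 < d w" "d w \<le> 2 * d z" "d z \<le> 2 * d w"
    using d_pos O qstep_d[OF zw] qstep_d[OF qstep_sym[OF zw]] by auto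
  have m: "\<kappa> * d w \<le> \<kappa> * (2 * d z)" "\<kappa> * d z \<le> \<kappa> * (2 * d w)"
    using dd \<kappa>_bounds by (auto intro!: mult_left_mono)
  have c: "dist w z + \<kappa> * d w \<le> ?h" "?h \<le> 8 * (\<kappa> * d w)"
  proof -
    have "0 < \<kappa> * d z" using dd \<kappa>_bounds by simp
    moreover have "dist w z < \<kappa> * d z" using qstep_dist(1)[OF zw] by (simp add: dist_commute)
    ultimately show "dist w z + \<kappa> * d w \<le> ?h" using m(1) by linarith
    show "?h \<le> 8 * (\<kappa> * d w)" using m(2) by linarith
  qed
  have "\<bar>avg f z - mean_on (ccube z ?h) f\<bar> \<le> 8 ^ CARD('n) * (2 * N)"
    unfolding avg_def using dd \<kappa>_bounds
    by (intro mean_ccube_compare[OF f N] ccube_in[OF O(1)] ccube_subset) auto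
  moreover have "\<bar>avg f w - mean_on (ccube z ?h) f\<bar> \<le> 8 ^ CARD('n) * (2 * N)"
    unfolding avg_def using dd \<kappa>_bounds c
    by (intro mean_ccube_compare[OF f N] ccube_in[OF O(1)] ccube_subset) auto
  ultimately show ?thesis by linarith
qed

lemma avg_qpow:
  assumes f: "f \<in> bmo_on lam \<Omega>" and N: "bmo_norm lam \<Omega> f \<le> ennreal N" "0 \<le> N"
  shows "qpow m z w \<Longrightarrow> \<bar>avg f z - avg f w\<bar> \<le> real m * (8 ^ CARD('n) * (4 * N))"
proof (induction m arbitrary: w)
  case (Suc m)
  then obtain v where v: "qpow m z v" "qstep v w" by auto
  show ?case using Suc.IH[OF v(1)] avg_step[OF f N v(2)] by (simp add: algebra_simps)
qed simp

text \<open>Here the second supremum enters: a deep point has an averaging cube of side at least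
  \<open>lam\<close>.\<close>

lemma avg_large:
  assumes f: "f \<in> bmo_on lam \<Omega>" and N: "bmo_norm lam \<Omega> f \<le> ennreal N" "0 \<le> N"
    and z: "z \<in> \<Omega>" and big: "lam \<le> 2 * \<kappa> * d z"
  shows "\<bar>avg f z\<bar> \<le> N"
proof -
  let ?h = "\<kappa> * d z"
  have h: "0 < ?h" "?h \<le> 4 * \<kappa> * d z" using d_pos[OF z] \<kappa>_bounds by auto
  have sub: "ccube z ?h \<subseteq> \<Omega>" using ccube_in[OF z h(2)] .
  have "\<bar>avg f z - 0\<bar> \<le> 1 ^ CARD('n) * mean_on (ccube z ?h) (\<lambda>x. \<bar>f x - 0\<bar>)"
    unfolding avg_def ccube_def using h bmo_on_ccube[OF f h(1) sub, unfolded ccube_def]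
    by (intro mean_on_dev_le_subcube) auto
  also have "\<dots> \<le> N"
    using bmo_norm_ge(2)[OF N, of "2 * ?h" "z - (\<chi> i. ?h)"] h sub big unfolding ccube_def by (simp add: mult_ac)
  finally show ?thesis by simp
qed

end

section \<open>The reflection operator\<close>

lemma nn_integral_mean_on:
  fixes a :: "real^'n"
  assumes g: "set_integrable lebesgue (cube a l) g" and l: "0 < l"
  shows "deviation g k a l = ennreal (l ^ CARD('n) * mean_on (cube a l) (\<lambda>x. \<bar>g x - k\<bar>))"
proof -
  have "deviation g k a l = (\<integral>\<^sup>+x. ennreal (indicator (cube a l) x *\<^sub>R \<bar>g x - k\<bar>) \<partial>lebesgue)"
    by (intro nn_integral_cong) (auto simp: indicator_def)
  also have "\<dots> = ennreal (LINT x:cube a l|lebesgue. \<bar>g x - k\<bar>)"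
    unfolding set_lebesgue_integral_def
    using set_integrable_dev(2)[OF g, of k] unfolding set_integrable_def by (intro nn_integral_eq_integral) auto
  also have "\<dots> = ennreal (l ^ CARD('n) * mean_on (cube a l) (\<lambda>x. \<bar>g x - k\<bar>))"
    using l by (simp add: mean_on_def content_cube)
  finally show ?thesis .
qed

lemma mean_on_le_nn:
  fixes a :: "real^'n"
  assumes g: "set_integrable lebesgue (cube a l) g" and l: "0 < l" and C: "0 \<le> C"
    and le: "deviation g k a l \<le> ennreal (C * l ^ CARD('n))"
  shows "mean_on (cube a l) (\<lambda>x. \<bar>g x - k\<bar>) \<le> C"
proof -
  have "l ^ CARD('n) * mean_on (cube a l) (\<lambda>x. \<bar>g x - k\<bar>) \<le> C * l ^ CARD('n)"
    using le l C unfolding nn_integral_mean_on[OF g l] by (subst (asm) ennreal_le_iff) auto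
  then show ?thesis using l by (simp add: mult.commute)
qed

lemma nn_integral_cube_le:
  fixes a :: "real^'n"
  assumes "\<And>x. x \<in> cube a l \<Longrightarrow> \<bar>g x - k\<bar> \<le> C" and l: "0 < l" and C: "0 \<le> C"
  shows "deviation g k a l \<le> ennreal (C * l ^ CARD('n))"
proof -
  have "deviation g k a l \<le> (\<integral>\<^sup>+x. ennreal C * indicator (cube a l) x \<partial>lebesgue)"
    using assms(1) by (intro nn_integral_mono) (auto simp: indicator_def intro!: ennreal_leI)
  also have "\<dots> = ennreal C * emeasure lebesgue (cube a l)" by (intro nn_integral_cmult_indicator) auto
  also have "\<dots> = ennreal (C * l ^ CARD('n))" using l C emeasure_cube[of l a] by (simp add: ennreal_mult)
  finally show ?thesis .
qed

text \<open>The extension is at first only known to be measurable. Deviations are therefore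
  \<open>ennreal\<close> integrals, and integrability is read off from their bounds.\<close>

lemma set_integrable_of_nn:
  fixes a :: "real^'n"
  assumes g: "g \<in> borel_measurable lebesgue"
    and le: "deviation g 0 a l \<le> ennreal C"
  shows "set_integrable lebesgue (cube a l) g"
  unfolding set_integrable_def
proof (rule integrableI_bounded)
  show "(\<lambda>x. indicator (cube a l) x *\<^sub>R g x) \<in> borel_measurable lebesgue" using g by measurable
  have "(\<integral>\<^sup>+x. ennreal (norm (indicator (cube a l) x *\<^sub>R g x)) \<partial>lebesgue) = deviation g 0 a l"
    by (intro nn_integral_cong) (auto simp: indicator_def)
  then show "(\<integral>\<^sup>+x. ennreal (norm (indicator (cube a l) x *\<^sub>R g x)) \<partial>lebesgue) < \<infinity>" using le by (simp add: le_less_trans)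
qed

text \<open>The numbers \<open>c\<close> and \<open>r1\<close> come from the corkscrew property, the
  second condition on \<open>M\<close> yields porosity, and \<open>H\<close> is the nearness factor
  of \<open>porous_recursion\<close>. The bound on \<open>9 * H * r1\<close> keeps all compared
  points within reach of the curves. Countability of \<open>q\<close> makes the reflected point a
  measurable choice.\<close>

locale reflection = local_uniform \<Omega> \<kappa> \<epsilon> \<delta> for \<Omega> :: "(real^'n) set" and \<kappa> \<epsilon> \<delta> +
  fixes c r1 H :: real and M :: nat and q :: "nat \<Rightarrow> real^'n"
  assumes c: "0 < c" "c \<le> 1" and r1: "0 < r1" "9 * H * r1 < \<delta>" "r1 \<le> 1"
    and M: "1 < M" "8 * (real CARD('n) + 1) \<le> c * real M"
    and H: "H = (real CARD('n) + 1) * real M"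
    and cork: "\<And>x t. 0 < t \<Longrightarrow> t \<le> r1 \<Longrightarrow> d x \<le> t \<Longrightarrow> \<exists>z\<in>\<Omega>. dist z x \<le> 2 * t \<and> c * t \<le> d z"
    and qO: "\<And>i. q i \<in> \<Omega>" and qdense: "\<And>U. open U \<Longrightarrow> U \<inter> \<Omega> \<noteq> {} \<Longrightarrow> \<exists>i. q i \<in> U"
begin

text \<open>The corkscrew constants 2 and \<open>c\<close> are relaxed to 3 and \<open>c / 2\<close>
  with strict inequalities. The admissible points then form an open set, which the dense sequence
  meets, and \<open>good i\<close> is an open condition on \<open>x\<close>, which makes the least
  index Borel measurable.\<close>

definition good :: "nat \<Rightarrow> real^'n \<Rightarrow> bool" where
  "good i x \<longleftrightarrow> dist (q i) x < 3 * d x \<and> c / 2 * d x < d (q i)"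

definition idx :: "real^'n \<Rightarrow> nat" where "idx x = (LEAST i. good i x)"

definition rpt :: "real^'n \<Rightarrow> real^'n" where "rpt x = q (idx x)"

text \<open>The value 0 stands both for the cut-off and for the frontier, a null set. The reflected
  point is chosen without reference to \<open>f\<close>, hence linearity.\<close>

definition T :: "(real^'n \<Rightarrow> real) \<Rightarrow> real^'n \<Rightarrow> real" where
  "T f x = (if x \<in> \<Omega> then f x else if 0 < d x \<and> d x < r1 then avg f (rpt x) else 0)"

lemma rpt_in: "rpt x \<in> \<Omega>" by (simp add: rpt_def qO)

lemma rpt:
  assumes "0 < d x" "d x \<le> r1"
  shows "dist (rpt x) x < 3 * d x" "c / 2 * d x < d (rpt x)"
proof -
  obtain z where z: "z \<in> \<Omega>" "dist z x \<le> 2 * d x" "c * d x \<le> d z" using cork[of "d x" x] assms by auto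
  have "open {y. dist y x < 3 * d x}" "open {y. c / 2 * d x < d y}"
    by (intro open_Collect_less continuous_intros)+
  then have "open ({y. dist y x < 3 * d x} \<inter> {y. c / 2 * d x < d y})" by (rule open_Int)
  moreover have "c / 2 * d x < d z" using z assms c mult_pos_pos[of c "d x"] by linarith
  then have "z \<in> {y. dist y x < 3 * d x} \<inter> {y. c / 2 * d x < d y} \<inter> \<Omega>" using z assms by auto
  ultimately have "\<exists>i. good i x" using qdense unfolding good_def by blast
  then have "good (idx x) x" unfolding idx_def by (rule LeastI_ex)
  then show "dist (rpt x) x < 3 * d x" "c / 2 * d x < d (rpt x)" by (auto simp: good_def rpt_def)
qed

text \<open>Inside \<open>\<Omega>\<close>, integrability of \<open>f\<close> is given on cubes
  only, so \<open>\<Omega>\<close> is covered by countably many cubes around the points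
  \<open>q i\<close> and measurability is glued from these pieces and the complement.\<close>

lemma T_measurable:
  assumes f: "f \<in> bmo_on lam \<Omega>" shows "T f \<in> borel_measurable lebesgue"
proof -
  have "{x. good i x} = {x. dist (q i) x < 3 * d x} \<inter> {x. c / 2 * d x < d (q i)}" for i
    by (auto simp: good_def)
  moreover have "open {x. dist (q i) x < 3 * d x}" "open {x. c / 2 * d x < d (q i)}" for i
    by (intro open_Collect_less continuous_intros)+
  ultimately have "open {x. good i x}" for i by auto
  then have [measurable]: "Measurable.pred borel (good i)" for i by (simp add: pred_def)
  have "idx \<in> borel \<rightarrow>\<^sub>M count_space UNIV" unfolding idx_def by measurable
  then have "(\<lambda>x. avg f (rpt x)) \<in> borel_measurable borel" unfolding rpt_def by measurable
  moreover have "open {x. 0 < d x}" "open {x. d x < r1}" by (intro open_Collect_less continuous_intros)+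
  then have [measurable]: "Measurable.pred borel (\<lambda>x. 0 < d x \<and> d x < r1)" by (auto simp: pred_def Collect_conj_eq)
  ultimately have "(\<lambda>x. if 0 < d x \<and> d x < r1 then avg f (rpt x) else 0) \<in> borel_measurable borel"
    by measurable
  then have "(\<lambda>x. if 0 < d x \<and> d x < r1 then avg f (rpt x) else 0) \<in> borel_measurable lborel" by simp
  then have ext: "(\<lambda>x. if 0 < d x \<and> d x < r1 then avg f (rpt x) else 0) \<in> borel_measurable lebesgue"
    by (rule measurable_completion)
  define Q where "Q i = ccube (q i) (\<kappa> * d (q i))" for i
  have h: "0 < \<kappa> * d (q i)" "\<kappa> * d (q i) \<le> 4 * \<kappa> * d (q i)" for i using d_pos[OF qO] \<kappa>_bounds by auto
  have QO: "Q i \<subseteq> \<Omega>" for i unfolding Q_def using ccube_in[OF qO h(2)] .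
  have Qs: "Q i \<in> sets lebesgue" for i by (simp add: Q_def ccube_def)
  show ?thesis
  proof (rule measurable_piecewise_restrict[of "insert (- \<Omega>) (range Q)"])
    show "space lebesgue \<subseteq> \<Union> (insert (- \<Omega>) (range Q))"
    proof
      fix x show "x \<in> \<Union> (insert (- \<Omega>) (range Q))"
      proof (cases "x \<in> \<Omega>")
        case True
        have "open (ball x (\<kappa> / 2 * d x))" by simp
        moreover have "x \<in> ball x (\<kappa> / 2 * d x) \<inter> \<Omega>" using True d_pos[OF True] \<kappa>_bounds by simp
        ultimately obtain i where "q i \<in> ball x (\<kappa> / 2 * d x)" using qdense by blast
        then have "qstep x (q i)" using qstepI[OF True] by simp
        then have "x \<in> Q i" unfolding Q_def using qstep_dist(2) by (intro ccubeI) (simp add: less_imp_le)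
        then show ?thesis by blast
      qed auto
    qed
    fix A assume "A \<in> insert (- \<Omega>) (range Q)"
    then consider "A = - \<Omega>" | i where "A = Q i" by blast
    then show "T f \<in> borel_measurable (restrict_space lebesgue A)"
    proof cases
      case 1
      have "(\<lambda>x. if 0 < d x \<and> d x < r1 then avg f (rpt x) else 0) \<in> borel_measurable (restrict_space lebesgue A)"
        using ext by (rule measurable_restrict_space1)
      then show ?thesis by (rule measurable_cong[THEN iffD1, rotated]) (auto simp: 1 T_def space_restrict_space)
    next
      case 2
      have "set_integrable lebesgue A f"
        unfolding 2 Q_def using QO[unfolded Q_def] by (intro bmo_on_ccube[OF f h(1)])
      then have "f \<in> borel_measurable (restrict_space lebesgue A)"
        using Qs unfolding 2 set_integrable_def by (subst borel_measurable_restrict_space_iff) auto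
      then show ?thesis
        using QO by (elim measurable_cong[THEN iffD1, rotated]) (auto simp: 2 T_def space_restrict_space)
    qed
  next
    fix A assume "A \<in> insert (- \<Omega>) (range Q)"
    then show "A \<inter> space lebesgue \<in> sets lebesgue" using Qs openO by auto
  qed simp
qed

end

lemma center_in_cube: "0 \<le> l \<Longrightarrow> a + (\<chi> i. l / 2) \<in> cube a l"
  by (simp add: mem_cube)

context reflection
begin

lemma H_bounds: "real CARD('n) + 1 \<le> H" "2 * (real CARD('n) + 1) \<le> H" "4 \<le> H" "H / real M = real CARD('n) + 1"
proof -
  have n: "1 \<le> real CARD('n)" using zero_less_card_finite[where 'a='n] by linarith
  have "(real CARD('n) + 1) * 2 \<le> H" unfolding H using M n by (intro mult_left_mono) auto
  then show 2: "2 * (real CARD('n) + 1) \<le> H" by (simp add: mult.commute)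
  have "real CARD('n) + 1 \<le> 2 * (real CARD('n) + 1)" by simp
  then show "real CARD('n) + 1 \<le> H" using 2 by (rule order_trans)
  have "4 \<le> 2 * (real CARD('n) + 1)" using n by simp
  then show "4 \<le> H" using 2 by (rule order_trans)
  show "H / real M = real CARD('n) + 1" using M by (simp add: H)
qed

text \<open>For \<open>l \<le> s0\<close> one has \<open>2 * (H * l) < r1\<close>, so a cube of side
  \<open>l\<close> whose corner has depth at most \<open>H * l\<close> does not reach the
  cut-off.\<close>

definition s0 :: real where "s0 = r1 / (4 * H)"

lemma s0: "0 < s0" "4 * H * s0 = r1" "s0 \<le> r1 / 8"
proof -
  show "0 < s0" "4 * H * s0 = r1" using r1 H_bounds by (auto simp: s0_def)
  have "r1 / (4 * H) \<le> r1 / 8" using r1 H_bounds by (intro divide_left_mono) auto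
  then show "s0 \<le> r1 / 8" by (simp add: s0_def)
qed

lemma s0_mult: "l \<le> s0 \<Longrightarrow> H * l < r1 / 2"
  using s0(2) r1(1) mult_left_mono[of l s0 H] H_bounds(3) by linarith

text \<open>Either the center is deep enough itself, or a corkscrew point at scale
  \<open>l / 8\<close> lies within \<open>l / 4\<close> of it. The resulting point has depth at
  least \<open>c * (l / 8)\<close>, which by the choice of \<open>M\<close> exceeds the diameter of
  its subcube by at least \<open>l / real M\<close>.\<close>

lemma porosity:
  assumes l: "0 < l" "l \<le> s0"
  shows "\<exists>m\<in>grid_ix M. far (frontier \<Omega>) (grid_pt a l M m) (l / real M)"
proof -
  let ?x = "a + (\<chi> i. l / 2)"
  obtain z where z: "dist z ?x \<le> l / 4" "c * (l / 8) \<le> d z"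
  proof (cases "d ?x \<le> l / 8")
    case True
    then show thesis using cork[of "l / 8" ?x] l s0 that by auto
  next
    case False
    have "c * (l / 8) \<le> 1 * (l / 8)" using c l by (intro mult_right_mono) auto
    then have "c * (l / 8) \<le> d ?x" using False by linarith
    then show thesis using l by (intro that[of ?x]) auto
  qed
  have "z \<in> ccube ?x (l / 2)" using z l by (intro ccubeI) simp
  then have "z \<in> cube a l" by (simp add: cube_as_ccube)
  then obtain m where m: "m \<in> grid_ix M" "z \<in> cube (grid_pt a l M m) (l / real M)"
    using grid_cover[of M l z a] M l by auto
  have "l / real M \<le> d y" if y: "y \<in> cube (grid_pt a l M m) (l / real M)" for y
  proof -
    have "(real CARD('n) + 1) * (l / real M) \<le> (c * real M / 8) * (l / real M)"
      using M l by (intro mult_right_mono) auto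
    also have "\<dots> = c * (l / 8)" using M by simp
    finally have "(real CARD('n) + 1) * (l / real M) \<le> d z" using z by linarith
    then show ?thesis using d_le[of z y] dist_cube_le[OF m(2) y] by (simp add: algebra_simps)
  qed
  then show ?thesis using m(1) by (auto simp: far_def)
qed

text \<open>With n the dimension, depths in a far cube differ by a factor of at most n + 1, so a
  reflected point, of depth at least \<open>c / 2 * d x\<close>, still has depth
  \<open>c0 * d a\<close> for another point \<open>a\<close> of the cube.\<close>

definition c0 :: real where "c0 = c * real M / (2 * H)"

lemma c0: "c0 = c / (2 * (real CARD('n) + 1))" "0 < c0" "c0 \<le> c / 4" "c0 \<le> 1" "c0 * (real CARD('n) + 1) = c / 2"
proof -
  have n: "1 \<le> real CARD('n)" using zero_less_card_finite[where 'a='n] by linarith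
  show e: "c0 = c / (2 * (real CARD('n) + 1))" unfolding c0_def unfolding H using M by simp
  have "c / (2 * k) * k = c / 2" if "0 < k" for k :: real using that by simp
  from this[of "real CARD('n) + 1"] show "c0 * (real CARD('n) + 1) = c / 2" by (simp add: e)
  show "0 < c0" using c by (simp add: e)
  show "c0 \<le> c / 4" unfolding e using c n by (intro divide_left_mono) auto
  then show "c0 \<le> 1" using c by simp
qed

text \<open>The factor 9 is attained for cubes outside \<open>\<Omega>\<close> near the frontier,
  with \<open>t\<close> the side: reflection moves a point by at most \<open>6 * H * t\<close>, and
  the reference point is at most \<open>3 * H * t\<close> away from it. The constant is uniform in
  \<open>f\<close> and \<open>lam\<close>.\<close>

lemma avg_compare:
  "\<exists>K\<ge>0. \<forall>f lam N z w t. bmo_le lam N f \<and> z \<in> \<Omega> \<and> w \<in> \<Omega> \<and> 0 < t \<and> t \<le> r1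
    \<and> c0 * t \<le> d z \<and> c0 * t \<le> d w \<and> dist z w \<le> 9 * H * t \<longrightarrow> \<bar>avg f z - avg f w\<bar> \<le> K * N"
proof -
  have "0 < 9 * H" using H_bounds by simp
  then obtain m where m: "\<And>p q t. p \<in> \<Omega> \<Longrightarrow> q \<in> \<Omega> \<Longrightarrow> 0 < t \<Longrightarrow> c0 * t \<le> d p \<Longrightarrow> c0 * t \<le> d q \<Longrightarrow> dist p q \<le> 9 * H * t \<Longrightarrow> 9 * H * t < \<delta> \<Longrightarrow> qpow m p q"
    using single_scale_chain[OF c0(2), of "9 * H"] by blast
  show ?thesis
  proof (intro exI[of _ "real m * (8 ^ CARD('n) * 4)"] conjI allI impI)
    fix f lam N z w t
    assume a: "bmo_le lam N f \<and> z \<in> \<Omega> \<and> w \<in> \<Omega> \<and> 0 < t \<and> t \<le> r1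
      \<and> c0 * t \<le> d z \<and> c0 * t \<le> d w \<and> dist z w \<le> 9 * H * t"
    have "9 * H * t \<le> 9 * H * r1" using a H_bounds by (intro mult_left_mono) auto
    then have "qpow m z w" using a r1 by (intro m[of z w t]) auto
    then show "\<bar>avg f z - avg f w\<bar> \<le> real m * (8 ^ CARD('n) * 4) * N" 
      using avg_qpow[of f lam N m z w] a by (simp add: mult.assoc)
  qed simp
qed

text \<open>A reference point of depth comparable to \<open>H * l\<close>, available for cubes on
  either side of the frontier or across it. The average there is the constant \<open>cf\<close> fed
  to \<open>porous_recursion\<close>.\<close>

definition zc :: "real^'n \<Rightarrow> real \<Rightarrow> real^'n" where
  "zc a l = (SOME z. z \<in> \<Omega> \<and> dist z a \<le> 2 * (H * l) \<and> c * (H * l) \<le> d z)"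

lemma zc:
  assumes "0 < l" "l \<le> s0" "d a \<le> H * l"
  shows "zc a l \<in> \<Omega>" "dist (zc a l) a \<le> 2 * (H * l)" "c * (H * l) \<le> d (zc a l)"
proof -
  have "0 < H * l" using assms H_bounds by simp
  moreover have "H * l \<le> r1" using s0_mult[OF assms(2)] r1 by simp
  ultimately have "\<exists>z. z \<in> \<Omega> \<and> dist z a \<le> 2 * (H * l) \<and> c * (H * l) \<le> d z" using cork assms by blast
  from someI_ex[OF this] show "zc a l \<in> \<Omega>" "dist (zc a l) a \<le> 2 * (H * l)" "c * (H * l) \<le> d (zc a l)"
    by (auto simp: zc_def)
qed

lemma far_cube_dichotomy:
  assumes "far (frontier \<Omega>) a l" "0 < l"
  shows "cube a l \<subseteq> \<Omega> \<or> cube a l \<inter> \<Omega> = {}"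
proof -
  have "connected (cube a l)" by (simp add: cube_def convex_connected)
  moreover have "0 < d x" if "x \<in> cube a l" for x using assms that by (force simp: far_def)
  ultimately show ?thesis using connected_sub by blast
qed

lemma deviation_T_inside:
  assumes "cube a l \<subseteq> \<Omega>" shows "deviation (T f) k a l = deviation f k a l"
  using assms by (intro nn_integral_cong) (auto simp: indicator_def T_def)

lemma T_far_outside:
  assumes "x \<notin> \<Omega>" "0 < d x" and f: "f \<in> bmo_on lam \<Omega>" and N: "bmo_norm lam \<Omega> f \<le> ennreal N" "0 \<le> N"
    and lam: "lam \<le> \<kappa> * c * d x"
  shows "\<bar>T f x\<bar> \<le> N"
proof (cases "d x < r1")
  case True
  have "lam \<le> 2 * \<kappa> * d (rpt x)"
  proof -
    have "\<kappa> * (c / 2 * d x) \<le> \<kappa> * d (rpt x)" using rpt(2)[OF assms(2)] True \<kappa>_bounds by (intro mult_left_mono) auto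
    then show ?thesis using lam by simp
  qed
  then show ?thesis using avg_large[OF f N rpt_in] N assms by (simp add: T_def)
qed (use assms in \<open>simp add: T_def\<close>)

text \<open>Averages are compared at the scale \<open>d a\<close> rather than \<open>l\<close>,
  because a far cube may be tiny compared with its depth. If the cube reaches depth
  \<open>r1\<close>, the extension may jump to 0 inside it; but then all its points have depth at
  least \<open>s0\<close>, the extension is bounded by \<open>N\<close> there, and the constant 0
  works.\<close>

lemma far_outside_osc:
  "\<exists>K\<ge>0. \<forall>f lam N a l. bmo_le lam N f \<and> lam \<le> \<kappa> * c * s0 \<and> 0 < l \<and> l \<le> s0 \<and> 
      far (frontier \<Omega>) a l \<and> cube a l \<inter> \<Omega> = {} \<longrightarrow> (\<exists>k. \<forall>x\<in>cube a l. \<bar>T f x - k\<bar> \<le> K * N)"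
proof -
  let ?n = "real CARD('n)"
  obtain K where K: "0 \<le> K" and cmp: "\<And>f lam N z w t. f \<in> bmo_on lam \<Omega> \<Longrightarrow> bmo_norm lam \<Omega> f \<le> ennreal N \<Longrightarrow> 0 \<le> N \<Longrightarrow> z \<in> \<Omega> \<Longrightarrow> w \<in> \<Omega> \<Longrightarrow> 0 < t \<Longrightarrow> t \<le> r1
    \<Longrightarrow> c0 * t \<le> d z \<Longrightarrow> c0 * t \<le> d w \<Longrightarrow> dist z w \<le> 9 * H * t \<Longrightarrow> \<bar>avg f z - avg f w\<bar> \<le> K * N"
    using avg_compare by blast
  have "\<exists>k. \<forall>x\<in>cube a l. \<bar>T f x - k\<bar> \<le> (K + 1) * N"
    if f: "f \<in> bmo_on lam \<Omega>" and N: "bmo_norm lam \<Omega> f \<le> ennreal N" "0 \<le> N" and lam: "lam \<le> \<kappa> * c * s0" and l: "0 < l" "l \<le> s0"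
      and far: "far (frontier \<Omega>) a l" and ext: "cube a l \<inter> \<Omega> = {}" for f lam N a l
  proof (cases "\<forall>x\<in>cube a l. d x < r1")
    case True
    have a: "a \<in> cube a l" using l by (intro corner_in_cube) simp
    have da: "l \<le> d a" "d a < r1" using far a True by (auto simp: far_def)
    have "\<bar>T f x - T f a\<bar> \<le> K * N" if x: "x \<in> cube a l" for x
    proof -
      have dx: "l \<le> d x" "d x < r1" using far x True by (auto simp: far_def)
      have xa: "dist x a \<le> ?n * l" by (rule dist_cube_le[OF x a])
      have nl: "?n * l \<le> ?n * d a" "?n * l \<le> ?n * d x" using da dx by (auto intro!: mult_left_mono)
      have d1: "d x \<le> (?n + 1) * d a" unfolding distrib_right using d_le[of x a] xa nl by linarith
      have d2: "d a \<le> (?n + 1) * d x" unfolding distrib_right using d_le[of a x] xa[unfolded dist_commute[of x a]] nl by linarith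
      note ra = rpt[of a] and rx = rpt[of x]
      have "\<bar>avg f (rpt x) - avg f (rpt a)\<bar> \<le> K * N"
      proof (rule cmp[OF f N rpt_in rpt_in, of "d a"])
        have "c0 * d a \<le> c0 * ((?n + 1) * d x)" using d2 c0 by (intro mult_left_mono) auto
        also have "\<dots> = (c0 * (?n + 1)) * d x" by (simp only: mult.assoc)
        also have "\<dots> = c / 2 * d x" by (simp only: c0(5))
        finally show "c0 * d a \<le> d (rpt x)" using rx dx l by simp
        have "c0 * d a \<le> c / 2 * d a" using c0(3) c da l by (intro mult_right_mono) auto
        moreover have "c / 2 * d a < d (rpt a)" using ra(2) da l by simp
        ultimately show "c0 * d a \<le> d (rpt a)" by linarith
        have "dist (rpt x) (rpt a) \<le> 3 * d x + ?n * l + 3 * d a"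
          using rx(1) ra(1) dx da l xa dist_triangle[of "rpt x" "rpt a" x] dist_triangle[of x "rpt a" a] by (simp add: dist_commute)
        also have "\<dots> \<le> 3 * ((?n + 1) * d a) + ?n * d a + 3 * d a" using d1 nl by linarith
        also have "\<dots> \<le> 9 * ((?n + 1) * d a)" using da l by (simp add: algebra_simps)
        also have "\<dots> \<le> 9 * (H * d a)" using H_bounds da l by (intro mult_left_mono mult_right_mono) auto
        finally show "dist (rpt x) (rpt a) \<le> 9 * H * d a" by simp
      qed (use da l in auto)
      moreover have "x \<notin> \<Omega>" "a \<notin> \<Omega>" using ext x a by auto
      ultimately show ?thesis using dx da l by (simp add: T_def)
    qed
    moreover have "K * N \<le> (K + 1) * N" using N by (intro mult_right_mono) auto
    ultimately show ?thesis by (meson order_trans)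
  next
    case False
    then obtain y where y: "y \<in> cube a l" "r1 \<le> d y" by auto
    have "\<bar>T f x - 0\<bar> \<le> (K + 1) * N" if x: "x \<in> cube a l" for x
    proof -
      have "dist y x \<le> ?n * l" by (rule dist_cube_le[OF y(1) x])
      also have "\<dots> \<le> H * l" using H_bounds l by (intro mult_right_mono) auto
      also have "\<dots> < r1 / 2" by (rule s0_mult[OF l(2)])
      finally have "s0 \<le> d x" using d_le[of y x] y s0(3) r1 by linarith
      then have "\<kappa> * c * s0 \<le> \<kappa> * c * d x" using \<kappa>_bounds c by (intro mult_left_mono) auto
      then have "\<bar>T f x\<bar> \<le> N" using x ext lam far l by (intro T_far_outside[OF _ _ f N]) (auto simp: far_def)
      also have "\<dots> \<le> (K + 1) * N" using K N by (simp add: algebra_simps)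
      finally show ?thesis by simp
    qed
    then show ?thesis by blast
  qed
  then show ?thesis using K by (intro exI[of _ "K + 1"]) auto
qed

text \<open>The recursion does the work. What remains is that the reference averages of a cube and
  of its subcubes are close, and that on a far cube the extension is either \<open>f\<close> itself
  or an average at a point of comparable depth.\<close>

lemma near_cubes:
  "\<exists>C\<ge>0. \<forall>f lam N a l. bmo_le lam N f \<and> 0 < l \<and> l \<le> s0 \<and> d a \<le> H * l \<longrightarrow>
      deviation (T f) (avg f (zc a l)) a l \<le> ennreal (C * N * l ^ CARD('n))"
proof -
  let ?n = "real CARD('n)"
  obtain K where K: "0 \<le> K" and cmp: "\<And>f lam N z w t. f \<in> bmo_on lam \<Omega> \<Longrightarrow> bmo_norm lam \<Omega> f \<le> ennreal N \<Longrightarrow> 0 \<le> N \<Longrightarrow> z \<in> \<Omega> \<Longrightarrow> w \<in> \<Omega> \<Longrightarrow> 0 < t \<Longrightarrow> t \<le> r1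
    \<Longrightarrow> c0 * t \<le> d z \<Longrightarrow> c0 * t \<le> d w \<Longrightarrow> dist z w \<le> 9 * H * t \<Longrightarrow> \<bar>avg f z - avg f w\<bar> \<le> K * N"
    using avg_compare by blast
  \<comment> \<open>Bounds the ratio of sides between the cube and the averaging cube at its center:
    \<open>4 * \<kappa> * H\<close> if the averaging cube is the larger one,
    \<open>1 / (2 * \<kappa>)\<close> otherwise.\<close>
  define K1 where "K1 = 4 * \<kappa> * H + 1 / (2 * \<kappa>)"
  have K1: "4 * \<kappa> * H \<le> K1" "1 / (2 * \<kappa>) \<le> K1" "0 \<le> K1" using \<kappa>_bounds H_bounds by (auto simp: K1_def)
  \<comment> \<open>For a far cube inside \<open>\<Omega>\<close>: 2 for the oscillation of
    \<open>f\<close>, the middle term for passing to the average at the center, and \<open>K\<close>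
    for passing on to \<open>zc\<close>. The other cases cost only \<open>K\<close>.\<close>
  define K2 where "K2 = 2 + K1 ^ CARD('n) * 2 + K"
  have K2: "K \<le> K2" "0 \<le> K2" using K K1 by (auto simp: K2_def)
  have n1: "?n \<le> H" using H_bounds by simp
  have "deviation (T f) (avg f (zc a l)) a l \<le> ennreal (2 * real (M ^ CARD('n)) * (K2 * N) * l ^ CARD('n))"
    if f: "f \<in> bmo_on lam \<Omega>" and N: "bmo_norm lam \<Omega> f \<le> ennreal N" "0 \<le> N" and l: "0 < l" "l \<le> s0" and near: "d a \<le> H * l" for f lam N a l
  proof (rule porous_recursion[where S = "frontier \<Omega>" and ?s0.0 = s0 and cf = "\<lambda>a l. avg f (zc a l)"])
    show "1 < M" by (rule M)
    show "T f \<in> borel_measurable lebesgue" by (rule T_measurable[OF f])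
    show "0 \<le> K2 * N" using K2 N by simp
    show "infdist a (frontier \<Omega>) \<le> (real CARD('n) + 1) * real M * l" using near by (simp add: H)
    show "\<exists>m\<in>grid_ix M. far (frontier \<Omega>) (grid_pt a l M m) (l / real M)" if "0 < l" "l \<le> s0" for a l
      using porosity that by blast
  next
    fix a l and m :: "'n \<Rightarrow> nat" assume l: "0 < l" "l \<le> s0" and nf: "\<not> far (frontier \<Omega>) a l" and m: "m \<in> grid_ix M"
    let ?h = "l / real M" and ?p = "grid_pt a l M m"
    have h: "0 < ?h" "?h \<le> s0" "H * ?h = (?n + 1) * l"
    proof -
      have "l / real M \<le> l / 1" using M l by (intro divide_left_mono) auto
      then show "?h \<le> s0" using l by simp
      show "H * ?h = (?n + 1) * l" using M by (simp add: H)
    qed (use M l in auto)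
    have a: "a \<in> cube a l" using l by (intro corner_in_cube) simp
    have p: "?p \<in> cube a l" using grid_subcube[OF m, of l a] corner_in_cube[of ?h ?p] h l by auto
    have da: "d a \<le> (?n + 1) * l" "d ?p \<le> (?n + 1) * l" using not_far_dist[OF nf a] not_far_dist[OF nf p] by auto
    have le: "(?n + 1) * l \<le> H * l" using H_bounds l by (intro mult_right_mono) auto
    have "d a \<le> H * l" "d ?p \<le> H * ?h" using da le h by auto
    note za = zc[OF l this(1)] and zp = zc[OF h(1,2) this(2)]
    show "\<bar>avg f (zc ?p ?h) - avg f (zc a l)\<bar> \<le> K2 * N"
    proof -
      have "\<bar>avg f (zc ?p ?h) - avg f (zc a l)\<bar> \<le> K * N"
      proof (rule cmp[OF f N zp(1) za(1) l(1)])
        show "l \<le> r1" using l s0 r1 by simp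
        have cl: "c0 * l \<le> c * l" using c0(3) c l by (intro mult_right_mono) auto
        have "c * (1 * l) \<le> c * ((?n + 1) * l)" using c l by (intro mult_left_mono mult_right_mono) auto
        then show "c0 * l \<le> d (zc ?p ?h)" using zp(3) cl unfolding h(3) by simp
        have "c * ((?n + 1) * l) \<le> c * (H * l)" using c le by (intro mult_left_mono) auto
        then show "c0 * l \<le> d (zc a l)" using za(3) cl \<open>c * (1 * l) \<le> _\<close> by simp
        have "dist (zc ?p ?h) (zc a l) \<le> 2 * ((?n + 1) * l) + ?n * l + 2 * (H * l)"
          using zp(2)[unfolded h(3)] za(2) dist_cube_le[OF p a] dist_triangle[of "zc ?p ?h" "zc a l" ?p] dist_triangle[of ?p "zc a l" a]
          by (simp add: dist_commute)
        also have "\<dots> \<le> 9 * (H * l)" using le mult_right_mono[OF n1, of l] mult_nonneg_nonneg[of H l] l H_bounds(3) by linarith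
        finally show "dist (zc ?p ?h) (zc a l) \<le> 9 * H * l" by simp
      qed
      also have "\<dots> \<le> K2 * N" using K2 N by (intro mult_right_mono) auto
      finally show ?thesis .
    qed
  next
    fix a l assume l: "0 < l" "l \<le> s0" and far: "far (frontier \<Omega>) a l" and "infdist a (frontier \<Omega>) \<le> (?n + 1) * real M * l"
    then have da: "d a \<le> H * l" by (simp add: H)
    note za = zc[OF l da]
    have a: "a \<in> cube a l" using l by (intro corner_in_cube) simp
    have nl: "?n * l \<le> H * l" using n1 l by (intro mult_right_mono) auto
    have Hl: "0 < H * l" using H_bounds l by simp
    have dx: "l \<le> d x" "d x \<le> 2 * (H * l)" "dist x (zc a l) \<le> 3 * (H * l)" if "x \<in> cube a l" for x
    proof -
      show "l \<le> d x" using far that by (simp add: far_def)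
      have xa: "dist x a \<le> ?n * l" by (rule dist_cube_le[OF that a])
      then show "d x \<le> 2 * (H * l)" using d_le[of x a] da nl by linarith
      show "dist x (zc a l) \<le> 3 * (H * l)" using xa za(2) nl dist_triangle[of x "zc a l" a] by (simp add: dist_commute)
    qed
    have dz: "c0 * l \<le> d (zc a l)"
    proof -
      have "c0 * l \<le> c * (1 * l)" using c0(3) c l by (simp add: mult_right_mono)
      also have "\<dots> \<le> c * (H * l)" using c l H_bounds by (intro mult_left_mono mult_right_mono) auto
      finally show ?thesis using za(3) by simp
    qed
    show "deviation (T f) (avg f (zc a l)) a l \<le> ennreal (K2 * N * l ^ CARD('n))"
      using far_cube_dichotomy[OF far l(1)]
    proof
      assume sub: "cube a l \<subseteq> \<Omega>"
      let ?p = "a + (\<chi> i. l / 2)"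
      have p: "?p \<in> cube a l" using l by (intro center_in_cube) simp
      then have pO: "?p \<in> \<Omega>" using sub by blast
      have f1: "set_integrable lebesgue (cube a l) f" by (rule bmo_on_cube[OF f l(1) sub])
      let ?m = "mean_on (cube a l) f"
      have "\<bar>?m - avg f ?p\<bar> \<le> K1 ^ CARD('n) * (2 * N)"
      proof (cases "l / 2 \<le> \<kappa> * d ?p")
        case True
        have "\<kappa> * d ?p \<le> \<kappa> * (2 * (H * l))" using dx(2)[OF p] \<kappa>_bounds by (intro mult_left_mono) auto
        also have "\<dots> = (4 * \<kappa> * H) * (l / 2)" by simp
        also have "\<dots> \<le> K1 * (l / 2)" using K1 l by (intro mult_right_mono) auto
        finally have "\<kappa> * d ?p \<le> K1 * (l / 2)" .
        then show ?thesis
          unfolding avg_def cube_as_ccube[of a l] using True l \<kappa>_bounds d_pos[OF pO]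
          by (intro mean_ccube_compare[OF f N] ccube_subset ccube_in[OF pO]) auto
      next
        case False
        have "l / 2 = (1 / (2 * \<kappa>)) * (\<kappa> * l)" using \<kappa>_bounds by simp
        also have "\<dots> \<le> K1 * (\<kappa> * d ?p)" using K1 \<kappa>_bounds dx(1)[OF p] l by (intro mult_mono) auto
        finally have "l / 2 \<le> K1 * (\<kappa> * d ?p)" .
        then have "\<bar>avg f ?p - ?m\<bar> \<le> K1 ^ CARD('n) * (2 * N)"
          unfolding avg_def cube_as_ccube[of a l] using False l \<kappa>_bounds d_pos[OF pO] sub[unfolded cube_as_ccube[of a l]]
          by (intro mean_ccube_compare[OF f N] ccube_subset) auto
        then show ?thesis by (simp add: abs_minus_commute)
      qed
      moreover have "\<bar>avg f ?p - avg f (zc a l)\<bar> \<le> K * N"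
      proof (rule cmp[OF f N pO za(1) l(1)])
        show "l \<le> r1" using l s0 r1 by simp
        have "c0 * l \<le> 1 * l" using c0 l by (intro mult_right_mono) auto
        then show "c0 * l \<le> d ?p" using dx(1)[OF p] by simp
        show "dist ?p (zc a l) \<le> 9 * H * l" using dx(3)[OF p] Hl by simp
      qed (rule dz)
      ultimately have mz: "\<bar>?m - avg f (zc a l)\<bar> \<le> (K1 ^ CARD('n) * 2 + K) * N" by (simp add: algebra_simps)
      have "mean_on (cube a l) (\<lambda>x. \<bar>f x - avg f (zc a l)\<bar>) \<le> mean_on (cube a l) (\<lambda>x. \<bar>f x - ?m\<bar> + \<bar>?m - avg f (zc a l)\<bar>)"
        by (intro mean_on_mono set_integrable_dev f1 set_integral_add(1) set_integrable_const_cube) auto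
      also have "\<dots> = mean_on (cube a l) (\<lambda>x. \<bar>f x - ?m\<bar>) + \<bar>?m - avg f (zc a l)\<bar>"
        by (simp add: mean_on_add set_integrable_dev f1 set_integrable_const_cube mean_on_const[OF l(1)])
      also have "\<dots> \<le> 2 * N + (K1 ^ CARD('n) * 2 + K) * N"
        using bmo_norm_osc[OF N l(1) sub f1] mz by simp
      also have "\<dots> = K2 * N" by (simp add: K2_def algebra_simps)
      finally have "l ^ CARD('n) * mean_on (cube a l) (\<lambda>x. \<bar>f x - avg f (zc a l)\<bar>) \<le> l ^ CARD('n) * (K2 * N)"
        using l by (intro mult_left_mono) auto
      then show ?thesis using nn_integral_mean_on[OF f1 l(1), of "avg f (zc a l)"] deviation_T_inside[OF sub] by (simp add: ennreal_leI mult.commute)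
    next
      assume ext: "cube a l \<inter> \<Omega> = {}"
      show ?thesis
      proof (rule nn_integral_cube_le)
        fix x assume x: "x \<in> cube a l"
        have "H * l < r1 / 2" by (rule s0_mult[OF l(2)])
        then have dr: "0 < d x" "d x < r1" using dx(1,2)[OF x] l by auto
        note rx = rpt[OF dr(1) less_imp_le[OF dr(2)]]
        have "\<bar>T f x - avg f (zc a l)\<bar> \<le> K * N"
        proof -
          have "\<bar>avg f (rpt x) - avg f (zc a l)\<bar> \<le> K * N"
          proof (rule cmp[OF f N rpt_in za(1) l(1)])
            show "l \<le> r1" using l s0 r1 by simp
            have "c0 * l \<le> c / 2 * l" using c0 c l by (intro mult_right_mono) auto
            also have "\<dots> \<le> c / 2 * d x" using dx(1)[OF x] c by (intro mult_left_mono) auto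
            finally show "c0 * l \<le> d (rpt x)" using rx by simp
            show "dist (rpt x) (zc a l) \<le> 9 * H * l"
              using rx(1) dx(2,3)[OF x] dist_triangle[of "rpt x" "zc a l" x] by (simp add: mult.assoc)
          qed (rule dz)
          then show ?thesis using dr ext x by (auto simp: T_def)
        qed
        also have "\<dots> \<le> K2 * N" using K2 N by (intro mult_right_mono) auto
        finally show "\<bar>T f x - avg f (zc a l)\<bar> \<le> K2 * N" .
      qed (use l K2 N in auto)
    qed
  qed (use l frontier_ne in auto)
  then show ?thesis using K2
    by (intro exI[of _ "2 * real (M ^ CARD('n)) * K2"]) (auto simp: mult.assoc)
qed

end

lemma compact_subset_ccube:
  fixes S :: "(real^'n) set"
  assumes "compact S" shows "\<exists>r>b. S \<subseteq> ccube 0 r"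
proof -
  obtain r where "\<forall>x\<in>S. norm x \<le> r" using assms compact_imp_bounded bounded_iff by blast
  then have r: "S \<subseteq> cball 0 r" by auto
  have "cball 0 r \<subseteq> ccube 0 (max r (b + 1))" for r :: real by (auto intro!: ccubeI simp: dist_commute)
  then show ?thesis using r by (intro exI[of _ "max r (b + 1)"]) auto
qed

lemma set_integrable_compact:
  fixes S :: "(real^'n) set" and g :: "real^'n \<Rightarrow> real"
  assumes "\<And>a l. b \<le> l \<Longrightarrow> set_integrable lebesgue (cube a l) g" "compact S"
  shows "set_integrable lebesgue S g"
proof -
  obtain r where r: "max b 0 < r" "S \<subseteq> ccube 0 r" using compact_subset_ccube[OF assms(2)] by blast
  have i: "set_integrable lebesgue (ccube 0 r) g" unfolding ccube_def using r by (intro assms) auto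
  show ?thesis
  proof (rule set_integrable_subset[of lebesgue "ccube 0 r"])
    show "S \<in> sets lebesgue" using assms(2) by (simp add: compact_imp_closed)
  qed (use i r in auto)
qed

section \<open>The extension at large and at small scales\<close>

context reflection
begin

lemma deep_corner_far:
  assumes l: "0 < l" and a: "\<not> d a \<le> H * l" shows "far (frontier \<Omega>) a l"
proof (rule ccontr)
  assume "\<not> far (frontier \<Omega>) a l"
  then have "d a < (real CARD('n) + 1) * l" using l by (intro not_far_dist[where a = a] corner_in_cube) auto
  also have "\<dots> \<le> H * l" using H_bounds l by (intro mult_right_mono) auto
  finally show False using a by simp
qed

text \<open>At this scale \<open>lam \<le> \<kappa> * c * l\<close>, so the second supremum bounds
  the reference average, the means over far cubes in \<open>\<Omega>\<close>, and the values on far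
  cubes outside. This is the origin of the admissible range of \<open>lam\<close>.\<close>

lemma T_top:
  "\<exists>C\<ge>0. \<forall>f lam N a l. bmo_le lam N f \<and> lam \<le> \<kappa> * c * s0 / 2 \<and> s0 / 2 \<le> l \<and> l \<le> s0 \<longrightarrow>
      deviation (T f) 0 a l \<le> ennreal (C * N * l ^ CARD('n))"
proof -
  obtain C where C: "0 \<le> C" and near: "\<And>f lam N a l. f \<in> bmo_on lam \<Omega> \<Longrightarrow> bmo_norm lam \<Omega> f \<le> ennreal N \<Longrightarrow> 0 \<le> N \<Longrightarrow> 0 < l \<Longrightarrow> l \<le> s0 \<Longrightarrow> d a \<le> H * l \<Longrightarrow>
      deviation (T f) (avg f (zc a l)) a l \<le> ennreal (C * N * l ^ CARD('n))"
    using near_cubes by blast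
  have "deviation (T f) 0 a l \<le> ennreal ((C + 1) * N * l ^ CARD('n))"
    if f: "f \<in> bmo_on lam \<Omega>" and N: "bmo_norm lam \<Omega> f \<le> ennreal N" "0 \<le> N" and lam: "lam \<le> \<kappa> * c * s0 / 2" and l: "s0 / 2 \<le> l" "l \<le> s0"
    for f lam N a l
  proof -
    have l0: "0 < l" using l s0(1) by linarith
    have kc: "\<kappa> * c * s0 / 2 \<le> \<kappa> * c * l" using mult_left_mono[OF l(1), of "\<kappa> * c"] \<kappa>_bounds c by simp
    have le: "1 * N * l ^ CARD('n) \<le> (C + 1) * N * l ^ CARD('n)" using C N l0 by (intro mult_right_mono) auto
    have lamkl: "lam \<le> \<kappa> * c * l" using kc lam by linarith
    show ?thesis
    proof (cases "d a \<le> H * l")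
      case True
      note za = zc[OF l0 l(2) True]
      let ?A = "avg f (zc a l)"
      have "\<kappa> * c * l \<le> 2 * \<kappa> * d (zc a l)"
      proof -
        have "c * (1 * l) \<le> c * (H * l)" using H_bounds c l0 by (intro mult_left_mono mult_right_mono) auto
        then have "c * l \<le> 2 * d (zc a l)" using za(3) d_pos[OF za(1)] by simp
        then have "\<kappa> * (c * l) \<le> \<kappa> * (2 * d (zc a l))" using \<kappa>_bounds by (intro mult_left_mono) auto
        then show ?thesis by simp
      qed
      then have A: "\<bar>?A\<bar> \<le> N" using lamkl by (intro avg_large[OF f N za(1)]) auto
      have [measurable]: "T f \<in> borel_measurable lebesgue" by (rule T_measurable[OF f])
      have "deviation (T f) 0 a l \<le>
         (\<integral>\<^sup>+x. ennreal \<bar>T f x - ?A\<bar> * indicator (cube a l) x + ennreal N * indicator (cube a l) x \<partial>lebesgue)"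
      proof (rule nn_integral_mono)
        fix x
        have "ennreal \<bar>T f x - 0\<bar> \<le> ennreal (\<bar>T f x - ?A\<bar> + N)" using A by (intro ennreal_leI) linarith
        then show "ennreal \<bar>T f x - 0\<bar> * indicator (cube a l) x \<le> ennreal \<bar>T f x - ?A\<bar> * indicator (cube a l) x + ennreal N * indicator (cube a l) x"
          using N by (auto simp: indicator_def ennreal_plus)
      qed
      also have "\<dots> = deviation (T f) ?A a l + ennreal N * emeasure lebesgue (cube a l)"
        by (subst nn_integral_add) (auto simp: nn_integral_cmult)
      also have "\<dots> \<le> ennreal (C * N * l ^ CARD('n)) + ennreal (N * l ^ CARD('n))"
        using near[OF f N l0 l(2) True] emeasure_cube[of l a] l0 N by (intro add_mono) (auto simp: ennreal_mult)
      also have "\<dots> = ennreal ((C + 1) * N * l ^ CARD('n))"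
        using C N l0 by (simp add: ennreal_plus[symmetric] algebra_simps del: ennreal_plus)
      finally show ?thesis .
    next
      case False
      have far: "far (frontier \<Omega>) a l" by (rule deep_corner_far[OF l0 False])
      have "deviation (T f) 0 a l \<le> ennreal (1 * N * l ^ CARD('n))"
        using far_cube_dichotomy[OF far l0]
      proof
        assume sub: "cube a l \<subseteq> \<Omega>"
        have "\<kappa> * c * l \<le> 1 * 1 * l" using \<kappa>_bounds c l0 by (intro mult_right_mono mult_mono) auto
        then have "mean_on (cube a l) (\<lambda>x. \<bar>f x - 0\<bar>) \<le> N" using bmo_norm_ge(2)[OF N l0 sub] lamkl by simp
        then have "l ^ CARD('n) * mean_on (cube a l) (\<lambda>x. \<bar>f x - 0\<bar>) \<le> l ^ CARD('n) * N" using l0 by (intro mult_left_mono) auto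
        then show ?thesis
          using nn_integral_mean_on[OF bmo_on_cube[OF f l0 sub] l0, of 0] deviation_T_inside[OF sub, of f 0] by (simp add: ennreal_leI mult.commute)
      next
        assume ext: "cube a l \<inter> \<Omega> = {}"
        have "\<bar>T f x - 0\<bar> \<le> 1 * N" if x: "x \<in> cube a l" for x
        proof -
          have dx: "l \<le> d x" using far x by (simp add: far_def)
          then have "\<kappa> * c * l \<le> \<kappa> * c * d x" using \<kappa>_bounds c by (intro mult_left_mono) auto
          then show ?thesis using T_far_outside[OF _ _ f N, of x] dx l0 lamkl ext x by auto
        qed
        then show ?thesis using l0 N by (intro nn_integral_cube_le) auto
      qed
      then show ?thesis using le ennreal_leI order_trans by blast
    qed
  qed
  then show ?thesis using C by (intro exI[of _ "C + 1"]) auto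
qed

text \<open>Rounding \<open>l / s0\<close> up to an integer gives subcubes with sides between
  \<open>s0 / 2\<close> and \<open>s0\<close>; this is why \<open>T_top\<close> covers a full factor
  of 2.\<close>

lemma T_large:
  "\<exists>C\<ge>0. \<forall>f lam N a l. bmo_le lam N f \<and> lam \<le> \<kappa> * c * s0 / 2 \<and> s0 / 2 \<le> l \<longrightarrow>
      deviation (T f) 0 a l \<le> ennreal (C * N * l ^ CARD('n))"
proof -
  obtain C where C: "0 \<le> C" and top: "\<And>f lam N a l. f \<in> bmo_on lam \<Omega> \<Longrightarrow> bmo_norm lam \<Omega> f \<le> ennreal N \<Longrightarrow> 0 \<le> N \<Longrightarrow> lam \<le> \<kappa> * c * s0 / 2 \<Longrightarrow> s0 / 2 \<le> l \<Longrightarrow> l \<le> s0 \<Longrightarrow>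
      deviation (T f) 0 a l \<le> ennreal (C * N * l ^ CARD('n))"
    using T_top by blast
  have "deviation (T f) 0 a l \<le> ennreal (C * N * l ^ CARD('n))"
    if f: "f \<in> bmo_on lam \<Omega>" and N: "bmo_norm lam \<Omega> f \<le> ennreal N" "0 \<le> N" and lam: "lam \<le> \<kappa> * c * s0 / 2" and l: "s0 / 2 \<le> l"
    for f lam N a l
  proof (cases "l \<le> s0")
    case False
    define m where "m = nat \<lceil>l / s0\<rceil>"
    have ls: "1 < l / s0" using False s0 by simp
    have m: "l / s0 \<le> real m" "real m < l / s0 + 1" using ls by (auto simp: m_def) linarith+
    have m0: "0 < m" using m ls by (cases m) auto
    have l0: "0 < l" using l s0(1) by linarith
    let ?h = "l / real m"
    have h: "?h \<le> s0" "s0 / 2 \<le> ?h"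
    proof -
      have "l \<le> real m * s0" using m(1) s0 by (simp add: field_simps)
      then show "?h \<le> s0" using m0 by (simp add: field_simps)
      have "real m * s0 < (l / s0 + 1) * s0" using m(2) s0 by (intro mult_strict_right_mono) auto
      also have "\<dots> = l + s0" using s0 by (simp add: field_simps)
      finally have "real m * s0 < 2 * l" using False by linarith
      then show "s0 / 2 \<le> ?h" using m0 by (simp add: field_simps)
    qed
    have [measurable]: "T f \<in> borel_measurable lebesgue" by (rule T_measurable[OF f])
    have "deviation (T f) 0 a l \<le>
       (\<Sum>i\<in>grid_ix m. \<integral>\<^sup>+x. ennreal \<bar>T f x - 0\<bar> * indicator (cube (grid_pt a l m i) ?h) x \<partial>lebesgue)"
      using m0 l0 by (intro nn_integral_grid_le) auto
    also have "\<dots> \<le> (\<Sum>i\<in>(grid_ix m :: ('n \<Rightarrow> nat) set). ennreal (C * N * ?h ^ CARD('n)))"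
      using h by (intro sum_mono top[OF f N lam]) auto
    also have "\<dots> = ennreal (\<Sum>i\<in>(grid_ix m :: ('n \<Rightarrow> nat) set). C * N * ?h ^ CARD('n))"
      using C N l0 by (intro sum_ennreal) auto
    also have "(\<Sum>i\<in>(grid_ix m :: ('n \<Rightarrow> nat) set). C * N * ?h ^ CARD('n)) = C * N * l ^ CARD('n)"
      using m0 by (simp add: card_grid_ix power_divide)
    finally show ?thesis .
  qed (use top[OF f N lam l] in auto)
  then show ?thesis using C by blast
qed

lemma T_osc:
  "\<exists>C\<ge>0. \<forall>f lam N a l. bmo_le lam N f \<and> lam \<le> \<kappa> * c * s0 / 2 \<and> 0 < l \<and> l \<le> s0 \<longrightarrow>
      (\<exists>k. deviation (T f) k a l \<le> ennreal (C * N * l ^ CARD('n)))"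
proof -
  obtain C where C: "0 \<le> C" and near: "\<And>f lam N a l. f \<in> bmo_on lam \<Omega> \<Longrightarrow> bmo_norm lam \<Omega> f \<le> ennreal N \<Longrightarrow> 0 \<le> N \<Longrightarrow> 0 < l \<Longrightarrow> l \<le> s0 \<Longrightarrow> d a \<le> H * l \<Longrightarrow>
      deviation (T f) (avg f (zc a l)) a l \<le> ennreal (C * N * l ^ CARD('n))"
    using near_cubes by blast
  obtain K where K: "0 \<le> K" and out: "\<And>f lam N a l. f \<in> bmo_on lam \<Omega> \<Longrightarrow> bmo_norm lam \<Omega> f \<le> ennreal N \<Longrightarrow> 0 \<le> N \<Longrightarrow> lam \<le> \<kappa> * c * s0 \<Longrightarrow> 0 < l \<Longrightarrow> l \<le> s0 \<Longrightarrow>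
      far (frontier \<Omega>) a l \<Longrightarrow> cube a l \<inter> \<Omega> = {} \<Longrightarrow> (\<exists>k. \<forall>x\<in>cube a l. \<bar>T f x - k\<bar> \<le> K * N)"
    using far_outside_osc by blast
  define B where "B = C + K + 2"
  have "\<exists>k. deviation (T f) k a l \<le> ennreal (B * N * l ^ CARD('n))"
    if f: "f \<in> bmo_on lam \<Omega>" and N: "bmo_norm lam \<Omega> f \<le> ennreal N" "0 \<le> N" and lam: "lam \<le> \<kappa> * c * s0 / 2" and l: "0 < l" "l \<le> s0"
    for f lam N a l
  proof -
    have up: "ennreal (A * N * l ^ CARD('n)) \<le> ennreal (B * N * l ^ CARD('n))" if "A \<le> B" for A
      using that N l by (intro ennreal_leI mult_right_mono) auto
    have B: "C \<le> B" "K \<le> B" "2 \<le> B" using C K by (auto simp: B_def)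
    show ?thesis
    proof (cases "d a \<le> H * l")
      case True
      then show ?thesis using near[OF f N l True] up[OF B(1)] order_trans by blast
    next
      case False
      have far: "far (frontier \<Omega>) a l" by (rule deep_corner_far[OF l(1) False])
      show ?thesis
        using far_cube_dichotomy[OF far l(1)]
      proof
        assume sub: "cube a l \<subseteq> \<Omega>"
        have f1: "set_integrable lebesgue (cube a l) f" by (rule bmo_on_cube[OF f l(1) sub])
        let ?m = "mean_on (cube a l) f"
        have "l ^ CARD('n) * mean_on (cube a l) (\<lambda>x. \<bar>f x - ?m\<bar>) \<le> l ^ CARD('n) * (2 * N)"
          using bmo_norm_osc[OF N l(1) sub f1] l by (intro mult_left_mono) auto
        then have "deviation (T f) ?m a l \<le> ennreal (2 * N * l ^ CARD('n))"
          using nn_integral_mean_on[OF f1 l(1), of ?m] deviation_T_inside[OF sub] by (simp add: ennreal_leI mult.commute)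
        then show ?thesis using up[OF B(3)] order_trans by blast
      next
        assume ext: "cube a l \<inter> \<Omega> = {}"
        have "0 \<le> \<kappa> * c * s0" using \<kappa>_bounds c s0 by simp
        then have "lam \<le> \<kappa> * c * s0" using lam by linarith
        then obtain k where "\<forall>x\<in>cube a l. \<bar>T f x - k\<bar> \<le> K * N" using out[OF f N _ l far ext] by blast
        then have "deviation (T f) k a l \<le> ennreal (K * N * l ^ CARD('n))"
          using l K N by (intro nn_integral_cube_le) auto
        then show ?thesis using up[OF B(2)] order_trans by blast
      qed
    qed
  qed
  then show ?thesis using C K by (intro exI[of _ B]) (auto simp: B_def)
qed

text \<open>Sides up to \<open>s0\<close> are handled by \<open>T_osc\<close>, larger ones by
  \<open>T_large\<close> with the constant 0. Since \<open>s0 / 2 \<le> 1\<close>, the latter also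
  covers the second supremum of the target norm.\<close>

lemma T_bmo:
  "\<exists>C\<ge>0. \<forall>f lam N. bmo_le lam N f \<and> lam \<le> \<kappa> * c * s0 / 2 \<longrightarrow>
      T f \<in> bmo_Rn \<and> bmo_Rn_norm (T f) \<le> ennreal (C * N)"
proof -
  obtain C1 where C1: "0 \<le> C1" and large: "\<And>f lam N a l. f \<in> bmo_on lam \<Omega> \<Longrightarrow> bmo_norm lam \<Omega> f \<le> ennreal N \<Longrightarrow> 0 \<le> N \<Longrightarrow> lam \<le> \<kappa> * c * s0 / 2 \<Longrightarrow> s0 / 2 \<le> l \<Longrightarrow>
      deviation (T f) 0 a l \<le> ennreal (C1 * N * l ^ CARD('n))"
    using T_large by blast
  obtain C2 where C2: "0 \<le> C2" and osc: "\<And>f lam N a l. f \<in> bmo_on lam \<Omega> \<Longrightarrow> bmo_norm lam \<Omega> f \<le> ennreal N \<Longrightarrow> 0 \<le> N \<Longrightarrow> lam \<le> \<kappa> * c * s0 / 2 \<Longrightarrow> 0 < l \<Longrightarrow> l \<le> s0 \<Longrightarrow>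
      (\<exists>k. deviation (T f) k a l \<le> ennreal (C2 * N * l ^ CARD('n)))"
    using T_osc by blast
  have "T f \<in> bmo_Rn \<and> bmo_Rn_norm (T f) \<le> ennreal ((2 * C1 + 2 * C2 + C1) * N)"
    if f: "f \<in> bmo_on lam \<Omega>" and N: "bmo_norm lam \<Omega> f \<le> ennreal N" "0 \<le> N" and lam: "lam \<le> \<kappa> * c * s0 / 2"
    for f lam N
  proof -
    have int: "set_integrable lebesgue (cube a l) (T f)" if "s0 / 2 \<le> l" for a l
      by (rule set_integrable_of_nn[OF T_measurable[OF f] large[OF f N lam that]])
    have cpt: "set_integrable lebesgue S (T f)" if "compact S" for S
      using set_integrable_compact[of "s0 / 2", OF int that] .
    have CN: "0 \<le> C1 * N" "0 \<le> C2 * N" using C1 C2 N by auto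
    have s01: "s0 / 2 \<le> 1" using s0 r1 by linarith
    have big: "mean_on (cube a l) (\<lambda>x. \<bar>T f x - 0\<bar>) \<le> C1 * N" if l: "s0 / 2 \<le> l" for a l
      using large[OF f N lam l] CN l s0(1) by (intro mean_on_le_nn cpt compact_cube) auto
    have "bmo_norm 1 UNIV (T f) \<le> ennreal ((2 * (C1 * N) + 2 * (C2 * N)) + C1 * N)"
    proof (rule bmo_norm_le)
      fix a :: "real^'n" and l :: real assume l: "0 < l"
      have i: "set_integrable lebesgue (cube a l) (T f)" by (intro cpt compact_cube)
      show "mean_on (cube a l) (\<lambda>x. \<bar>T f x - mean_on (cube a l) (T f)\<bar>) \<le> 2 * (C1 * N) + 2 * (C2 * N)"
      proof (cases "l \<le> s0")
        case True
        obtain k where "deviation (T f) k a l \<le> ennreal (C2 * N * l ^ CARD('n))"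
          using osc[OF f N lam l True] by blast
        then have "mean_on (cube a l) (\<lambda>x. \<bar>T f x - k\<bar>) \<le> C2 * N"
          using CN by (intro mean_on_le_nn[OF i l]) auto
        then show ?thesis using mean_osc_le[OF i l, of k] CN by linarith
      next
        case False
        then have "mean_on (cube a l) (\<lambda>x. \<bar>T f x - 0\<bar>) \<le> C1 * N" using s0(1) by (intro big) auto
        then show ?thesis using mean_osc_le[OF i l, of 0] CN by linarith
      qed
      assume "1 \<le> l"
      then show "mean_on (cube a l) (\<lambda>x. \<bar>T f x\<bar>) \<le> C1 * N" using big[of l a] s01 by simp
    qed (use CN in auto)
    then have le: "bmo_Rn_norm (T f) \<le> ennreal ((2 * C1 + 2 * C2 + C1) * N)"
      by (simp add: bmo_Rn_norm_def algebra_simps)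
    moreover have "T f \<in> bmo_Rn" unfolding bmo_Rn_def using cpt le by (auto intro: le_less_trans)
    ultimately show ?thesis by blast
  qed
  then show ?thesis using C1 C2 by (intro exI[of _ "2 * C1 + 2 * C2 + C1"]) auto
qed

lemma avg_linear:
  assumes f: "f \<in> bmo_on lam \<Omega>" and g: "g \<in> bmo_on lam \<Omega>" and z: "z \<in> \<Omega>"
  shows "avg (\<lambda>x. a * f x + b * g x) z = a * avg f z + b * avg g z"
proof -
  have h: "0 < \<kappa> * d z" "\<kappa> * d z \<le> 4 * \<kappa> * d z" using d_pos[OF z] \<kappa>_bounds by auto
  have sub: "ccube z (\<kappa> * d z) \<subseteq> \<Omega>" by (rule ccube_in[OF z h(2)])
  note i = bmo_on_ccube[OF f h(1) sub] bmo_on_ccube[OF g h(1) sub]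
  have "set_integrable lebesgue (ccube z (\<kappa> * d z)) (\<lambda>x. a * f x)" "set_integrable lebesgue (ccube z (\<kappa> * d z)) (\<lambda>x. b * g x)"
    using i by auto
  then show ?thesis unfolding avg_def ccube_def by (simp add: mean_on_add mean_on_cmult)
qed

lemma T_extension:
  assumes lam: "lam \<le> \<kappa> * c * s0 / 2"
  shows "extension_operator lam \<Omega> T" "bounded_operator lam \<Omega> T" "linear_operator lam \<Omega> T"
proof -
  obtain C where C: "0 \<le> C" and bnd: "\<And>f N. f \<in> bmo_on lam \<Omega> \<Longrightarrow> bmo_norm lam \<Omega> f \<le> ennreal N \<Longrightarrow> 0 \<le> N \<Longrightarrow> 
      T f \<in> bmo_Rn \<and> bmo_Rn_norm (T f) \<le> ennreal (C * N)"
    using T_bmo lam by blast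
  have main: "T f \<in> bmo_Rn" "bmo_Rn_norm (T f) \<le> ennreal C * bmo_norm lam \<Omega> f" if f: "f \<in> bmo_on lam \<Omega>" for f
  proof -
    obtain N where N: "bmo_norm lam \<Omega> f = ennreal N" "0 \<le> N"
      using f by (cases "bmo_norm lam \<Omega> f") (auto simp: bmo_on_def)
    show "T f \<in> bmo_Rn" "bmo_Rn_norm (T f) \<le> ennreal C * bmo_norm lam \<Omega> f"
      using bnd[OF f, of N] N C by (auto simp: ennreal_mult)
  qed
  show "extension_operator lam \<Omega> T"
    unfolding extension_operator_def
  proof (intro conjI ballI impI)
    fix f g :: "real^'n \<Rightarrow> real" assume "\<forall>x\<in>\<Omega>. f x = g x"
    then have "avg f (rpt x) = avg g (rpt x)" for x by (intro avg_cong[OF rpt_in]) auto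
    with \<open>\<forall>x\<in>\<Omega>. f x = g x\<close> show "T f = T g" by (intro ext) (simp add: T_def)
  qed (auto simp: main T_def)
  show "bounded_operator lam \<Omega> T" unfolding bounded_operator_def using main(2) by blast
  show "linear_operator lam \<Omega> T"
    unfolding linear_operator_def T_def by (auto simp: fun_eq_iff avg_linear[OF _ _ rpt_in])
qed

end

lemma (in local_uniform) eps_delta_imp_extension:
  "\<exists>lam0>0. \<forall>lam. 0 < lam \<and> lam \<le> lam0 \<longrightarrow> (\<exists>T. extension_operator lam \<Omega> T \<and> bounded_operator lam \<Omega> T \<and> linear_operator lam \<Omega> T)"
proof -
  obtain c' r' where c': "0 < c'" and r': "0 < r'" 
    and cork: "\<And>x t. 0 < t \<Longrightarrow> t \<le> r' \<Longrightarrow> d x \<le> t \<Longrightarrow> \<exists>z\<in>\<Omega>. dist z x \<le> 2 * t \<and> c' * t \<le> d z"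
    using corkscrew by blast
  define c where "c = min c' 1"
  have c: "0 < c" "c \<le> 1" "c \<le> c'" using c' by (auto simp: c_def)
  obtain M0 :: nat where M0: "8 * (real CARD('n) + 1) / c \<le> real M0" using real_arch_simple by blast
  define M where "M = M0 + 2"
  have M: "1 < M" "8 * (real CARD('n) + 1) \<le> c * real M"
  proof -
    have "8 * (real CARD('n) + 1) / c \<le> real M" using M0 by (simp add: M_def)
    then show "8 * (real CARD('n) + 1) \<le> c * real M" using c by (simp add: pos_divide_le_eq mult.commute)
  qed (simp add: M_def)
  define H where "H = (real CARD('n) + 1) * real M"
  have H: "0 < H" using M by (simp add: H_def)
  \<comment> \<open>The entry 1 makes unit cubes count as large, and dividing by 10 leaves the
    inequality \<open>9 * H * r1 < \<delta>\<close> strict.\<close>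
  define r1 where "r1 = min r' (min 1 (\<delta> / (10 * H)))"
  have r1: "0 < r1" "r1 \<le> r'" "r1 \<le> 1" using r' \<delta> H by (auto simp: r1_def)
  have "H * r1 \<le> H * (\<delta> / (10 * H))" using H by (intro mult_left_mono) (auto simp: r1_def)
  also have "\<dots> = \<delta> / 10" using H by simp
  finally have r1\<delta>: "9 * H * r1 < \<delta>" using \<delta> by simp
  obtain D where D: "countable D" "\<And>X. open X \<Longrightarrow> X \<noteq> {} \<Longrightarrow> \<exists>x\<in>D. x \<in> (X :: (real^'n) set)"
    using countable_dense_setE[where 'a="real^'n"] by metis
  have DO: "D \<inter> \<Omega> \<noteq> {}" using D(2)[OF openO neO] by blast
  define q where "q = from_nat_into (D \<inter> \<Omega>)"
  interpret reflection \<Omega> \<kappa> \<epsilon> \<delta> c r1 H M q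
  proof unfold_locales
    show "\<exists>z\<in>\<Omega>. dist z x \<le> 2 * t \<and> c * t \<le> d z" if t: "0 < t" "t \<le> r1" "d x \<le> t" for x t
    proof -
      have "c * t \<le> c' * t" using c t by (intro mult_right_mono) auto
      moreover have "t \<le> r'" using t r1 by linarith
      then obtain z where "z \<in> \<Omega>" "dist z x \<le> 2 * t" "c' * t \<le> d z" using cork[OF t(1) _ t(3)] by blast
      ultimately show ?thesis by (intro bexI[of _ z]) auto
    qed
    show "q i \<in> \<Omega>" for i using from_nat_into[OF DO, of i] by (simp add: q_def)
    show "\<exists>i. q i \<in> U" if U: "open U" "U \<inter> \<Omega> \<noteq> {}" for U
    proof -
      obtain x where x: "x \<in> D" "x \<in> U \<inter> \<Omega>" using D(2)[of "U \<inter> \<Omega>"] U openO by blast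
      then have "x \<in> range q" unfolding q_def using D(1) DO by (subst range_from_nat_into) auto
      then show ?thesis using x by auto
    qed
  qed (use c r1 r1\<delta> M H_def in auto)
  have "0 < \<kappa> * c * s0 / 2" using \<kappa>_bounds c s0 by simp
  then show ?thesis using T_extension by blast
qed

lemma linepath_eps_delta: "eps_delta_domain 1 1 (UNIV :: (real^'n) set)"
  unfolding eps_delta_domain_def
proof (intro ballI impI)
  fix x y :: "real^'n"
  have "arclength (linepath x y) \<le> ennreal (dist x y)" by (rule arclength_le[OF len_le_linepath])
  moreover from this have "arclength (linepath x y) < \<infinity>" by (simp add: le_less_trans)
  ultimately show "\<exists>\<gamma>. path \<gamma> \<and> path_image \<gamma> \<subseteq> UNIV \<and> pathstart \<gamma> = x \<and> pathfinish \<gamma> = y \<and> arclength \<gamma> < \<infinity> \<and>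
      arclength \<gamma> \<le> ennreal (dist x y / 1) \<and> (\<forall>z\<in>path_image \<gamma>. ereal (1 * (dist z x * dist z y / dist x y)) \<le> dist_boundary UNIV z)"
    by (intro exI[of _ "linepath x y"]) (simp add: dist_boundary_def)
qed

text \<open>Only the threshold moves, from \<open>lam\<close> up to 1: \<open>bmo_norm_osc\<close>
  bounds the oscillation by twice the norm at all sides, and sides from 1 on are also at least
  \<open>lam\<close>.\<close>

lemma identity_extension:
  assumes lam: "0 < lam" "lam \<le> 1"
  shows "extension_operator lam (UNIV :: (real^'n) set) id \<and> bounded_operator lam (UNIV :: (real^'n) set) id \<and> linear_operator lam (UNIV :: (real^'n) set) id"
proof -
  have main: "f \<in> bmo_Rn" "bmo_Rn_norm f \<le> ennreal 3 * bmo_norm lam UNIV f" if f: "f \<in> bmo_on lam UNIV" for f :: "real^'n \<Rightarrow> real"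
  proof -
    have int: "set_integrable lebesgue (cube a l) f" if "0 < l" for a l using f that by (simp add: bmo_on_def)
    obtain N where N: "bmo_norm lam UNIV f = ennreal N" "0 \<le> N"
      using f by (cases "bmo_norm lam UNIV f") (auto simp: bmo_on_def)
    then have Nle: "bmo_norm lam UNIV f \<le> ennreal N" by simp
    have "bmo_norm 1 UNIV f \<le> ennreal (2 * N + N)"
      using lam N bmo_norm_osc[OF Nle N(2) _ _ int] bmo_norm_ge(2)[OF Nle N(2)] by (intro bmo_norm_le) auto
    also have "\<dots> = ennreal 3 * bmo_norm lam UNIV f" using N by (simp add: ennreal_mult[symmetric] del: ennreal_numeral)
    finally show le: "bmo_Rn_norm f \<le> ennreal 3 * bmo_norm lam UNIV f" by (simp add: bmo_Rn_norm_def)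
    have "set_integrable lebesgue S f" if "compact S" for S
      using set_integrable_compact[of 1 f S] int that by auto
    moreover have "bmo_Rn_norm f < \<infinity>" using le N by (simp add: ennreal_mult[symmetric] le_less_trans del: ennreal_numeral)
    ultimately show "f \<in> bmo_Rn" by (simp add: bmo_Rn_def)
  qed
  then show ?thesis
    unfolding extension_operator_def bounded_operator_def linear_operator_def
    by (auto intro!: exI[of _ "3::real"])
qed

theorem theorem1p1:
  fixes \<Omega> :: "(real^'n) set"
  assumes "is_domain \<Omega>"
  shows "(\<forall>\<epsilon>>0. \<forall>\<delta>>0. eps_delta_domain \<epsilon> \<delta> \<Omega> \<longrightarrow>
            (\<exists>lam0>0. \<forall>lam. 0 < lam \<and> lam \<le> lam0 \<longrightarrow>
               (\<exists>T. extension_operator lam \<Omega> T \<and> bounded_operator lam \<Omega> T \<and> linear_operator lam \<Omega> T)))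
       \<and> (\<forall>lam>0. (\<exists>T. extension_operator lam \<Omega> T \<and> bounded_operator lam \<Omega> T) \<longrightarrow>
            (\<exists>\<epsilon>>0. \<exists>\<delta>>0. eps_delta_domain \<epsilon> \<delta> \<Omega>))"
\<comment> \<open>The whole space has empty frontier, to which \<open>infdist\<close> assigns the
  value 0, so chains would not see any depth there.\<close>
proof (cases "\<Omega> = UNIV")
  case True
  show ?thesis unfolding True using identity_extension linepath_eps_delta zero_less_one by blast
next
  case False
  interpret proper_domain \<Omega> "1 / (100 * real CARD('n))"
    using assms False by unfold_locales auto
  have "\<exists>lam0>0. \<forall>lam. 0 < lam \<and> lam \<le> lam0 \<longrightarrow>
      (\<exists>T. extension_operator lam \<Omega> T \<and> bounded_operator lam \<Omega> T \<and> linear_operator lam \<Omega> T)"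
    if "0 < \<epsilon>" "0 < \<delta>" "eps_delta_domain \<epsilon> \<delta> \<Omega>" for \<epsilon> \<delta>
  proof -
    interpret local_uniform \<Omega> "1 / (100 * real CARD('n))" \<epsilon> \<delta>
      using that by unfold_locales
    show ?thesis by (rule eps_delta_imp_extension)
  qed
  then show ?thesis using extension_imp_eps_delta by blast
qed

end
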